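(* Let $1<p<\infty$ and let $f_+=BO_+\in H_p^+\setminus\{0\}$, where $B$ is a finite Blaschke product and $O_+$ is outer in $H_p^+$. Let $O_-$ be any square rigid outer function in $H_p^-$. Then the minimal kernel $K^*_{\min}(f_+)$ exists and $$K^*_{\min}(f_+)=\ker T_{O_-\overline{B}(O_+)^{-1}}=O_+\,(\xi+i)\,K_{rB}.$$
   Context: $L_p=L^p(\mathbb R)$; $H_p^+=H^p(\mathbb C^+)$ and $H_p^-=\overline{H_p^+}=H^p(\mathbb C^-)$ are the Hardy spaces of the upper and lower half-planes, identified with closed subspaces of $L_p$ via boundary values; $P^+$ is the projection of $L_p$ onto $H_p^+$ parallel to $H_p^-$. $\sigma_p$ is the class of measurable functions $g$ on $\mathbb R$ for which there exists $\phi\in H_p^+\setminus\{0\}$ with $g\phi\in L_p$. For $g\in\sigma_p$ the (possibly unbounded) Toeplitz operator $T_g$ has domain $D(T_g)=\{\phi_+\in H_p^+: g\phi_+\in L_p\}$ and $T_g\phi_+=P^+(g\phi_+)$; thus $\ker T_g=\{\phi_+\in H_p^+: g\phi_+\in H_p^-\}$. $K^*_{\min}(f_+)$ denotes, if it exists, the kernel $\ker T_k$ with $k\in\sigma_p$ and $f_+\in\ker T_k$ such that $\ker T_k\subset\ker T_h$ for every $h\in\sigma_p$ with $f_+\in\ker T_h$. $r(\xi)=\frac{\xi-i}{\xi+i}$, and for an inner function $\theta$, $K_\theta=\ker T_{\overline\theta}\subset H_p^+$ is the model space. A function $f\in H_q^+\setminus\{0\}$ ($q>0$) is rigid if every $g\in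 H_q^+$ with $g/f>0$ a.e. on $\mathbb R$ satisfies $g=\lambda f$ for some $\lambda\in\mathbb R^+$. An outer function $\psi_+\in H_p^+$ is square rigid if $\psi_+^2$ is rigid in $H_{p/2}^+$. A function $O_-\in H_p^-$ is outer (resp. square rigid) if $\overline{O_-}$ is outer (resp. square rigid) in $H_p^+$. Finite Blaschke products are for $\mathbb C^+$. *)

theory Defs
  imports "HOL-Complex_Analysis.Complex_Analysis"
begin

text \<open>
  Elements of \<open>L\<^sub>p(\<real>)\<close> are represented by Lebesgue measurable functions rather than by
  equivalence classes.  All sets of functions below are closed under almost everywhere equality
  (they are unions of equivalence classes), so equality and inclusion of such sets have
  the same meaning as for the corresponding subsets of \<open>L\<^sub>p(\<real>)\<close>.
\<close>

definition Lp :: "real \<Rightarrow> (real \<Rightarrow> complex) set" where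
  "Lp p = {f \<in> borel_measurable lebesgue. integrable lebesgue (\<lambda>x. norm (f x) powr p)}"


section \<open>Hardy spaces of the half-planes\<close>

definition upper_half_plane :: "complex set" where
  "upper_half_plane = {z. Im z > 0}"

definition hardy_fun :: "real \<Rightarrow> (complex \<Rightarrow> complex) \<Rightarrow> bool" where
  "hardy_fun p F \<longleftrightarrow> F holomorphic_on upper_half_plane \<and>
     (SUP y\<in>{0<..}. \<integral>\<^sup>+x. ennreal (norm (F (Complex x y)) powr p) \<partial>lebesgue) < \<infinity>"

definition nontangential_limit :: "(complex \<Rightarrow> complex) \<Rightarrow> real \<Rightarrow> complex \<Rightarrow> bool" where
  "nontangential_limit F x l \<longleftrightarrow>
     (\<forall>a>0. (F \<longlongrightarrow> l) (at (complex_of_real x) within {z. Im z > 0 \<and> \<bar>Re z - x\<bar> < a * Im z}))"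

definition boundary_value :: "(complex \<Rightarrow> complex) \<Rightarrow> (real \<Rightarrow> complex) \<Rightarrow> bool" where
  "boundary_value F f \<longleftrightarrow> (AE x in lebesgue. nontangential_limit F x (f x))"

definition hardy_plus :: "real \<Rightarrow> (real \<Rightarrow> complex) set" where
  "hardy_plus p = {f \<in> Lp p. \<exists>F. hardy_fun p F \<and> boundary_value F f}"

definition hardy_minus :: "real \<Rightarrow> (real \<Rightarrow> complex) set" where
  "hardy_minus p = {f. (\<lambda>x. cnj (f x)) \<in> hardy_plus p}"


section \<open>Outer, rigid and square rigid functions\<close>

text \<open>
  The function \<open>exp ((1/\<pi>\<i>) \<integral> (1/(t-z) - t/(1+t\<^sup>2)) u(t) dt)\<close>, whose modulus on the boundary is
  \<open>exp u\<close>.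
\<close>

definition outer_exp :: "(real \<Rightarrow> real) \<Rightarrow> complex \<Rightarrow> complex" where
  "outer_exp u z =
     exp (1 / (of_real pi * \<i>) *
       (LINT t|lebesgue. (1 / (of_real t - z) - of_real (t / (1 + t\<^sup>2))) * of_real (u t)))"

text \<open>The condition \<open>f t \<noteq> 0\<close> excludes the points where \<open>ln 0 = 0\<close> would differ from \<open>-\<infinity>\<close>.\<close>

definition outer_plus :: "real \<Rightarrow> (real \<Rightarrow> complex) \<Rightarrow> bool" where
  "outer_plus p f \<longleftrightarrow> f \<in> Lp p \<and>
     (AE t in lebesgue. f t \<noteq> 0) \<and>
     integrable lebesgue (\<lambda>t. ln (norm (f t)) / (1 + t\<^sup>2)) \<and>
     (\<exists>c. norm c = 1 \<and>
        hardy_fun p (\<lambda>z. c * outer_exp (\<lambda>t. ln (norm (f t))) z) \<and>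
        boundary_value (\<lambda>z. c * outer_exp (\<lambda>t. ln (norm (f t))) z) f)"

definition rigid :: "real \<Rightarrow> (real \<Rightarrow> complex) \<Rightarrow> bool" where
  "rigid q f \<longleftrightarrow> f \<in> hardy_plus q \<and> \<not> (AE x in lebesgue. f x = 0) \<and>
     (\<forall>g \<in> hardy_plus q.
        (AE x in lebesgue. g x / f x \<in> \<real> \<and> Re (g x / f x) > 0) \<longrightarrow>
        (\<exists>l::real. l > 0 \<and> (AE x in lebesgue. g x = of_real l * f x)))"

definition square_rigid_plus :: "real \<Rightarrow> (real \<Rightarrow> complex) \<Rightarrow> bool" where
  "square_rigid_plus p f \<longleftrightarrow> outer_plus p f \<and> rigid (p / 2) (\<lambda>x. (f x)\<^sup>2)"

definition outer_minus :: "real \<Rightarrow> (real \<Rightarrow> complex) \<Rightarrow> bool" where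
  "outer_minus p f \<longleftrightarrow> outer_plus p (\<lambda>x. cnj (f x))"

definition square_rigid_minus :: "real \<Rightarrow> (real \<Rightarrow> complex) \<Rightarrow> bool" where
  "square_rigid_minus p f \<longleftrightarrow> square_rigid_plus p (\<lambda>x. cnj (f x))"

text \<open>
  Constants of modulus one are included (empty list of zeros); the usual normalising unimodular
  factors are absorbed in \<open>c\<close>.
\<close>

definition finite_blaschke :: "(complex \<Rightarrow> complex) \<Rightarrow> bool" where
  "finite_blaschke B \<longleftrightarrow>
     (\<exists>c as. norm c = 1 \<and> (\<forall>a\<in>set as. Im a > 0) \<and>
        B = (\<lambda>z. c * (\<Prod>a\<leftarrow>as. (z - a) / (z - cnj a))))"


section \<open>Toeplitz operators and their kernels\<close>

definition symbol_class :: "real \<Rightarrow> (real \<Rightarrow> complex) set" where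
  "symbol_class p = {g \<in> borel_measurable lebesgue.
     \<exists>\<phi>\<in>hardy_plus p. \<not> (AE x in lebesgue. \<phi> x = 0) \<and> (\<lambda>x. g x * \<phi> x) \<in> Lp p}"

text \<open>
  The projection \<open>P\<^sup>+\<close> onto \<open>H\<^sub>p\<^sup>+\<close> parallel to \<open>H\<^sub>p\<^sup>-\<close> and the Toeplitz operator are given by their
  graphs: \<open>riesz_projection p h u\<close> reads \<open>P\<^sup>+ h = u\<close>, and \<open>toeplitz p g \<phi> u\<close> reads
  \<open>\<phi> \<in> D(T\<^sub>g)\<close> and \<open>T\<^sub>g \<phi> = u\<close> (equalities almost everywhere).
\<close>

definition riesz_projection :: "real \<Rightarrow> (real \<Rightarrow> complex) \<Rightarrow> (real \<Rightarrow> complex) \<Rightarrow> bool" where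
  "riesz_projection p h u \<longleftrightarrow>
     h \<in> Lp p \<and> u \<in> hardy_plus p \<and> (\<lambda>x. h x - u x) \<in> hardy_minus p"

definition toeplitz_domain :: "real \<Rightarrow> (real \<Rightarrow> complex) \<Rightarrow> (real \<Rightarrow> complex) set" where
  "toeplitz_domain p g = {\<phi> \<in> hardy_plus p. (\<lambda>x. g x * \<phi> x) \<in> Lp p}"

definition toeplitz ::
    "real \<Rightarrow> (real \<Rightarrow> complex) \<Rightarrow> (real \<Rightarrow> complex) \<Rightarrow> (real \<Rightarrow> complex) \<Rightarrow> bool" where
  "toeplitz p g \<phi> u \<longleftrightarrow>
     \<phi> \<in> toeplitz_domain p g \<and> riesz_projection p (\<lambda>x. g x * \<phi> x) u"

definition toeplitz_kernel :: "real \<Rightarrow> (real \<Rightarrow> complex) \<Rightarrow> (real \<Rightarrow> complex) set" where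
  "toeplitz_kernel p g = {\<phi>. toeplitz p g \<phi> (\<lambda>x. 0)}"

definition is_min_kernel :: "real \<Rightarrow> (real \<Rightarrow> complex) \<Rightarrow> (real \<Rightarrow> complex) set \<Rightarrow> bool" where
  "is_min_kernel p f K \<longleftrightarrow>
     (\<exists>k\<in>symbol_class p. K = toeplitz_kernel p k) \<and> f \<in> K \<and>
     (\<forall>h\<in>symbol_class p. f \<in> toeplitz_kernel p h \<longrightarrow> K \<subseteq> toeplitz_kernel p h)"

definition min_kernel_exists :: "real \<Rightarrow> (real \<Rightarrow> complex) \<Rightarrow> bool" where
  "min_kernel_exists p f \<longleftrightarrow> (\<exists>K. is_min_kernel p f K)"

definition min_kernel :: "real \<Rightarrow> (real \<Rightarrow> complex) \<Rightarrow> (real \<Rightarrow> complex) set" where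
  "min_kernel p f = (THE K. is_min_kernel p f K)"

text \<open>Meaningful for \<open>\<theta>\<close> the boundary function of an inner function.\<close>

definition model_space :: "real \<Rightarrow> (real \<Rightarrow> complex) \<Rightarrow> (real \<Rightarrow> complex) set" where
  "model_space p \<theta> = toeplitz_kernel p (\<lambda>x. cnj (\<theta> x))"

definition r_fun :: "complex \<Rightarrow> complex" where
  "r_fun z = (z - \<i>) / (z + \<i>)"

text \<open>The set \<open>w K\<close> of products \<open>w k\<close> with \<open>k \<in> K\<close>, closed under almost everywhere equality.\<close>

definition mult_set :: "(real \<Rightarrow> complex) \<Rightarrow> (real \<Rightarrow> complex) set \<Rightarrow> (real \<Rightarrow> complex) set" where
  "mult_set w K = {\<phi> \<in> borel_measurable lebesgue.
     \<exists>k\<in>K. AE x in lebesgue. \<phi> x = w x * k x}"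


section \<open>Consistency of the definitions\<close>

lemma zero_in_hardy_plus: "p > 0 \<Longrightarrow> (\<lambda>x. 0) \<in> hardy_plus p"
proof -
  assume "p > 0"
  then have "hardy_fun p (\<lambda>z. 0)" by (simp add: hardy_fun_def)
  moreover have "boundary_value (\<lambda>z. 0) (\<lambda>x. 0)"
    by (simp add: boundary_value_def nontangential_limit_def)
  moreover have "(\<lambda>x. 0) \<in> Lp p" using \<open>p > 0\<close> by (simp add: Lp_def)
  ultimately show ?thesis unfolding hardy_plus_def by blast
qed

lemma hardy_minus_subset_Lp: "hardy_minus p \<subseteq> Lp p"
proof
  fix f assume "f \<in> hardy_minus p"
  then have f: "(\<lambda>x. cnj (f x)) \<in> borel_measurable lebesgue"
      "integrable lebesgue (\<lambda>x. norm (f x) powr p)"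
    by (auto simp: hardy_minus_def hardy_plus_def Lp_def)
  have "(\<lambda>x. cnj (cnj (f x))) \<in> borel_measurable lebesgue"
    by (rule borel_measurable_continuous_on[OF _ f(1)]) (intro continuous_intros)
  with f show "f \<in> Lp p" by (simp add: Lp_def)
qed

lemma toeplitz_kernel_eq:
  assumes "p > 0"
  shows "toeplitz_kernel p g = {\<phi> \<in> hardy_plus p. (\<lambda>x. g x * \<phi> x) \<in> hardy_minus p}"
  using zero_in_hardy_plus[OF assms] hardy_minus_subset_Lp[of p]
  by (auto simp: toeplitz_kernel_def toeplitz_def toeplitz_domain_def riesz_projection_def)

lemma is_min_kernel_unique: "is_min_kernel p f K \<Longrightarrow> is_min_kernel p f K' \<Longrightarrow> K = K'"
  unfolding is_min_kernel_def by (rule subset_antisym) (elim conjE bexE; simp)+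

lemma min_kernel_eqI: "is_min_kernel p f K \<Longrightarrow> min_kernel p f = K"
  unfolding min_kernel_def by (rule the_equality) (assumption, erule is_min_kernel_unique)

end

(*
  Let n be the degree of B = c A / A#, with A the product of the z - a_j and A# = conj A on the real
  line. Both ker T_g, for the symbol g of the theorem, and O_+ (x + i) K_{rB} consist of the functions
  O_+ q / A# with q a polynomial of degree at most n. For such a function \<phi> and any h with h f
  in H_p^-, the function h \<phi> = h f q / (c A) is in H_p^- because q / A is bounded in the lower
  half-plane; this gives minimality.

  To describe ker T_g, write \<phi> = t O_+ / A# and o = conj O_-. Smirnov's theorem gives t o / A# in H_p^+,
  and g \<phi> in H_p^- says that conj t o / A# is in H_p^+. So the real and imaginary parts u of t satisfy
  u o / A# in H_p^+. For n = 0, square rigidity of o makes u constant. The zeros are removed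
  one at a time: subtracting a real linear function from u makes the analytic extension vanish
  at a_j, which allows division by |x - a_j|^2; the degree is controlled because x o is not
  in H_p^+. The model space is the same computation with o = O_+ = 1 / (x + i).
*)

theory Submission
  imports Defs "HOL-Probability.Sinc_Integral" "HOL-Real_Asymp.Real_Asymp"
begin

section \<open>Poisson integrals\<close>


text \<open>A Hardy function is given only by bounded integrals over horizontal lines and by
  nontangential limits, an outer function only as the exponential of a logarithmic integral. The
  bridge between the two is the inequality ln |F z| <= P[ln |f|] with the Poisson integral P, which
  is an equality for outer functions. It is proved for the shifts F (z + i/(n+1)), which are bounded
  and continue across the real line, and then carried to the boundary: p > 1 supplies uniform
  integrability, and Fatou's lemma handles the logarithm.

  Rigidity compares only functions with a positive quotient, so it speaks about real multipliers
  alone. Hence every zero has to be removed in a way that keeps the multiplier real: the factor 1/(x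
  - cnj a) is already present in 1/A#, and dividing out the zero created at a completes it to the
  real number 1/|x - a|^2.\<close>

lemma borel_measurable_lebesgue_ident [measurable]: "(\<lambda>x::real. x) \<in> borel_measurable lebesgue"
  by (rule measurable_completion) simp

lemma borel_imp_lebesgue_measurable:
  fixes f :: "real \<Rightarrow> 'a::topological_space"
  shows "f \<in> borel_measurable borel \<Longrightarrow> f \<in> borel_measurable lebesgue"
  by (rule measurable_completion) simp

definition poisson :: "complex \<Rightarrow> real \<Rightarrow> real" where
  "poisson z t = Im z / (pi * (norm (of_real t - z))\<^sup>2)"

lemma poisson_eq: "poisson z t = Im z / (pi * ((t - Re z)\<^sup>2 + (Im z)\<^sup>2))"
  by (simp add: poisson_def cmod_power2)

lemma poisson_pos: "Im z > 0 \<Longrightarrow> poisson z t > 0"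
  unfolding poisson_eq by (intro divide_pos_pos mult_pos_pos) (auto simp: add_nonneg_pos)

lemma poisson_nonneg: "Im z > 0 \<Longrightarrow> poisson z t \<ge> 0"
  using poisson_pos by (simp add: less_imp_le)

lemma poisson_measurable [measurable]: "poisson z \<in> borel_measurable borel"
  unfolding poisson_def[abs_def] by measurable

lemma poisson_measurable_lebesgue [measurable]: "poisson z \<in> borel_measurable lebesgue"
  by (rule borel_imp_lebesgue_measurable) measurable

lemma poisson_le: "Im z > 0 \<Longrightarrow> poisson z t \<le> 1 / (pi * Im z)"
  unfolding poisson_eq
  by (rule order_trans[OF divide_left_mono[of "pi * (Im z)\<^sup>2"]])
     (auto simp: power2_eq_square intro!: mult_pos_pos add_nonneg_pos)

lemma has_bochner_integral_inverse_1_plus_square: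
  "has_bochner_integral lborel (\<lambda>x::real. 1 / (1 + x\<^sup>2)) pi"
proof -
  have i: "integrable lborel (\<lambda>x::real. 1 / (1 + x\<^sup>2))"
    using integrable_inverse_1_plus_square by (simp add: set_integrable_def inverse_eq_divide)
  have "(LINT x::real|lborel. 1 / (1 + x\<^sup>2)) = pi"
    using LBINT_inverse_1_plus_square
    by (simp add: interval_lebesgue_integral_def set_lebesgue_integral_def inverse_eq_divide)
  with i show ?thesis by (simp add: has_bochner_integral_iff)
qed

text \<open>The substitution \<open>s = (x - Re z) / Im z\<close> reduces the kernel to the
  derivative of the arctangent.\<close>

lemma has_bochner_integral_poisson:
  assumes "Im z > 0"
  shows "has_bochner_integral lborel (poisson z) 1"
proof -
  have "has_bochner_integral lborel (\<lambda>x. 1 / (1 + (- Re z / Im z + (1 / Im z) * x)\<^sup>2)) (pi /\<^sub>R \<bar>1 / Im z\<bar>)"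
    by (rule lborel_has_bochner_integral_real_affine_iff[THEN iffD1, rotated,
          OF has_bochner_integral_inverse_1_plus_square]) (use assms in simp)
  then have "has_bochner_integral lborel (\<lambda>x. (1 / (pi * Im z)) * (1 / (1 + (- Re z / Im z + (1 / Im z) * x)\<^sup>2)))
     ((1 / (pi * Im z)) * (pi /\<^sub>R \<bar>1 / Im z\<bar>))"
    by (rule has_bochner_integral_mult_right) 
  moreover have "(1 / (pi * Im z)) * (1 / (1 + (- Re z / Im z + (1 / Im z) * x)\<^sup>2)) = poisson z x" for x
  proof -
    have "- Re z / Im z + (1 / Im z) * x = (x - Re z) / Im z" using assms by (simp add: field_simps)
    moreover have "1 + ((x - Re z) / Im z)\<^sup>2 = ((x - Re z)\<^sup>2 + (Im z)\<^sup>2) / (Im z)\<^sup>2"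
      using assms by (simp add: field_simps)
    ultimately show ?thesis using assms unfolding poisson_eq
      by (simp add: field_simps power2_eq_square)
  qed
  moreover have "(1 / (pi * Im z)) * (pi /\<^sub>R \<bar>1 / Im z\<bar>) = 1"
    using assms by (simp add: field_simps)
  ultimately show ?thesis by simp
qed

lemma integrable_poisson: "Im z > 0 \<Longrightarrow> integrable lebesgue (poisson z)"
  using has_bochner_integral_poisson[of z]
  by (subst integrable_completion) (auto simp: has_bochner_integral_iff)

lemma integral_poisson: "Im z > 0 \<Longrightarrow> (LINT t|lebesgue. poisson z t) = 1"
  using has_bochner_integral_poisson[of z]
  by (subst integral_completion) (auto simp: has_bochner_integral_iff)

text \<open>Kernels of size 1/|t - z|^2 thereby become comparable with the weight 1/(1 + t^2) under
  which logarithms of outer functions are integrable.\<close>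

lemma one_plus_square_le:
  assumes "Im z > 0"
  obtains c where "c > 0" "\<And>t. 1 + t\<^sup>2 \<le> c * (norm (of_real t - z))\<^sup>2"
proof 
  \<comment> \<open>The estimate is t^2 <= 2 |t - z|^2 + 2 |z|^2; the constant part 1 + 2 |z|^2 is
    absorbed through Im z <= |t - z|.\<close>
  define c where "c = (1 + 2 * (norm z)\<^sup>2) / (Im z)\<^sup>2 + 2"
  show "c > 0" unfolding c_def using assms by (intro add_nonneg_pos) auto
  fix t :: real
  have 1: "Im z \<le> norm (of_real t - z)"
    using abs_Im_le_cmod[of "of_real t - z"] assms by simp
  have "\<bar>t\<bar> \<le> norm (of_real t - z) + norm z"
    using norm_triangle_ineq[of "of_real t - z" z] by simp
  then have "t\<^sup>2 \<le> (norm (of_real t - z) + norm z)\<^sup>2"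
    by (metis abs_ge_zero power2_abs power_mono)
  also have "\<dots> \<le> 2 * (norm (of_real t - z))\<^sup>2 + 2 * (norm z)\<^sup>2"
    using sum_squares_ge_zero[of "norm (of_real t - z) - norm z" 0] 
    by (simp add: power2_eq_square algebra_simps)
  finally have "1 + t\<^sup>2 \<le> (1 + 2 * (norm z)\<^sup>2) * 1 + 2 * (norm (of_real t - z))\<^sup>2" by simp
  also have "(1 + 2 * (norm z)\<^sup>2) * 1 \<le> (1 + 2 * (norm z)\<^sup>2) * ((norm (of_real t - z))\<^sup>2 / (Im z)\<^sup>2)"
    using 1 assms by (intro mult_left_mono) (auto simp: field_simps power_mono)
  finally show "1 + t\<^sup>2 \<le> c * (norm (of_real t - z))\<^sup>2" 
    by (simp add: c_def algebra_simps)
qed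

lemma measurable_if_integrable_weighted:
  fixes v :: "real \<Rightarrow> real"
  assumes v: "integrable lebesgue (\<lambda>t. v t / (1 + t\<^sup>2))"
  shows "v \<in> borel_measurable lebesgue"
proof -
  have p1: "1 + t\<^sup>2 > 0" for t :: real by (simp add: add_pos_nonneg)
  have "(\<lambda>t. (v t / (1 + t\<^sup>2)) * (1 + t\<^sup>2)) \<in> borel_measurable lebesgue"
    using borel_measurable_integrable[OF v] by measurable
  then show ?thesis using p1 by (simp add: less_imp_neq[symmetric])
qed

lemma integrable_poisson_mult:
  fixes v :: "real \<Rightarrow> real"
  assumes z: "Im z > 0" and v: "integrable lebesgue (\<lambda>t. v t / (1 + t\<^sup>2))"
  shows "integrable lebesgue (\<lambda>t. poisson z t * v t)"
proof -
  obtain c where c: "c > 0" "\<And>t. 1 + t\<^sup>2 \<le> c * (norm (of_real t - z))\<^sup>2"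
    using one_plus_square_le[OF z] by blast
  have p1: "1 + t\<^sup>2 > 0" for t :: real by (simp add: add_pos_nonneg)
  have vm [measurable]: "v \<in> borel_measurable lebesgue" by (rule measurable_if_integrable_weighted[OF v])
  have eq: "poisson z t * v t = (poisson z t * (1 + t\<^sup>2)) * (v t / (1 + t\<^sup>2))" for t
    using p1[of t] by simp
  have b: "\<bar>poisson z t * (1 + t\<^sup>2)\<bar> \<le> c * Im z / pi" for t
  proof -
    have "Im z \<le> norm (of_real t - z)"
      using abs_Im_le_cmod[of "of_real t - z"] z by simp
    then have "norm (of_real t - z) > 0" using z by linarith
    then have "(norm (of_real t - z))\<^sup>2 > 0" by simp
    then have "Im z * (1 + t\<^sup>2) / (pi * (norm (of_real t - z))\<^sup>2) \<le> Im z * (c * (norm (of_real t - z))\<^sup>2) / (pi * (norm (of_real t - z))\<^sup>2)"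
      using c(2)[of t] z by (intro divide_right_mono mult_left_mono) auto
    also have "\<dots> = c * Im z / pi" using \<open>(norm (of_real t - z))\<^sup>2 > 0\<close> by simp
    finally show ?thesis using z p1[of t] by (simp add: poisson_def abs_mult)
  qed
  show ?thesis
  proof (rule Bochner_Integration.integrable_bound)
    show "integrable lebesgue (\<lambda>t. (c * Im z / pi) * (v t / (1 + t\<^sup>2)))" by (rule integrable_mult_right[OF v])
    show "AE t in lebesgue. norm (poisson z t * v t) \<le> norm ((c * Im z / pi) * (v t / (1 + t\<^sup>2)))"
    proof (rule AE_I2)
      fix t :: real
      have "norm (poisson z t * v t) = \<bar>poisson z t * (1 + t\<^sup>2)\<bar> * \<bar>v t / (1 + t\<^sup>2)\<bar>"
        by (subst eq) (simp add: abs_mult)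
      also have "\<dots> \<le> (c * Im z / pi) * \<bar>v t / (1 + t\<^sup>2)\<bar>"
        by (intro mult_right_mono b) simp
      finally show "norm (poisson z t * v t) \<le> norm ((c * Im z / pi) * (v t / (1 + t\<^sup>2)))"
        using z c(1) by (simp add: abs_mult)
    qed
  qed measurable
qed

text \<open>The increment from -R to R of a primitive of (F w - F z) / ((w - z)(w - cnj z)) tends to
  0, because it can be taken along a path on which the integrand is O(1/R^2) and whose length is
  O(R). On the real line the denominator is |t - z|^2, so this increment is a multiple of a
  truncated Poisson integral of F - F z.\<close>

lemma poisson_formula:
  assumes e: "e > 0" and hol: "F holomorphic_on {z. Im z > - e}"
    and bd: "\<And>z. Im z \<ge> 0 \<Longrightarrow> norm (F z) \<le> M" and z: "Im z > 0"
  shows "integrable lebesgue (\<lambda>t. poisson z t *\<^sub>R F (of_real t))"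
    "F z = (LINT t|lebesgue. poisson z t *\<^sub>R F (of_real t))"
proof -
  \<comment> \<open>The half-plane S must lie in the domain of F and must avoid cnj z, whose
    imaginary part is -Im z.\<close>
  define d where "d = min e (Im z)"
  define S where "S = {w. Im w > - d}"
  have d: "d > 0" "d \<le> e" "d \<le> Im z" using e z by (auto simp: d_def)
  have S: "open S" "convex S" unfolding S_def 
     by (auto simp: open_halfspace_Im_gt convex_halfspace_Im_gt)
  have FS: "F holomorphic_on S" by (rule holomorphic_on_subset[OF hol]) (use d in \<open>auto simp: S_def\<close>)
  \<comment> \<open>The difference quotient with its removable singularity at z filled in, so that
    it has a primitive on the convex set S.\<close>
  define q where "q = (\<lambda>w. if w = z then deriv F z else (F w - F z) / (w - z))"
  have q: "q holomorphic_on S" unfolding q_def by (rule pole_lemma_open[OF FS S(1)])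
  have nz: "w - cnj z \<noteq> 0" if "w \<in> S" for w
    using that d by (auto simp: S_def complex_eq_iff)
  have h: "(\<lambda>w. q w / (w - cnj z)) holomorphic_on S"
    by (intro holomorphic_intros q) (use nz in auto)
  obtain P where P: "\<And>w. w \<in> S \<Longrightarrow> (P has_field_derivative q w / (w - cnj z)) (at w within S)"
    using holomorphic_convex_primitive'[OF S(2,1) h] by blast
  have P': "(P has_field_derivative q w / (w - cnj z)) (at w)" if "w \<in> S" for w
    using P[OF that] at_within_open[OF that S(1)] by simp
  have M0: "M \<ge> 0" using bd[of z] z norm_ge_zero[of "F z"] by linarith
  have hb: "norm (q w / (w - cnj z)) \<le> 2 * M / (norm w - norm z)\<^sup>2"
    if "Im w \<ge> 0" "norm w > norm z" for w
  proof -
    have "norm (F w - F z) \<le> 2 * M" 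
      using norm_triangle_ineq4[of "F w" "F z"] bd[of w] bd[of z] that z by linarith
    moreover have "norm w - norm z \<le> norm (w - z)" by (rule norm_triangle_ineq2)
    moreover have "norm w - norm z \<le> norm (w - cnj z)" using norm_triangle_ineq2[of w "cnj z"] by simp
    moreover have "w \<noteq> z" using that by auto
    ultimately show ?thesis using that M0 unfolding power2_eq_square
      by (simp add: q_def norm_divide norm_mult) (intro frac_le mult_mono mult_pos_pos; simp)
  qed
  have seg: "norm (P b - P a) \<le> (2 * M / (R/2 - norm z)\<^sup>2) * norm (b - a)"
    if "closed_segment a b \<subseteq> {w. Im w \<ge> 0 \<and> norm w \<ge> R / 2}" "R / 2 > norm z" for a b R
  proof (rule field_differentiable_bound)
    fix w assume w: "w \<in> closed_segment a b"
    then have w': "Im w \<ge> 0" "norm w \<ge> R/2" using that by auto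
    have "w \<in> S" using w' d by (auto simp: S_def)
    then show "(P has_field_derivative q w / (w - cnj z)) (at w within closed_segment a b)"
      using P' has_field_derivative_at_within by blast
    have "norm (q w / (w - cnj z)) \<le> 2 * M / (norm w - norm z)\<^sup>2" using hb w' that(2) by simp
    also have "\<dots> \<le> 2 * M / (R/2 - norm z)\<^sup>2"
      using w' that(2) M0 by (intro divide_left_mono power_mono mult_pos_pos zero_less_power) auto
    finally show "norm (q w / (w - cnj z)) \<le> 2 * M / (R/2 - norm z)\<^sup>2" .
  qed auto
  \<comment> \<open>The path from -R to R runs over iR. On both segments |Re w| + Im w >= R, hence
    |w| >= R/2.\<close>
  have segs: "closed_segment (of_real R) (\<i> * of_real R) \<subseteq> {w. Im w \<ge> 0 \<and> norm w \<ge> R / 2}"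
     "closed_segment (of_real (-R)) (\<i> * of_real R) \<subseteq> {w. Im w \<ge> 0 \<and> norm w \<ge> R / 2}" if "R > 0" for R :: real
  proof -
    have *: "norm w \<ge> R/2" if "\<bar>Re w\<bar> + Im w \<ge> R" "Im w \<ge> 0" for w
      using abs_Re_le_cmod[of w] abs_Im_le_cmod[of w] that by linarith
    have **: "convex {w. Im w \<ge> 0 \<and> s * Re w + Im w \<ge> R}" for s :: real
    proof -
      have "{w. Im w \<ge> 0 \<and> s * Re w + Im w \<ge> R} = {w. Im w \<ge> 0} \<inter> {w. inner (Complex s 1) w \<ge> R}"
        by (auto simp: inner_complex_def)
      then show ?thesis
        by (simp add: convex_Int convex_halfspace_Im_ge convex_halfspace_ge)
    qed
    have hull: "closed_segment a b \<subseteq> {w. Im w \<ge> 0 \<and> norm w \<ge> R / 2}"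
      if "Im a \<ge> 0" "Im b \<ge> 0" "s * Re a + Im a \<ge> R" "s * Re b + Im b \<ge> R" "\<bar>s\<bar> = 1" for a b :: complex and s :: real
    proof 
      fix w assume "w \<in> closed_segment a b"
      then have "Im w \<ge> 0" "s * Re w + Im w \<ge> R"
        using closed_segment_subset[OF _ _ **[of s], of a b] that by auto
      moreover have "s * Re w \<le> \<bar>Re w\<bar>" using that(5) by (metis abs_ge_self abs_mult mult_1)
      ultimately show "w \<in> {w. Im w \<ge> 0 \<and> norm w \<ge> R / 2}" using *[of w] by simp
    qed
    show "closed_segment (of_real R) (\<i> * of_real R) \<subseteq> {w. Im w \<ge> 0 \<and> norm w \<ge> R / 2}"
      "closed_segment (of_real (-R)) (\<i> * of_real R) \<subseteq> {w. Im w \<ge> 0 \<and> norm w \<ge> R / 2}"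
      by (rule hull[of _ _ 1] hull[of _ _ "-1"]; use that in simp)+
  qed
  have tri: "norm (P (of_real R) - P (of_real (-R))) \<le> (2 * M / (R/2 - norm z)\<^sup>2) * (4 * R)"
    if "R > 0" "R/2 > norm z" for R
  proof -
    define K where "K = 2 * M / (R/2 - norm z)\<^sup>2"
    have K: "K \<ge> 0" using M0 by (simp add: K_def)
    have a: "norm (\<i> * of_real R - of_real R) \<le> 2 * R" 
      using norm_triangle_ineq4[of "\<i> * of_real R" "of_real R"] that by (simp add: norm_mult)
    have b: "norm (\<i> * of_real R - of_real (-R)) \<le> 2 * R" 
      using norm_triangle_ineq4[of "\<i> * of_real R" "of_real (-R)"] that by (simp add: norm_mult)
    have "norm (P (\<i> * of_real R) - P (of_real R)) \<le> K * (2 * R)"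
      using seg[OF segs(1)[OF that(1)] that(2)] a K unfolding K_def[symmetric]
      by (meson mult_left_mono order_trans)
    moreover have "norm (P (\<i> * of_real R) - P (of_real (-R))) \<le> K * (2 * R)"
      using seg[OF segs(2)[OF that(1)] that(2)] b K unfolding K_def[symmetric]
      by (meson mult_left_mono order_trans)
    ultimately have "norm (P (of_real R) - P (of_real (-R))) \<le> K * (2 * R) + K * (2 * R)"
      using norm_triangle_ineq4[of "P (\<i> * of_real R) - P (of_real (-R))" "P (\<i> * of_real R) - P (of_real R)"]
      by simp
    then show ?thesis by (simp add: K_def algebra_simps)
  qed
  \<comment> \<open>(t - z)(t - cnj z) = |t - z|^2 for real t, which is where the Poisson kernel
    appears.\<close>
  have qr: "q (of_real t) / (of_real t - cnj z) = of_real (pi / Im z) * (poisson z t *\<^sub>R (F (of_real t) - F z))" for t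
  proof -
    have "of_real t \<noteq> z" using z by (auto simp: complex_eq_iff)
    have "(of_real t - z) * (of_real t - cnj z) = of_real ((norm (of_real t - z))\<^sup>2)"
      by (metis complex_cnj_complex_of_real complex_cnj_diff complex_norm_square of_real_power)
    then show ?thesis using \<open>of_real t \<noteq> z\<close> z
      by (simp add: q_def poisson_def scaleR_conv_of_real)
  qed
  have Ft: "continuous_on UNIV (\<lambda>t. F (of_real t))"
    by (rule continuous_on_compose2[OF holomorphic_on_imp_continuous_on[OF hol]])
       (use e in \<open>auto intro!: continuous_intros\<close>)
  then have Fm: "(\<lambda>t. F (of_real t)) \<in> borel_measurable borel"
    by (rule borel_measurable_continuous_onI)
  then have Fm' [measurable]: "(\<lambda>t. F (of_real t)) \<in> borel_measurable lebesgue" 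
    by (rule borel_imp_lebesgue_measurable)
  have intF: "integrable lebesgue (\<lambda>t. poisson z t *\<^sub>R G t)" if "G \<in> borel_measurable lebesgue" "\<And>t. norm (G t) \<le> L" for G :: "real \<Rightarrow> complex" and L
  proof (rule Bochner_Integration.integrable_bound)
    show "integrable lebesgue (\<lambda>t. L * poisson z t)" using integrable_poisson[OF z] by simp
    show "AE t in lebesgue. norm (poisson z t *\<^sub>R G t) \<le> norm (L * poisson z t)"
    proof (rule AE_I2)
      fix t
      have "norm (G t) \<le> \<bar>L\<bar>" using that(2)[of t] by linarith
      then show "norm (poisson z t *\<^sub>R G t) \<le> norm (L * poisson z t)"
        using poisson_nonneg[OF z, of t] 
        unfolding norm_scaleR real_norm_def abs_mult mult.commute[of "\<bar>L\<bar>"] by (intro mult_left_mono) auto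
    qed
  qed (use that in measurable)
  show i1: "integrable lebesgue (\<lambda>t. poisson z t *\<^sub>R F (of_real t))"
    by (rule intF[OF Fm', of M]) (simp add: bd)
  have i2: "integrable lebesgue (\<lambda>t. poisson z t *\<^sub>R F z)"
    by (rule intF[of _ "norm (F z)"]) auto
  have i3: "integrable lebesgue (\<lambda>t. poisson z t *\<^sub>R (F (of_real t) - F z))"
    using Bochner_Integration.integrable_diff[OF i1 i2] by (simp add: scaleR_diff_right)
  define I where "I = (LINT t|lebesgue. poisson z t *\<^sub>R (F (of_real t) - F z))"
  have lim: "((\<lambda>R. LINT t|lebesgue. indicator {-R..R} t *\<^sub>R (poisson z t *\<^sub>R (F (of_real t) - F z))) \<longlongrightarrow> I) at_top"
    unfolding I_def
  proof (rule integral_dominated_convergence_at_top[where w="\<lambda>t. norm (poisson z t *\<^sub>R (F (of_real t) - F z))"])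
    show "AE x in lebesgue. ((\<lambda>R. indicator {-R..R} x *\<^sub>R (poisson z x *\<^sub>R (F (of_real x) - F z))) \<longlongrightarrow>
        poisson z x *\<^sub>R (F (of_real x) - F z)) at_top"
    proof (rule AE_I2, rule tendsto_eventually)
      fix x :: real
      show "\<forall>\<^sub>F R in at_top. indicator {-R..R} x *\<^sub>R (poisson z x *\<^sub>R (F (of_real x) - F z)) = poisson z x *\<^sub>R (F (of_real x) - F z)"
        using eventually_ge_at_top[of "\<bar>x\<bar>"] by eventually_elim (auto simp: indicator_def)
    qed
    show "integrable lebesgue (\<lambda>t. norm (poisson z t *\<^sub>R (F (of_real t) - F z)))"
      by (rule integrable_norm[OF i3])
    show "\<forall>\<^sub>F i in at_top. AE x in lebesgue.
       norm (indicator {-i..i} x *\<^sub>R (poisson z x *\<^sub>R (F (of_real x) - F z))) \<le> norm (poisson z x *\<^sub>R (F (of_real x) - F z))"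
      by (intro always_eventually allI AE_I2) (auto simp: indicator_def)
    show "\<And>i. (\<lambda>x. indicator {-i..i} x *\<^sub>R (poisson z x *\<^sub>R (F (of_real x) - F z))) \<in> borel_measurable lebesgue"
      by (intro borel_measurable_scaleR borel_measurable_indicator borel_measurable_integrable[OF i3]) auto
  qed (rule borel_measurable_integrable[OF i3])
  have ev: "(LINT t|lebesgue. indicator {-R..R} t *\<^sub>R (poisson z t *\<^sub>R (F (of_real t) - F z)))
     = of_real (Im z / pi) * (P (of_real R) - P (of_real (-R)))" if "R > 0" for R
  proof -
    have "((\<lambda>t. q (of_real t) / (of_real t - cnj z)) has_integral (P (of_real R) - P (of_real (-R)))) {-R..R}"
    proof (rule fundamental_theorem_of_calculus)
      fix x assume "x \<in> {-R..R}"
      have "of_real x \<in> S" using d by (simp add: S_def)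
      from P'[OF this] show "((\<lambda>x. P (of_real x)) has_vector_derivative q (of_real x) / (of_real x - cnj z)) (at x within {-R..R})"

        by (rule has_vector_derivative_at_within[OF has_vector_derivative_real_field])
    qed (use that in simp)
    then have "((\<lambda>t. of_real (Im z / pi) * (q (of_real t) / (of_real t - cnj z))) has_integral of_real (Im z / pi) * (P (of_real R) - P (of_real (-R)))) {-R..R}"
      by (rule has_integral_mult_right)
    moreover have "of_real (Im z / pi) * (q (of_real t) / (of_real t - cnj z)) = poisson z t *\<^sub>R (F (of_real t) - F z)" for t
      unfolding qr using z by simp
    ultimately have hi: "((\<lambda>t. poisson z t *\<^sub>R (F (of_real t) - F z)) has_integral of_real (Im z / pi) * (P (of_real R) - P (of_real (-R)))) {-R..R}"
      by simp
    have "set_integrable lebesgue {-R..R} (\<lambda>t. poisson z t *\<^sub>R (F (of_real t) - F z))"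
      unfolding set_integrable_def
      by (rule integrable_mult_indicator[OF _ i3]) simp
    from set_lebesgue_integral_eq_integral(2)[OF this] integral_unique[OF hi] 
    show ?thesis by (simp add: set_lebesgue_integral_def)
  qed
  have "I = 0"
  proof (rule tendsto_unique[OF _ lim])
    have "((\<lambda>R. (Im z / pi) * ((2 * M / (R/2 - norm z)\<^sup>2) * (4 * R))) \<longlongrightarrow> 0) at_top"
      by real_asymp
    then show "((\<lambda>R. LINT t|lebesgue. indicator {-R..R} t *\<^sub>R (poisson z t *\<^sub>R (F (of_real t) - F z))) \<longlongrightarrow> 0) at_top"
    proof (rule Lim_null_comparison[rotated])
      show "\<forall>\<^sub>F R in at_top. norm (LINT t|lebesgue. indicator {-R..R} t *\<^sub>R (poisson z t *\<^sub>R (F (of_real t) - F z)))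
          \<le> (Im z / pi) * ((2 * M / (R/2 - norm z)\<^sup>2) * (4 * R))"
        using eventually_gt_at_top[of "max 0 (2 * norm z)"]
      proof eventually_elim
        case (elim R)
        then have R: "R > 0" "R / 2 > norm z" using norm_ge_zero[of z] by linarith+
        show ?case unfolding ev[OF R(1)] norm_mult 
          using tri[OF R] z by (intro mult_mono) (auto simp: norm_divide)
      qed
    qed
  qed simp
  have "I = (LINT t|lebesgue. poisson z t *\<^sub>R F (of_real t)) - F z"
    unfolding I_def scaleR_diff_right
    by (subst Bochner_Integration.integral_diff[OF i1 i2])
       (simp add: integral_poisson[OF z] integrable_poisson[OF z])
  with \<open>I = 0\<close> show "F z = (LINT t|lebesgue. poisson z t *\<^sub>R F (of_real t))" by simp
qed

text \<open>F z is an average of its boundary values with respect to the probability density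
  \<open>poisson z\<close>. The bound M only gives access to the Poisson formula and does not enter
  the conclusion.\<close>

lemma bounded_holomorphic_max_principle:
  assumes e: "e > 0" and hol: "F holomorphic_on {z. Im z > - e}"
    and bd: "\<And>z. Im z \<ge> 0 \<Longrightarrow> norm (F z) \<le> M" and z: "Im z > 0"
    and m: "\<And>t. norm (F (of_real t)) \<le> m"
  shows "norm (F z) \<le> m"
proof -
  note pf = poisson_formula[OF e hol bd z]
  have "norm (F z) \<le> (LINT t|lebesgue. norm (poisson z t *\<^sub>R F (of_real t)))"
    using integral_norm_bound[of lebesgue "\<lambda>t. poisson z t *\<^sub>R F (of_real t)"] pf(2) by simp
  also have "\<dots> \<le> (LINT t|lebesgue. m * poisson z t)"
    using integrable_poisson[OF z]  m poisson_nonneg[OF z]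
    by (intro integral_mono integrable_norm pf(1)) 
       (auto intro: mult_left_mono simp: mult.commute[of m])
  also have "\<dots> = m" by (simp add: integral_poisson[OF z])
  finally show ?thesis .
qed

section \<open>Outer functions\<close>


lemma Im_le_norm_diff: "Im z > 0 \<Longrightarrow> Im z \<le> norm (of_real t - z)"
  using abs_Im_le_cmod[of "of_real t - z"] by simp

lemma of_real_neq_Im_pos: "Im z > 0 \<Longrightarrow> of_real t - z \<noteq> 0"
  by (auto simp: complex_eq_iff)

lemma integrable_weight_bound:
  fixes v :: "real \<Rightarrow> real" and k :: "real \<Rightarrow> complex"
  assumes v: "integrable lebesgue (\<lambda>t. v t / (1 + t\<^sup>2))"
    and k: "k \<in> borel_measurable lebesgue" "\<And>t. norm (k t) \<le> C / (1 + t\<^sup>2)"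
  shows "integrable lebesgue (\<lambda>t. k t * of_real (v t))"
proof (rule Bochner_Integration.integrable_bound)
  show "integrable lebesgue (\<lambda>t. C * (v t / (1 + t\<^sup>2)))" by (rule integrable_mult_right[OF v])
  have [measurable]: "v \<in> borel_measurable lebesgue" by (rule measurable_if_integrable_weighted[OF v])
  note k(1)[measurable]
  show "(\<lambda>t. k t * of_real (v t)) \<in> borel_measurable lebesgue" by measurable
  show "AE t in lebesgue. norm (k t * of_real (v t)) \<le> norm (C * (v t / (1 + t\<^sup>2)))"
  proof (rule AE_I2)
    fix t :: real
    have "norm (k t * of_real (v t)) \<le> (C / (1 + t\<^sup>2)) * \<bar>v t\<bar>"
      unfolding norm_mult norm_of_real by (intro mult_right_mono k(2)) simp
    also have "\<dots> \<le> norm (C * (v t / (1 + t\<^sup>2)))"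
      by (simp add: abs_mult divide_right_mono mult_right_mono)
    finally show "norm (k t * of_real (v t)) \<le> norm (C * (v t / (1 + t\<^sup>2)))" .
  qed
qed

text \<open>The subtracted term t/(1 + t^2) improves the decay: the kernel equals (1 + t z)/(t - z)
  divided by 1 + t^2, and (1 + t z)/(t - z) = z + (1 + z^2)/(t - z) is bounded in t.\<close>

lemma integrable_outer_kernel:
  assumes v: "integrable lebesgue (\<lambda>t. v t / (1 + t\<^sup>2))" and z: "Im z > 0"
  shows "integrable lebesgue (\<lambda>t. (1 / (of_real t - z) - of_real (t / (1 + t\<^sup>2))) * of_real (v t))"
proof (rule integrable_weight_bound[OF v])
  fix t :: real
  have p1: "1 + t\<^sup>2 > 0" by (simp add: add_pos_nonneg)
  then have p2: "1 + (of_real t)\<^sup>2 \<noteq> (0::complex)"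
    by (metis less_irrefl of_real_1 of_real_add of_real_eq_0_iff of_real_power)
  have "1 / (of_real t - z) - of_real (t / (1 + t\<^sup>2)) = (z + (1 + z\<^sup>2) / (of_real t - z)) / of_real (1 + t\<^sup>2)"
    using of_real_neq_Im_pos[OF z, of t] p2 by (simp add: field_simps power2_eq_square)
  moreover have "norm ((1 + z\<^sup>2) / (of_real t - z)) \<le> norm (1 + z\<^sup>2) / Im z"
    unfolding norm_divide using Im_le_norm_diff[OF z, of t] z of_real_neq_Im_pos[OF z, of t]
    by (intro divide_left_mono) auto
  moreover have "norm (z + (1 + z\<^sup>2) / (of_real t - z)) \<le> norm z + norm ((1 + z\<^sup>2) / (of_real t - z))"
    by (rule norm_triangle_ineq)
  ultimately have "norm (1 / (of_real t - z) - of_real (t / (1 + t\<^sup>2))) = norm (z + (1 + z\<^sup>2) / (of_real t - z)) / (1 + t\<^sup>2)"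
    "norm (z + (1 + z\<^sup>2) / (of_real t - z)) \<le> norm z + norm (1 + z\<^sup>2) / Im z"
    using p1 by (simp_all only: norm_divide[of _ "of_real (1 + t\<^sup>2)"] norm_of_real abs_of_pos)
  then show "norm (1 / (of_real t - z) - of_real (t / (1 + t\<^sup>2))) \<le> (norm z + norm (1 + z\<^sup>2) / Im z) / (1 + t\<^sup>2)"
    using p1 by (simp only:) (intro divide_right_mono; simp)
qed measurable

text \<open>The real part of the exponent is 1/pi times the imaginary part of the integral. The real
  term t/(1 + t^2) drops out, and Im (1/(t - z)) is pi times the Poisson kernel.\<close>

lemma norm_outer_exp:
  assumes v: "integrable lebesgue (\<lambda>t. v t / (1 + t\<^sup>2))" and z: "Im z > 0"
  shows "norm (outer_exp v z) = exp (LINT t|lebesgue. poisson z t * v t)"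
proof -
  note i = integrable_outer_kernel[OF v z]
  have "Im (1 / (of_real t - z) - of_real (t / (1 + t\<^sup>2))) = pi * poisson z t" for t
    unfolding poisson_def by (simp add: Im_divide cmod_power2)
  then have eq: "Im ((1 / (of_real t - z) - of_real (t / (1 + t\<^sup>2))) * of_real (v t)) = pi * (poisson z t * v t)" for t
    by simp
  have "Re (1 / (of_real pi * \<i>) * w) = Im w / pi" for w
    by (simp add: Re_divide field_simps power2_eq_square)
  then have "norm (outer_exp v z) = exp (Im (LINT t|lebesgue. (1 / (of_real t - z) - of_real (t / (1 + t\<^sup>2))) * of_real (v t)) / pi)"
    unfolding outer_exp_def by (simp only: norm_exp_eq_Re)
  also have "\<dots> = exp ((LINT t|lebesgue. pi * (poisson z t * v t)) / pi)"
    unfolding integral_Im[OF i, symmetric] eq ..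
  finally show ?thesis by simp
qed

text \<open>Differentiation under the integral sign, carried out with an explicit second order
  remainder.\<close>

lemma outer_exp_holomorphic:
  assumes v: "integrable lebesgue (\<lambda>t. v t / (1 + t\<^sup>2))"
  shows "outer_exp v holomorphic_on upper_half_plane"
proof -
  define J where "J = (\<lambda>z::complex. LINT t|lebesgue. (1 / (of_real t - z) - of_real (t / (1 + t\<^sup>2))) * of_real (v t))"
  have J: "J field_differentiable (at z)" if z: "Im z > 0" for z
  proof -
    obtain c where c: "c > 0" "\<And>t. 1 + t\<^sup>2 \<le> c * (norm (of_real t - z))\<^sup>2"
      using one_plus_square_le[OF z] by blast
    have p1: "1 + t\<^sup>2 > 0" for t :: real by (simp add: add_pos_nonneg)
    have kb: "norm (1 / (of_real t - z)\<^sup>2) \<le> c / (1 + t\<^sup>2)" for t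
      using c(2)[of t] p1[of t] of_real_neq_Im_pos[OF z, of t]
      by (simp add: norm_divide norm_power field_simps)
    have i2: "integrable lebesgue (\<lambda>t. 1 / (of_real t - z)\<^sup>2 * of_real (v t))"
      by (rule integrable_weight_bound[OF v _ kb]) measurable
    define D where "D = (LINT t|lebesgue. 1 / (of_real t - z)\<^sup>2 * of_real (v t))"
    \<comment> \<open>For |h| < Im z / 2 the point z + h has height at least Im z / 2, so 1/|t - z -
      h| <= 2/Im z; the constant c bounds 1/|t - z|^2 by c/(1 + t^2).\<close>
    define C where "C = (LINT t|lebesgue. norm ((2 * c / Im z) * (v t / (1 + t\<^sup>2))))"
    have bound: "norm ((J (z + h) - J z) / h - D) \<le> norm h * C" if h: "h \<noteq> 0" "norm h < Im z / 2" for h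
    proof -
      have "Im h \<ge> - (Im z / 2)" using h abs_Im_le_cmod[of h] by linarith
      then have zh: "Im (z + h) \<ge> Im z / 2" by simp
      then have zh': "Im (z + h) > 0" using z by linarith
      have n2: "norm (of_real t - (z + h)) \<ge> Im z / 2" for t
        using Im_le_norm_diff[OF zh', of t] zh by linarith
      have "J (z + h) - J z - h * D = (LINT t|lebesgue. (1 / (of_real t - (z + h)) - of_real (t / (1 + t\<^sup>2))) * of_real (v t)
         - (1 / (of_real t - z) - of_real (t / (1 + t\<^sup>2))) * of_real (v t) - h * (1 / (of_real t - z)\<^sup>2 * of_real (v t)))"
        unfolding J_def D_def
        using Bochner_Integration.integral_diff[OF Bochner_Integration.integrable_diff[OF
            integrable_outer_kernel[OF v zh'] integrable_outer_kernel[OF v z]] integrable_mult_right[OF i2, of h]]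
          Bochner_Integration.integral_diff[OF integrable_outer_kernel[OF v zh'] integrable_outer_kernel[OF v z]]
        by (simp only: integral_mult_right_zero)
      also have "\<dots> = (LINT t|lebesgue. h\<^sup>2 * (1 / (of_real t - z)\<^sup>2 * (1 / (of_real t - (z + h))) * of_real (v t)))"
      proof (rule Bochner_Integration.integral_cong[OF refl])
        fix t :: real
        define a where "a = of_real t - z"
        have a: "a \<noteq> 0" "a - h \<noteq> 0" 
          using of_real_neq_Im_pos[OF z, of t] of_real_neq_Im_pos[OF zh', of t] by (auto simp: a_def algebra_simps)
        \<comment> \<open>The Taylor remainder of the kernel in closed form; the terms t/(1 + t^2)
          cancel in the difference.\<close>
        have "1 / (a - h) - 1 / a - h * (1 / a\<^sup>2) = h\<^sup>2 * (1 / a\<^sup>2 * (1 / (a - h)))"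
          using a by (simp add: field_simps power2_eq_square)
        then have "(1 / (a - h) - 1 / a - h * (1 / a\<^sup>2)) * of_real (v t) = h\<^sup>2 * (1 / a\<^sup>2 * (1 / (a - h))) * of_real (v t)"
          by simp
        moreover have "of_real t - (z + h) = a - h" by (simp add: a_def)
        ultimately show "(1 / (of_real t - (z + h)) - of_real (t / (1 + t\<^sup>2))) * of_real (v t)
         - (1 / (of_real t - z) - of_real (t / (1 + t\<^sup>2))) * of_real (v t) - h * (1 / (of_real t - z)\<^sup>2 * of_real (v t))
          = h\<^sup>2 * (1 / (of_real t - z)\<^sup>2 * (1 / (of_real t - (z + h))) * of_real (v t))"
          unfolding a_def[symmetric] by (simp add: algebra_simps)
      qed
      finally have eq: "J (z + h) - J z - h * D = h\<^sup>2 * (LINT t|lebesgue. (1 / (of_real t - z)\<^sup>2 * (1 / (of_real t - (z + h)))) * of_real (v t))"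
        by (simp only: integral_mult_right_zero)
      have "norm (LINT t|lebesgue. (1 / (of_real t - z)\<^sup>2 * (1 / (of_real t - (z + h)))) * of_real (v t)) \<le> C"
      proof -
        have kb2: "norm (1 / (of_real t - z)\<^sup>2 * (1 / (of_real t - (z + h)))) \<le> (2 * c / Im z) / (1 + t\<^sup>2)" for t
        proof -
          have "norm (1 / (of_real t - (z + h))) \<le> 2 / Im z"
            using frac_le[of 1 1 "Im z / 2" "norm (of_real t - (z + h))"] n2[of t] z by (simp add: norm_divide)
          then have "norm (1 / (of_real t - z)\<^sup>2 * (1 / (of_real t - (z + h)))) \<le> (c / (1 + t\<^sup>2)) * (2 / Im z)"
            unfolding norm_mult by (intro mult_mono kb) (use c(1) p1[of t] in auto)
          then show ?thesis by (simp add: mult_ac)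
        qed
        have i3: "integrable lebesgue (\<lambda>t. (1 / (of_real t - z)\<^sup>2 * (1 / (of_real t - (z + h)))) * of_real (v t))"
          by (rule integrable_weight_bound[OF v _ kb2]) measurable
        have "norm (LINT t|lebesgue. (1 / (of_real t - z)\<^sup>2 * (1 / (of_real t - (z + h)))) * of_real (v t))
           \<le> (LINT t|lebesgue. norm ((1 / (of_real t - z)\<^sup>2 * (1 / (of_real t - (z + h)))) * of_real (v t)))"
          by (rule integral_norm_bound)
        also have "\<dots> \<le> C" unfolding C_def
        proof (rule integral_mono[OF integrable_norm[OF i3] integrable_norm[OF integrable_mult_right[OF v]]])
          fix t :: real
          have "norm ((1 / (of_real t - z)\<^sup>2 * (1 / (of_real t - (z + h)))) * of_real (v t)) \<le> (2 * c / Im z) / (1 + t\<^sup>2) * \<bar>v t\<bar>"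
            unfolding norm_mult[of _ "of_real (v t)"] norm_of_real by (intro mult_right_mono kb2) simp
          also have "\<dots> = norm ((2 * c / Im z) * (v t / (1 + t\<^sup>2)))"
            using c(1) z p1[of t] by (simp add: abs_mult)
          finally show "norm ((1 / (of_real t - z)\<^sup>2 * (1 / (of_real t - (z + h)))) * of_real (v t)) \<le> norm ((2 * c / Im z) * (v t / (1 + t\<^sup>2)))" .
        qed
        finally show ?thesis .
      qed
      then have "norm (J (z + h) - J z - h * D) \<le> (norm h)\<^sup>2 * C"
        unfolding eq norm_mult norm_power by (intro mult_left_mono) auto
      moreover have "(J (z + h) - J z) / h - D = (J (z + h) - J z - h * D) / h"
        using h by (simp add: field_simps)
      ultimately show ?thesis using h
        by (simp add: norm_divide divide_le_eq power2_eq_square mult_ac)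
    qed
    have "(J has_field_derivative D) (at z)"
      unfolding DERIV_def
    proof (subst LIM_zero_iff[symmetric], rule Lim_null_comparison)
      show "\<forall>\<^sub>F h in at 0. norm ((J (z + h) - J z) / h - D) \<le> norm h * C"
        unfolding eventually_at using bound z by (intro exI[of _ "Im z / 2"]) auto
      show "((\<lambda>h. norm h * C) \<longlongrightarrow> 0) (at (0::complex))"
        by (auto intro!: tendsto_eq_intros)
    qed
    then show ?thesis by (auto simp: field_differentiable_def)
  qed
  have "J holomorphic_on upper_half_plane"
    unfolding holomorphic_on_def upper_half_plane_def
    using J field_differentiable_at_within by blast
  then show ?thesis
    unfolding outer_exp_def[abs_def] J_def by (intro holomorphic_intros)
qed

text \<open>The line is split at distance \<open>\<eta>\<close> from x. The near part is controlled
  by the Lipschitz constant, the far part by the small mass of the kernel there. The bound does not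
  depend on x, which allows a maximum principle on the whole line Im w = y.\<close>

lemma poisson_mean_close:
  fixes v :: "real \<Rightarrow> real"
  assumes vm [measurable]: "v \<in> borel_measurable lebesgue" and vb: "\<And>t. \<bar>v t\<bar> \<le> V"
    and vl: "\<And>s t. \<bar>v s - v t\<bar> \<le> L * \<bar>s - t\<bar>" and h: "\<eta> > 0" and y: "y > 0"
  shows "\<bar>(LINT t|lebesgue. poisson (Complex x y) t * v t) - v x\<bar> \<le> L * \<eta> + 2 * V * (1 + 1 / \<eta>\<^sup>2) * y"
proof -
  have V: "V \<ge> 0" using vb[of 0] by linarith
  have L: "L \<ge> 0" using vl[of 0 1] by simp
  have y': "Im (Complex x y) > 0" using y by simp
  have bi: "integrable lebesgue (\<lambda>t. poisson (Complex x y) t * w t)" 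
    if "w \<in> borel_measurable lebesgue" "\<And>t. \<bar>w t\<bar> \<le> W" for w W
  proof (rule Bochner_Integration.integrable_bound)
    show "integrable lebesgue (\<lambda>t. W * poisson (Complex x y) t)" using integrable_poisson[OF y'] by simp
    show "AE t in lebesgue. norm (poisson (Complex x y) t * w t) \<le> norm (W * poisson (Complex x y) t)"
    proof (rule AE_I2)
      fix t
      have "\<bar>w t\<bar> \<le> \<bar>W\<bar>" using that(2)[of t] by linarith
      then show "norm (poisson (Complex x y) t * w t) \<le> norm (W * poisson (Complex x y) t)"
        by (simp add: abs_mult mult.commute[of "\<bar>W\<bar>"] mult_left_mono)
    qed
  qed (use that in measurable)
  have i1: "integrable lebesgue (\<lambda>t. poisson (Complex x y) t * v t)" by (rule bi[OF vm vb])
  have "\<bar>v t - v x\<bar> \<le> V + \<bar>v x\<bar>" for t using vb[of t] by linarith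
  then have i2: "integrable lebesgue (\<lambda>t. poisson (Complex x y) t * (v t - v x))" by (intro bi[where W="V + \<bar>v x\<bar>"]) auto
  have "(LINT t|lebesgue. poisson (Complex x y) t * v t) - v x = (LINT t|lebesgue. poisson (Complex x y) t * (v t - v x))"
    unfolding right_diff_distrib using i1 integrable_poisson[OF y'] integral_poisson[OF y']
    by (subst Bochner_Integration.integral_diff) auto
  also have "\<bar>\<dots>\<bar> \<le> (LINT t|lebesgue. \<bar>poisson (Complex x y) t * (v t - v x)\<bar>)"
    by (rule integral_abs_bound)
  also have "\<dots> \<le> (LINT t|lebesgue. (L * \<eta>) * poisson (Complex x y) t + (2 * V * (1 + 1 / \<eta>\<^sup>2) * y) * poisson (Complex x 1) t)"
  proof (rule integral_mono)
    show "integrable lebesgue (\<lambda>t. \<bar>poisson (Complex x y) t * (v t - v x)\<bar>)" by (rule integrable_abs[OF i2])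
    show "integrable lebesgue (\<lambda>t. (L * \<eta>) * poisson (Complex x y) t + (2 * V * (1 + 1 / \<eta>\<^sup>2) * y) * poisson (Complex x 1) t)"
      using integrable_poisson[OF y'] integrable_poisson[of "Complex x 1"] by simp
    fix t
    have P: "poisson (Complex x y) t \<ge> 0" "poisson (Complex x 1) t \<ge> 0"
      using poisson_nonneg y' by auto
    show "\<bar>poisson (Complex x y) t * (v t - v x)\<bar> \<le> (L * \<eta>) * poisson (Complex x y) t + (2 * V * (1 + 1 / \<eta>\<^sup>2) * y) * poisson (Complex x 1) t"
    proof (cases "\<bar>t - x\<bar> \<le> \<eta>")
      case True
      then have "\<bar>v t - v x\<bar> \<le> L * \<eta>" using vl[of t x] L by (meson mult_left_mono order_trans)
      then have "\<bar>poisson (Complex x y) t * (v t - v x)\<bar> \<le> (L * \<eta>) * poisson (Complex x y) t"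
        using P by (simp add: abs_mult mult.commute[of "L * \<eta>"] mult_left_mono)
      moreover have "(2 * V * (1 + 1 / \<eta>\<^sup>2) * y) * poisson (Complex x 1) t \<ge> 0"
        using P V y by simp
      ultimately show ?thesis by linarith
    next
      case False
      then have s: "(t - x)\<^sup>2 \<ge> \<eta>\<^sup>2" "(t - x)\<^sup>2 > 0"
        using h by (auto simp: abs_le_square_iff[symmetric])
      have "poisson (Complex x y) t \<le> y / (pi * (t - x)\<^sup>2)"
        unfolding poisson_eq complex.sel using s y by (intro divide_left_mono mult_left_mono mult_pos_pos) (auto intro: add_pos_pos)
      \<comment> \<open>For |t - x| > \<open>\<eta>\<close> the kernel at height y is dominated by a
        multiple of the kernel at height 1, whose integral is again 1.\<close>
      also have "1 + (t - x)\<^sup>2 \<le> (1 + 1 / \<eta>\<^sup>2) * (t - x)\<^sup>2"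
        using s h by (simp add: algebra_simps)
      then have "1 / (t - x)\<^sup>2 \<le> (1 + 1 / \<eta>\<^sup>2) / (1 + (t - x)\<^sup>2)"
        using s by (simp add: divide_le_eq pos_le_divide_eq add_pos_pos mult.commute)
      then have "y / pi * (1 / (t - x)\<^sup>2) \<le> y / pi * ((1 + 1 / \<eta>\<^sup>2) / (1 + (t - x)\<^sup>2))"
        using y by (intro mult_left_mono) auto
      then have "y / (pi * (t - x)\<^sup>2) \<le> (1 + 1 / \<eta>\<^sup>2) * y * poisson (Complex x 1) t"
        unfolding poisson_eq by (simp add: add.commute mult_ac)
      finally have "poisson (Complex x y) t \<le> (1 + 1 / \<eta>\<^sup>2) * y * poisson (Complex x 1) t" .
      moreover have "\<bar>v t - v x\<bar> \<le> 2 * V" using vb[of t] vb[of x] by linarith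
      ultimately have "poisson (Complex x y) t * \<bar>v t - v x\<bar> \<le> (1 + 1 / \<eta>\<^sup>2) * y * poisson (Complex x 1) t * (2 * V)"
        using P y h by (intro mult_mono) auto
      then have "\<bar>poisson (Complex x y) t * (v t - v x)\<bar> \<le> (2 * V * (1 + 1 / \<eta>\<^sup>2) * y) * poisson (Complex x 1) t"
        using P by (simp only: abs_mult abs_of_nonneg mult_ac)
      moreover have "(L * \<eta>) * poisson (Complex x y) t \<ge> 0" using L h P by simp
      ultimately show ?thesis by linarith
    qed
  qed
  also have "\<dots> = L * \<eta> + 2 * V * (1 + 1 / \<eta>\<^sup>2) * y"
    using integrable_poisson[OF y'] integrable_poisson[of "Complex x 1"] 
      integral_poisson[OF y'] integral_poisson[of "Complex x 1"] by simp
  finally show ?thesis .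
qed


section \<open>Logarithmic subharmonicity for bounded functions\<close>

lemma bounded_holomorphic_lipschitz:
  assumes e: "e > 0" and hol: "F holomorphic_on {z. Im z > - e}"
    and bd: "\<And>z. Im z > - e \<Longrightarrow> norm (F z) \<le> M"
    and a: "Im a \<ge> 0" and b: "Im b \<ge> 0"
  shows "norm (F b - F a) \<le> (2 * M / e) * norm (b - a)"
proof (rule field_differentiable_bound[of "{z. Im z \<ge> 0}" F "deriv F"])
  show "convex {z. Im z \<ge> 0}" by (rule convex_halfspace_Im_ge)
  fix z assume "z \<in> {z. Im z \<ge> 0}"
  then have z: "Im z \<ge> 0" by simp
  have sub: "cball z (e/2) \<subseteq> {z. Im z > - e}"
  proof
    fix w assume "w \<in> cball z (e/2)"
    then have "norm (z - w) \<le> e / 2" by (simp add: dist_norm)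
    then have "\<bar>Im z - Im w\<bar> \<le> e / 2" using abs_Im_le_cmod[of "z - w"] by simp
    then have "- e < Im w" using z e by linarith
    then show "w \<in> {z. Im z > - e}" by simp
  qed
  have op: "open {z. Im z > - e}" by (rule open_halfspace_Im_gt)
  show "(F has_field_derivative deriv F z) (at z within {z. Im z \<ge> 0})"
    using holomorphic_derivI[OF hol op] z e has_field_derivative_at_within by auto
  have "norm ((deriv ^^ 1) F z) \<le> fact 1 * M / (e/2)^1"
  proof (rule Cauchy_inequality)
    show "F holomorphic_on ball z (e/2)" using sub ball_subset_cball by (intro holomorphic_on_subset[OF hol]) blast
    show "continuous_on (cball z (e/2)) F"
      by (rule holomorphic_on_imp_continuous_on[OF holomorphic_on_subset[OF hol sub]])
    fix x assume "norm (z - x) = e/2"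
    then have "x \<in> cball z (e/2)" by (simp add: dist_norm)
    then show "norm (F x) \<le> M" using sub bd by auto
  qed (use e in simp)
  then show "norm (deriv F z) \<le> 2 * M / e" by (simp add: mult.commute)
qed (use a b in auto)

text \<open>Let E be the outer function with boundary modulus |F| + \<open>\<delta>\<close>; the
  shift by \<open>\<delta>\<close> makes the logarithm bounded and Lipschitz. The maximum principle
  is applied to F/E on the line Im w = y instead of the real line, since E is controlled only inside
  the half-plane. There |F/E| is at most 1 up to an error that is uniform in x and vanishes in the
  limit.\<close>

lemma norm_le_exp_poisson_bounded:
  assumes e: "e > 0" and hol: "F holomorphic_on {z. Im z > - e}"
    and bd: "\<And>z. Im z > - e \<Longrightarrow> norm (F z) \<le> M"
    and z: "Im z > 0" and d: "\<delta> > 0"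
  shows "norm (F z) \<le> exp (LINT t|lebesgue. poisson z t * ln (norm (F (of_real t)) + \<delta>))"
proof -
  define v where "v = (\<lambda>t. ln (norm (F (of_real t)) + \<delta>))"
  define l where "l = 2 * M / e"
  have M: "M \<ge> 0" using bd[of z] z e norm_ge_zero[of "F z"] by (smt (verit))
  have l: "l \<ge> 0" using M e by (simp add: l_def)
  have lip: "norm (F b - F a) \<le> l * norm (b - a)" if "Im a \<ge> 0" "Im b \<ge> 0" for a b
    unfolding l_def by (rule bounded_holomorphic_lipschitz[OF e hol bd that])
  define V where "V = \<bar>ln \<delta>\<bar> + \<bar>ln (M + \<delta>)\<bar>"
  have vb: "\<bar>v t\<bar> \<le> V" for t
  proof -
    have "ln \<delta> \<le> v t" unfolding v_def using d by (subst ln_le_cancel_iff) (auto intro: add_nonneg_pos)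
    moreover have "v t \<le> ln (M + \<delta>)" unfolding v_def using d M bd[of "of_real t"] e
      by (subst ln_le_cancel_iff) (auto intro: add_nonneg_pos)
    ultimately show ?thesis unfolding V_def by linarith
  qed
  \<comment> \<open>The slope of ln is at most 1/\<open>\<delta>\<close> on the values that are at
    least \<open>\<delta>\<close>.\<close>
  have lnlip: "ln a - ln b \<le> (a - b) / \<delta>" if "a \<ge> b" "b \<ge> \<delta>" for a b :: real
  proof -
    have "ln a - ln b = ln (a / b)" using that d by (simp add: ln_div)
    also have "\<dots> \<le> a / b - 1" using that d by (intro ln_le_minus_one) auto
    also have "\<dots> = (a - b) / b" using that d by (simp add: field_simps)
    also have "\<dots> \<le> (a - b) / \<delta>" using that d by (intro divide_left_mono) auto
    finally show ?thesis .
  qed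
  have vl1: "v s - v t \<le> (l / \<delta>) * \<bar>s - t\<bar>" for s t
  proof (cases "norm (F (of_real s)) \<ge> norm (F (of_real t))")
    case True
    then have "v s - v t \<le> (norm (F (of_real s)) - norm (F (of_real t))) / \<delta>"
      using lnlip[of "norm (F (of_real t)) + \<delta>" "norm (F (of_real s)) + \<delta>"] by (simp add: v_def)
    also have "\<dots> \<le> (l * \<bar>s - t\<bar>) / \<delta>"
    proof (rule divide_right_mono)
      have "norm (F (of_real s)) - norm (F (of_real t)) \<le> norm (F (of_real s) - F (of_real t))"
        by (rule norm_triangle_ineq2)
      also have "\<dots> \<le> l * norm (of_real s - of_real t :: complex)" by (rule lip) auto
      finally show "norm (F (of_real s)) - norm (F (of_real t)) \<le> l * \<bar>s - t\<bar>"
        by (metis norm_of_real of_real_diff)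
    qed (use d in simp)
    finally show ?thesis by simp
  next
    case False
    then have "v s \<le> v t" unfolding v_def using d by (subst ln_le_cancel_iff) (auto intro: add_nonneg_pos)
    moreover have "(l / \<delta>) * \<bar>s - t\<bar> \<ge> 0" using l d by simp
    ultimately show ?thesis by linarith
  qed
  have vl: "\<bar>v s - v t\<bar> \<le> (l / \<delta>) * \<bar>s - t\<bar>" for s t
    using vl1[of s t] vl1[of t s] by (simp add: abs_le_iff abs_minus_commute)
  have Fm: "(\<lambda>t. F (of_real t)) \<in> borel_measurable lebesgue"
    by (intro borel_imp_lebesgue_measurable borel_measurable_continuous_onI 
         continuous_on_compose2[OF holomorphic_on_imp_continuous_on[OF hol]])
       (use e in \<open>auto intro!: continuous_intros\<close>)
  have vm [measurable]: "v \<in> borel_measurable lebesgue"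
    unfolding v_def using Fm by measurable
  have p1: "1 + t\<^sup>2 > 0" for t :: real by (simp add: add_pos_nonneg)
  have wint: "integrable lebesgue (\<lambda>t::real. 1 / (1 + t\<^sup>2))"
    using has_bochner_integral_inverse_1_plus_square
    by (subst integrable_completion) (auto simp: has_bochner_integral_iff)
  have vi: "integrable lebesgue (\<lambda>t. v t / (1 + t\<^sup>2))"
  proof (rule Bochner_Integration.integrable_bound[OF integrable_mult_right[OF wint, of V]])
    show "AE x in lebesgue. norm (v x / (1 + x\<^sup>2)) \<le> norm (V * (1 / (1 + x\<^sup>2)))"
      using vb p1 by (intro AE_I2) (simp add: divide_right_mono order_trans[OF _ abs_ge_self])
  qed measurable
  define E where "E = outer_exp v"
  have E: "E holomorphic_on {z. Im z > 0}"
    using outer_exp_holomorphic[OF vi] by (simp add: E_def upper_half_plane_def)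
  have nE: "norm (E w) = exp (LINT t|lebesgue. poisson w t * v t)" if "Im w > 0" for w
    unfolding E_def by (rule norm_outer_exp[OF vi that])
  have E0: "E w \<noteq> 0" for w unfolding E_def outer_exp_def by simp
  \<comment> \<open>A positive lower bound of |E| makes F/E bounded, as the maximum principle
    requires on an unbounded domain.\<close>
  have Elow: "norm (E w) \<ge> exp (- V)" if w: "Im w > 0" for w
  proof -
    have "- V = (LINT t|lebesgue. - V * poisson w t)" by (simp add: integral_poisson[OF w])
    also have "\<dots> \<le> (LINT t|lebesgue. poisson w t * v t)"
    proof (rule integral_mono)
      show "integrable lebesgue (\<lambda>t. poisson w t * v t)" by (rule integrable_poisson_mult[OF w vi])
      fix t 
      have "poisson w t * (- V) \<le> poisson w t * v t"
        using vb[of t] poisson_nonneg[OF w] by (intro mult_left_mono) auto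
      then show "- V * poisson w t \<le> poisson w t * v t" by (simp add: mult.commute)
    qed (use integrable_poisson[OF w] in simp)
    finally show ?thesis unfolding nE[OF w] by simp
  qed
  \<comment> \<open>The first factor comes from |F (x + iy)| <= |F x| + l y <= (|F x| +
    \<open>\<delta>\<close>) (1 + l y/\<open>\<delta>\<close>), the second from replacing v x by its
    Poisson mean at height y.\<close>
  define K where "K = (\<lambda>\<eta> y. (1 + l * y / \<delta>) * exp ((l / \<delta>) * \<eta> + 2 * V * (1 + 1 / \<eta>\<^sup>2) * y))"
  have main: "norm (F (z + \<i> * of_real y)) \<le> norm (E (z + \<i> * of_real y)) * K \<eta> y" 
    if y: "y > 0" and h: "\<eta> > 0" for y \<eta>
  proof -
    define H where "H = (\<lambda>w. F (w + \<i> * of_real y) / E (w + \<i> * of_real y))"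
    have hF: "(\<lambda>w. F (w + \<i> * of_real y)) holomorphic_on {z. Im z > - y}"
      by (rule holomorphic_on_compose_gen[OF _ hol, unfolded o_def]) (use y e in \<open>auto intro!: holomorphic_intros\<close>)
    have hE: "(\<lambda>w. E (w + \<i> * of_real y)) holomorphic_on {z. Im z > - y}"
      by (rule holomorphic_on_compose_gen[OF _ E, unfolded o_def]) (use y e in \<open>auto intro!: holomorphic_intros\<close>)
    have "norm (H z) \<le> K \<eta> y"
    proof (rule bounded_holomorphic_max_principle[OF y _ _ z])
      show "H holomorphic_on {z. Im z > - y}" unfolding H_def
        by (intro holomorphic_intros hF hE) (use E0 in auto)
      show "norm (H w) \<le> M / exp (- V)" if "Im w \<ge> 0" for w
        unfolding H_def norm_divide using that y e M by (intro frac_le bd Elow) auto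
      fix x :: real
      have c: "of_real x + \<i> * of_real y = Complex x y" by (simp add: complex_eq_iff)
      have "norm (F (Complex x y)) \<le> norm (F (of_real x)) + l * y"
        using lip[of "of_real x" "Complex x y"] norm_triangle_ineq2[of "F (Complex x y)" "F (of_real x)"] y 
        by (simp add: c[symmetric] norm_mult)
      also have "\<dots> \<le> (norm (F (of_real x)) + \<delta>) * (1 + l * y / \<delta>)"
        using l y d by (simp add: field_simps)
      also have "norm (F (of_real x)) + \<delta> = exp (v x)" unfolding v_def using d by (simp add: add_nonneg_pos)
      finally have 1: "norm (F (Complex x y)) \<le> exp (v x) * (1 + l * y / \<delta>)" .
      have "v x \<le> (LINT t|lebesgue. poisson (Complex x y) t * v t) + ((l / \<delta>) * \<eta> + 2 * V * (1 + 1 / \<eta>\<^sup>2) * y)"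
        using poisson_mean_close[OF vm vb vl h y, of x] by linarith
      then have "exp (v x) \<le> norm (E (Complex x y)) * exp ((l / \<delta>) * \<eta> + 2 * V * (1 + 1 / \<eta>\<^sup>2) * y)"
        using y by (simp add: nE exp_add[symmetric])
      then have "norm (F (Complex x y)) \<le> (norm (E (Complex x y)) * exp ((l / \<delta>) * \<eta> + 2 * V * (1 + 1 / \<eta>\<^sup>2) * y)) * (1 + l * y / \<delta>)"
        using 1 l y d by (meson add_nonneg_nonneg divide_nonneg_pos less_imp_le mult_nonneg_nonneg mult_right_mono order_trans zero_le_one)
      then show "norm (H (of_real x)) \<le> K \<eta> y"
        unfolding H_def c norm_divide K_def using E0[of "Complex x y"] by (simp add: divide_le_eq mult_ac)
    qed
    then show ?thesis unfolding H_def norm_divide using E0[of "z + \<i> * of_real y"] by (simp add: divide_le_eq mult.commute)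
  qed
  \<comment> \<open>The limit y -> 0 is taken with \<open>\<eta>\<close> fixed, because the error
    contains y/\<open>\<eta>\<close>^2; only afterwards does \<open>\<eta>\<close> tend to
    0.\<close>
  have main2: "norm (F z) \<le> norm (E z) * exp ((l / \<delta>) * \<eta>)" if h: "\<eta> > 0" for \<eta>
  proof (rule tendsto_le)
    have zt: "((\<lambda>y. z + \<i> * of_real y) \<longlongrightarrow> z) (at_right 0)" by (auto intro!: tendsto_eq_intros)
    have cF: "isCont F z"
      by (rule continuous_on_interior[OF holomorphic_on_imp_continuous_on[OF hol]])
         (use z e in \<open>simp add: interior_open open_halfspace_Im_gt\<close>)
    have cE: "isCont E z"
      by (rule continuous_on_interior[OF holomorphic_on_imp_continuous_on[OF E]])
         (use z in \<open>simp add: interior_open open_halfspace_Im_gt\<close>)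
    show "((\<lambda>y. norm (F (z + \<i> * of_real y))) \<longlongrightarrow> norm (F z)) (at_right 0)"
      by (intro tendsto_norm isCont_tendsto_compose[OF cF] zt)
    have "(K \<eta> \<longlongrightarrow> (1 + l * 0 / \<delta>) * exp ((l / \<delta>) * \<eta> + 2 * V * (1 + 1 / \<eta>\<^sup>2) * 0)) (at_right 0)"
      unfolding K_def using d h by (intro tendsto_intros) auto
    then have "(K \<eta> \<longlongrightarrow> exp ((l / \<delta>) * \<eta>)) (at_right 0)" by simp
    then show "((\<lambda>y. norm (E (z + \<i> * of_real y)) * K \<eta> y) \<longlongrightarrow> norm (E z) * exp ((l / \<delta>) * \<eta>)) (at_right 0)"
      by (intro tendsto_intros isCont_tendsto_compose[OF cE] zt)
    show "\<forall>\<^sub>F y in at_right 0. norm (F (z + \<i> * of_real y)) \<le> norm (E (z + \<i> * of_real y)) * K \<eta> y"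
      using eventually_at_right_less[of 0] by eventually_elim (use main h in auto)
  qed simp
  have "norm (F z) \<le> norm (E z) * exp ((l / \<delta>) * 0)"
  proof (rule tendsto_lowerbound)
    show "((\<lambda>\<eta>. norm (E z) * exp ((l / \<delta>) * \<eta>)) \<longlongrightarrow> norm (E z) * exp ((l / \<delta>) * 0)) (at_right 0)"
      by (intro tendsto_intros)
    show "\<forall>\<^sub>F \<eta> in at_right 0. norm (F z) \<le> norm (E z) * exp ((l / \<delta>) * \<eta>)"
      using eventually_at_right_less[of 0] by eventually_elim (use main2 in auto)
  qed simp
  then show ?thesis using nE[OF z] by (simp add: v_def)
qed

section \<open>Weighted convergence under a uniform bound on p-th powers\<close>

lemma le_one_plus_powr:
  fixes a p :: real
  assumes "p \<ge> 1" "a \<ge> 0"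
  shows "a \<le> 1 + a powr p"
proof (cases "a \<le> 1")
  case False
  then have "a powr 1 \<le> a powr p" using assms by (intro powr_mono) auto
  then show ?thesis using False by simp
qed (use assms in \<open>simp add: add_increasing2\<close>)

text \<open>Bounded integrals of p-th powers with p > 1 give uniform integrability. The distances
  truncated at N converge by dominated convergence, and the excess over N costs at most C' N^(1 -
  p), uniformly in n.\<close>

lemma weighted_L1_convergence:
  fixes X :: "nat \<Rightarrow> real \<Rightarrow> complex"
  assumes p: "p > 1" and K: "integrable M K" "\<And>t. K t \<ge> 0"
    and Xm: "\<And>n. X n \<in> borel_measurable M" and xm: "x \<in> borel_measurable M"
    and lim: "AE t in M. (\<lambda>n. X n t) \<longlonglongrightarrow> x t"
    and Xi: "\<And>n. integrable M (\<lambda>t. K t * norm (X n t) powr p)" 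
    and Xb: "\<And>n. (LINT t|M. K t * norm (X n t) powr p) \<le> C"
    and xi: "integrable M (\<lambda>t. K t * norm (x t) powr p)"
  shows "integrable M (\<lambda>t. K t * norm (X n t))" "integrable M (\<lambda>t. K t * norm (x t))"
    "(\<lambda>n. LINT t|M. K t * norm (X n t - x t)) \<longlonglongrightarrow> 0"
proof -
  note [measurable] = Xm xm borel_measurable_integrable[OF K(1)]
  note le1 = le_one_plus_powr[OF less_imp_le[OF p]]
  have int1: "integrable M (\<lambda>t. K t * norm (y t))" 
    if [measurable]: "y \<in> borel_measurable M" and "integrable M (\<lambda>t. K t * norm (y t) powr p)" for y :: "real \<Rightarrow> complex"
  proof (rule Bochner_Integration.integrable_bound[OF Bochner_Integration.integrable_add[OF K(1) that(2)]])
    show "AE t in M. norm (K t * norm (y t)) \<le> norm (K t + K t * norm (y t) powr p)"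
      using mult_left_mono[OF le1[OF norm_ge_zero] K(2)] K(2)
      by (intro AE_I2) (simp add: abs_mult algebra_simps)
  qed measurable
  show "integrable M (\<lambda>t. K t * norm (X n t))" by (rule int1[OF Xm Xi])
  show "integrable M (\<lambda>t. K t * norm (x t))" by (rule int1[OF xm xi])
  define D where "D = (\<lambda>n t. norm (X n t - x t))"
  have Dm [measurable]: "D n \<in> borel_measurable M" for n unfolding D_def by measurable
  have D0: "D n t \<ge> 0" for n t by (simp add: D_def)
  define C' where "C' = 2 powr p * (C + (LINT t|M. K t * norm (x t) powr p))"
  have Dp: "D n t powr p \<le> 2 powr p * (norm (X n t) powr p + norm (x t) powr p)" for n t
  proof -
    have "D n t \<le> 2 * max (norm (X n t)) (norm (x t))"
      unfolding D_def using norm_triangle_ineq4[of "X n t" "x t"] by linarith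
    then have "D n t powr p \<le> (2 * max (norm (X n t)) (norm (x t))) powr p"
      using p D0 by (intro powr_mono2) auto
    also have "\<dots> = 2 powr p * max (norm (X n t)) (norm (x t)) powr p" by (simp add: powr_mult)
    also have "max (norm (X n t)) (norm (x t)) powr p \<le> norm (X n t) powr p + norm (x t) powr p"
      by (simp add: max_def)
    finally show ?thesis by simp
  qed
  have Dpi: "integrable M (\<lambda>t. K t * D n t powr p)" "(LINT t|M. K t * D n t powr p) \<le> C'" for n
  proof -
    have i: "integrable M (\<lambda>t. 2 powr p * (K t * norm (X n t) powr p + K t * norm (x t) powr p))"
      using Xi xi by simp
    have b: "K t * D n t powr p \<le> 2 powr p * (K t * norm (X n t) powr p + K t * norm (x t) powr p)" for t
      using mult_left_mono[OF Dp[of n t] K(2)[of t]] by (simp add: algebra_simps)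
    show i2: "integrable M (\<lambda>t. K t * D n t powr p)"
      by (rule Bochner_Integration.integrable_bound[OF i]) (use b K(2) in \<open>auto intro!: AE_I2 order_trans[OF b abs_ge_self]\<close>)
    have "(LINT t|M. K t * D n t powr p) \<le> (LINT t|M. 2 powr p * (K t * norm (X n t) powr p + K t * norm (x t) powr p))"
      by (rule integral_mono[OF i2 i b])
    also have "\<dots> \<le> C'" unfolding C'_def using Xi xi Xb[of n] by simp
    finally show "(LINT t|M. K t * D n t powr p) \<le> C'" .
  qed
  have C': "C' \<ge> 0" using order_trans[OF integral_nonneg_AE Dpi(2)[of 0]] K(2) by simp
  have Di: "integrable M (\<lambda>t. K t * D n t)" for n
    unfolding D_def by (rule int1) (use Dpi(1)[of n] in \<open>auto simp: D_def\<close>)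
  have Dlim: "(\<lambda>n. LINT t|M. K t * min (D n t) N) \<longlonglongrightarrow> (LINT t|M. 0)" if N: "N > 0" for N
  proof (rule integral_dominated_convergence[where w="\<lambda>t. N * K t"])
    show "AE t in M. (\<lambda>n. K t * min (D n t) N) \<longlonglongrightarrow> 0"
      using lim
    proof eventually_elim
      case (elim t)
      have "(\<lambda>n. K t * min (norm (X n t - x t)) N) \<longlonglongrightarrow> K t * min (norm (x t - x t)) N"
        by (intro tendsto_intros elim)
      then show ?case using N by (simp add: D_def)
    qed
    show "AE t in M. norm (K t * min (D n t) N) \<le> N * K t" for n
      using D0 K(2) N by (intro AE_I2) (simp add: abs_mult mult.commute[of N] mult_left_mono)
  qed (use K in auto)
  have bnd: "(LINT t|M. K t * D n t) \<le> (LINT t|M. K t * min (D n t) N) + C' * N powr (1 - p)" if N: "N > 0" for N n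
  proof -
    \<comment> \<open>Where D > N, write D = D^(1 - p) D^p and use that 1 - p is negative.\<close>
    have pt: "D n t \<le> min (D n t) N + N powr (1 - p) * D n t powr p" for t
    proof (cases "D n t \<le> N")
      case False
      have "D n t = D n t powr (1 - p) * D n t powr p" using False N by (simp add: powr_add[symmetric])
      also have "\<dots> \<le> N powr (1 - p) * D n t powr p"
        using False N p by (intro mult_right_mono powr_mono2') auto
      also have "\<dots> \<le> min (D n t) N + \<dots>" using N D0[of n t] by simp
      finally show ?thesis .
    qed (simp add: min_def)
    have im: "integrable M (\<lambda>t. K t * min (D n t) N)"
      by (rule Bochner_Integration.integrable_bound[OF Di[of n]])
         (use K D0 N in \<open>auto intro!: AE_I2 mult_left_mono simp: abs_mult\<close>)
    have "(LINT t|M. K t * D n t) \<le> (LINT t|M. K t * min (D n t) N + N powr (1 - p) * (K t * D n t powr p))"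
    proof (rule integral_mono[OF Di])
      show "integrable M (\<lambda>t. K t * min (D n t) N + N powr (1 - p) * (K t * D n t powr p))"
        using im Dpi(1) by simp
      show "K t * D n t \<le> K t * min (D n t) N + N powr (1 - p) * (K t * D n t powr p)" for t
        using mult_left_mono[OF pt[of t] K(2)[of t]] by (simp add: algebra_simps)
    qed
    also have "\<dots> = (LINT t|M. K t * min (D n t) N) + N powr (1 - p) * (LINT t|M. K t * D n t powr p)"
      using im Dpi(1) by simp
    also have "\<dots> \<le> (LINT t|M. K t * min (D n t) N) + N powr (1 - p) * C'"
      using Dpi(2)[of n] by (intro add_left_mono mult_left_mono) auto
    finally show ?thesis by (simp add: mult.commute)
  qed
  show "(\<lambda>n. LINT t|M. K t * norm (X n t - x t)) \<longlonglongrightarrow> 0"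
  proof (rule LIMSEQ_I)
    fix r :: real assume r: "r > 0"
    have "((\<lambda>N. C' * N powr (1 - p)) \<longlongrightarrow> C' * 0) at_top"
      using p by (intro tendsto_intros tendsto_neg_powr filterlim_ident) auto
    then have "\<forall>\<^sub>F N in at_top. C' * N powr (1 - p) < r / 2"
      using r by (intro order_tendstoD(2)) auto
    then have "\<forall>\<^sub>F N in at_top. C' * N powr (1 - p) < r / 2 \<and> N > 0"
      using eventually_gt_at_top[of 0] by eventually_elim auto
    then obtain N where N: "C' * N powr (1 - p) < r / 2" "N > 0"
      using eventually_happens'[OF trivial_limit_at_top_linorder] by blast
    have "\<forall>\<^sub>F n in sequentially. (LINT t|M. K t * min (D n t) N) < r / 2"
      using Dlim[OF N(2)] r by (intro order_tendstoD(2)) auto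
    then obtain n0 where n0: "\<And>n. n \<ge> n0 \<Longrightarrow> (LINT t|M. K t * min (D n t) N) < r / 2"
      unfolding eventually_sequentially by blast
    show "\<exists>no. \<forall>n\<ge>no. norm ((LINT t|M. K t * norm (X n t - x t)) - 0) < r"
    proof (intro exI allI impI)
      fix n assume "n \<ge> n0"
      then have "(LINT t|M. K t * D n t) < r"
        using bnd[OF N(2), of n] n0[of n] N(1) by linarith
      moreover have "(LINT t|M. K t * D n t) \<ge> 0" using K D0 by (intro integral_nonneg_AE AE_I2) simp
      ultimately show "norm ((LINT t|M. K t * norm (X n t - x t)) - 0) < r" by (simp add: D_def)
    qed
  qed
qed

section \<open>Boundary values of Hardy functions\<close>


lemma integral_le_nn_integral_bound:
  fixes g :: "real \<Rightarrow> real"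
  assumes g: "continuous_on {a..b} g" "\<And>x. g x \<ge> 0"
    and C: "(\<integral>\<^sup>+x. ennreal (g x) \<partial>lebesgue) \<le> ennreal C" "C \<ge> 0"
  shows "integral {a..b} g \<le> C"
proof -
  have si: "set_integrable lebesgue {a..b} g"
    by (rule absolutely_integrable_continuous_real[OF g(1)])
  have "ennreal (integral {a..b} g) = ennreal (LINT x|lebesgue. indicator {a..b} x *\<^sub>R g x)"
    using set_lebesgue_integral_eq_integral(2)[OF si] by (simp add: set_lebesgue_integral_def)
  also have "\<dots> = (\<integral>\<^sup>+x. ennreal (indicator {a..b} x *\<^sub>R g x) \<partial>lebesgue)"
    using si g(2) unfolding set_integrable_def by (intro nn_integral_eq_integral[symmetric]) auto
  also have "\<dots> \<le> (\<integral>\<^sup>+x. ennreal (g x) \<partial>lebesgue)"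
    using g(2) by (intro nn_integral_mono ennreal_leI) (auto simp: indicator_def)
  finally show ?thesis using C by (meson ennreal_le_iff order_trans)
qed

lemma hardy_fun_line_bound:
  assumes "hardy_fun p F"
  obtains C where "C \<ge> 0" "\<And>y. y > 0 \<Longrightarrow> (\<integral>\<^sup>+x. ennreal (norm (F (Complex x y)) powr p) \<partial>lebesgue) \<le> ennreal C"
proof -
  define S where "S = (SUP y\<in>{0<..}. \<integral>\<^sup>+x. ennreal (norm (F (Complex x y)) powr p) \<partial>lebesgue)"
  have "S < \<infinity>" using assms by (simp add: hardy_fun_def S_def)
  then obtain C where C: "S = ennreal C" "C \<ge> 0" by (cases S) auto
  have "(\<integral>\<^sup>+x. ennreal (norm (F (Complex x y)) powr p) \<partial>lebesgue) \<le> ennreal C" if "y > 0" for y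
    unfolding C(1)[symmetric] S_def by (rule SUP_upper) (use that in simp)
  with C(2) show ?thesis by (rule that)
qed

lemma hardy_fun_holomorphic: "hardy_fun p F \<Longrightarrow> F holomorphic_on {z. Im z > 0}"
  by (simp add: hardy_fun_def upper_half_plane_def)

text \<open>
  The integrals of \<open>F\<close> over horizontal unit segments are uniformly bounded, so Cauchy's estimate for
  the differences \<open>P (z + h) - P z\<close> of a primitive bounds \<open>F (z + h) - F z\<close>.
\<close>

lemma hardy_fun_bounded:
  assumes p: "p > 1" and F: "hardy_fun p F" and e: "e > 0"
  obtains M where "\<And>z. Im z > e \<Longrightarrow> norm (F z) \<le> M"
proof -
  obtain C where C: "C \<ge> 0" "\<And>y. y > 0 \<Longrightarrow> (\<integral>\<^sup>+x. ennreal (norm (F (Complex x y)) powr p) \<partial>lebesgue) \<le> ennreal C"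
    using hardy_fun_line_bound[OF F] by blast
  define U where "U = {z. Im z > 0}"
  have hol: "F holomorphic_on U" using hardy_fun_holomorphic[OF F] by (simp add: U_def)
  have U: "open U" "convex U" by (auto simp: U_def open_halfspace_Im_gt convex_halfspace_Im_gt)
  obtain P where P: "\<And>w. w \<in> U \<Longrightarrow> (P has_field_derivative F w) (at w within U)"
    using holomorphic_convex_primitive'[OF U(2,1) hol] by blast
  have P': "(P has_field_derivative F w) (at w)" if "w \<in> U" for w
    using P[OF that] at_within_open[OF that U(1)] by simp
  have hi: "((\<lambda>x. F (Complex x (Im z))) has_integral P (z + of_real h) - P z) {Re z..Re z + h}"
    if z: "Im z > 0" and h: "h \<ge> 0" for z h
  proof -
    have "((\<lambda>x. F (Complex x (Im z))) has_integral P (Complex (Re z + h) (Im z)) - P (Complex (Re z) (Im z))) {Re z..Re z + h}"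
    proof (rule fundamental_theorem_of_calculus)
      fix x assume "x \<in> {Re z..Re z + h}"
      have eq: "Complex x (Im z) = of_real x + \<i> * of_real (Im z)" for x by (simp add: complex_eq_iff)
      have "((\<lambda>w. P (w + \<i> * of_real (Im z))) has_field_derivative F (of_real x + \<i> * of_real (Im z)) * 1) (at (of_real x))"
        by (rule DERIV_chain2[OF P']) (use z in \<open>auto simp: U_def intro!: derivative_eq_intros\<close>)
      then show "((\<lambda>x. P (Complex x (Im z))) has_vector_derivative F (Complex x (Im z))) (at x within {Re z..Re z + h})"
        unfolding eq mult_1_right by (rule has_vector_derivative_at_within[OF has_vector_derivative_real_field])
    qed (use h in simp)
    moreover have "Complex (Re z + h) (Im z) = z + of_real h" by (simp add: complex_eq_iff)
    ultimately show ?thesis by simp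
  qed
  have Fc: "continuous_on UNIV (\<lambda>x. F (Complex x y))" if "y > 0" for y
  proof -
    have "(\<lambda>x. Complex x y) = (\<lambda>x. of_real x + \<i> * of_real y)" by (auto simp: complex_eq_iff)
    then have "continuous_on UNIV (\<lambda>x. Complex x y)" by (simp add: continuous_intros)
    then show ?thesis
      by (rule continuous_on_compose2[OF holomorphic_on_imp_continuous_on[OF hol]]) (use that in \<open>auto simp: U_def\<close>)
  qed
  have diff: "norm (P (z + of_real h) - P z) \<le> 1 + C" if z: "Im z > 0" and h: "0 \<le> h" "h \<le> 1" for z h
  proof -
    have g: "continuous_on {Re z..Re z + h} (\<lambda>x. norm (F (Complex x (Im z))) powr p)"
      using p by (intro continuous_intros continuous_on_powr' continuous_on_subset[OF Fc[OF z]]) auto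
    note le1 = le_one_plus_powr[OF less_imp_le[OF p]]
    have "P (z + of_real h) - P z = integral {Re z..Re z + h} (\<lambda>x. F (Complex x (Im z)))"
      using integral_unique[OF hi[OF z h(1)]] by simp
    \<comment> \<open>Since |F| <= 1 + |F|^p and the segment has length h <= 1, the line integral
      bound C yields the bound 1 + C.\<close>
    also have "norm \<dots> \<le> integral {Re z..Re z + h} (\<lambda>x. 1 + norm (F (Complex x (Im z))) powr p)"
      by (rule integral_norm_bound_integral[OF has_integral_integrable[OF hi[OF z h(1)]]
            integrable_continuous_real[OF continuous_on_add[OF continuous_on_const g]] le1[OF norm_ge_zero]])
    also have "\<dots> = integral {Re z..Re z + h} (\<lambda>x. 1) + integral {Re z..Re z + h} (\<lambda>x. norm (F (Complex x (Im z))) powr p)"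
      by (rule integral_add[OF integrable_const_ivl integrable_continuous_real[OF g]])
    also have "\<dots> \<le> 1 + C"
    proof (rule add_mono)
      show "integral {Re z..Re z + h} (\<lambda>x. 1) \<le> (1::real)" using h by simp
      show "integral {Re z..Re z + h} (\<lambda>x. norm (F (Complex x (Im z))) powr p) \<le> C"
        by (rule integral_le_nn_integral_bound[OF g _ C(2)[OF z] C(1)]) simp
    qed
    finally show ?thesis .
  qed
  define B where "B = 2 * (1 + C) / e"
  have Fdiff: "norm (F (z + of_real h) - F z) \<le> B" if z: "Im z > e" and h: "0 \<le> h" "h \<le> 1" for z h
  proof -
    define Q where "Q = (\<lambda>w. P (w + of_real h) - P w)"
    have sub: "w \<in> U" "w + of_real h \<in> U" if "w \<in> cball z (e/2)" for w
    proof -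
      have "norm (z - w) \<le> e / 2" using that by (simp add: dist_norm)
      then have "\<bar>Im z - Im w\<bar> \<le> e / 2" using abs_Im_le_cmod[of "z - w"] by simp
      then have "Im w > 0" using z e by linarith
      then show "w \<in> U" "w + of_real h \<in> U" by (auto simp: U_def)
    qed
    have Qd: "(Q has_field_derivative (F (w + of_real h) - F w)) (at w)" if "w \<in> cball z (e/2)" for w
    proof -
      have "((\<lambda>w. P (w + of_real h)) has_field_derivative F (w + of_real h) * 1) (at w)"
        by (rule DERIV_chain2[where f=P and g="\<lambda>w. w + of_real h", OF P'[OF sub(2)[OF that]]]) (auto intro!: derivative_eq_intros)
      then show ?thesis unfolding Q_def using P'[OF sub(1)[OF that]] by (auto intro!: derivative_eq_intros)
    qed
    have Qh: "Q holomorphic_on cball z (e/2)"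
      unfolding holomorphic_on_def field_differentiable_def
      using has_field_derivative_at_within[OF Qd] by blast
    have "norm ((deriv ^^ 1) Q z) \<le> fact 1 * (1 + C) / (e/2)^1"
    proof (rule Cauchy_inequality)
      show "Q holomorphic_on ball z (e/2)" by (rule holomorphic_on_subset[OF Qh ball_subset_cball])
      show "continuous_on (cball z (e/2)) Q" by (rule holomorphic_on_imp_continuous_on[OF Qh])
      fix x assume "norm (z - x) = e/2"
      then have "x \<in> U" using sub(1) by (simp add: dist_norm)
      then show "norm (Q x) \<le> 1 + C" unfolding Q_def using diff[of x h] h by (simp add: U_def)
    qed (use e in simp)
    moreover have "deriv Q z = F (z + of_real h) - F z" using Qd[of z] e by (intro DERIV_imp_deriv) simp
    ultimately show ?thesis by (simp add: B_def mult.commute)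
  qed
  show ?thesis
  proof (rule that[of "B + (1 + C)"])
    fix z assume z: "Im z > e"
    then have z0: "Im z > 0" using e by linarith
    \<comment> \<open>The mean of F over a unit segment starting at z is P (z + 1) - P z, which is
      bounded, and F deviates from F z by at most B on that segment.\<close>
    have "((\<lambda>x. F (Complex x (Im z)) - F z) has_integral (P (z + of_real 1) - P z) - 1 *\<^sub>R F z) {Re z..Re z + 1}"
      using has_integral_diff[OF hi[OF z0, of 1] has_integral_const_real[of "F z" "Re z" "Re z + 1"]] by simp
    then have "norm ((P (z + of_real 1) - P z) - 1 *\<^sub>R F z) \<le> B * measure lborel {Re z..Re z + 1}"
    proof (rule has_integral_bound_real[rotated 2])
      show "finite ({} :: real set)" by simp
      show "B \<ge> 0" using C e by (simp add: B_def)
      fix x assume "x \<in> {Re z..Re z + 1} - {}"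
      then have "norm (F (z + of_real (x - Re z)) - F z) \<le> B" by (intro Fdiff z) auto
      moreover have "z + of_real (x - Re z) = Complex x (Im z)" by (simp add: complex_eq_iff)
      ultimately show "norm (F (Complex x (Im z)) - F z) \<le> B" by simp
    qed
    then have "norm (F z - (P (z + of_real 1) - P z)) \<le> B" by (simp add: norm_minus_commute)
    then show "norm (F z) \<le> B + (1 + C)"
      using diff[OF z0, of 1] norm_triangle_sub[of "F z" "P (z + of_real 1) - P z"] by simp
  qed
qed


lemma Lp_integrable: "f \<in> Lp p \<Longrightarrow> integrable lebesgue (\<lambda>x. norm (f x) powr p)"
  by (simp add: Lp_def)

lemma Lp_measurable: "f \<in> Lp p \<Longrightarrow> f \<in> borel_measurable lebesgue"
  by (simp add: Lp_def)

text \<open>The vertical approach stays in the cone of aperture 1. The heights 1/(n + 1) are those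
  of the shifts used in the passage to the boundary.\<close>

lemma nontangential_limit_vertical:
  assumes "nontangential_limit F x l"
  shows "(\<lambda>n. F (Complex x (1 / real (Suc n)))) \<longlonglongrightarrow> l"
proof -
  have 1: "(F \<longlongrightarrow> l) (at (complex_of_real x) within {z. Im z > 0 \<and> \<bar>Re z - x\<bar> < 1 * Im z})"
    using assms unfolding nontangential_limit_def by (meson zero_less_one)
  have "(\<lambda>n. of_real x + \<i> * of_real (1 / real (Suc n))) \<longlonglongrightarrow> of_real x + \<i> * of_real 0"
    using LIMSEQ_inverse_real_of_nat by (intro tendsto_intros) (simp add: inverse_eq_divide)
  then have lim: "(\<lambda>n. Complex x (1 / real (Suc n))) \<longlonglongrightarrow> of_real x"
    by (simp add: complex_eq_iff Complex_eq)
  show ?thesis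
  proof (rule filterlim_compose[OF 1])
    show "filterlim (\<lambda>n. Complex x (1 / real (Suc n))) (at (complex_of_real x) within {z. Im z > 0 \<and> \<bar>Re z - x\<bar> < 1 * Im z}) sequentially"
      unfolding filterlim_at using lim by (auto intro!: always_eventually simp: complex_eq_iff)
  qed
qed

text \<open>All four claims are limits of facts about the bounded shifts \<open>G n\<close>. The
  Poisson formula passes to the limit by the weighted convergence above. The logarithm has no
  integrable majorant near the zeros of f, so that part rests on Fatou's lemma, which also yields
  that f vanishes almost nowhere.\<close>

lemma
  fixes p :: real
  assumes p: "p > 1" and F: "hardy_fun p F" and bv: "boundary_value F f" and f: "f \<in> Lp p" and z: "Im z > 0"
  shows hardy_poisson: "F z = (LINT t|lebesgue. poisson z t *\<^sub>R f t)"
    and hardy_log_integrable: "F z \<noteq> 0 \<Longrightarrow> integrable lebesgue (\<lambda>t. poisson z t * ln (norm (f t)))"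
    and hardy_boundary_nonzero: "F z \<noteq> 0 \<Longrightarrow> AE t in lebesgue. f t \<noteq> 0"
    and hardy_log_le: "F z \<noteq> 0 \<Longrightarrow> ln (norm (F z)) \<le> (LINT t|lebesgue. poisson z t * ln (norm (f t)))"
proof -
  obtain C where C: "C \<ge> 0" "\<And>y. y > 0 \<Longrightarrow> (\<integral>\<^sup>+x. ennreal (norm (F (Complex x y)) powr p) \<partial>lebesgue) \<le> ennreal C"
    using hardy_fun_line_bound[OF F] by blast
  have hol: "F holomorphic_on {z. Im z > 0}" by (rule hardy_fun_holomorphic[OF F])
  define \<epsilon> where "\<epsilon> = (\<lambda>n. 1 / real (Suc n))"
  have eps: "\<epsilon> n > 0" for n by (simp add: \<epsilon>_def)
  have eps0: "\<epsilon> \<longlonglongrightarrow> 0" unfolding \<epsilon>_def using LIMSEQ_inverse_real_of_nat by (simp add: inverse_eq_divide)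
  \<comment> \<open>F is bounded on Im z > \<open>\<epsilon> n / 2\<close>, so each shift is bounded
    and holomorphic on a half-plane that contains the closed upper one.\<close>
  define G where "G = (\<lambda>n w. F (w + \<i> * of_real (\<epsilon> n)))"
  define X where "X = (\<lambda>n t. G n (of_real t))"
  have XF: "X n t = F (Complex t (\<epsilon> n))" for n t
    by (simp add: X_def G_def Complex_eq)
  have Gh: "G n holomorphic_on {z. Im z > - (\<epsilon> n / 2)}" for n
    unfolding G_def
    by (rule holomorphic_on_compose_gen[OF _ hol, unfolded o_def]) 
       (use eps[of n] in \<open>auto intro!: holomorphic_intros\<close>)
  have e2: "\<epsilon> n / 2 > 0" for n using eps by simp
  have "\<exists>M. \<forall>w. Im w > - (\<epsilon> n / 2) \<longrightarrow> norm (G n w) \<le> M" for n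
  proof -
    obtain M where M: "\<And>z. Im z > \<epsilon> n / 2 \<Longrightarrow> norm (F z) \<le> M"
      using hardy_fun_bounded[OF p F e2] by blast
    show ?thesis unfolding G_def by (intro exI[of _ M] allI impI M) simp
  qed
  then obtain M where M: "\<And>n w. Im w > - (\<epsilon> n / 2) \<Longrightarrow> norm (G n w) \<le> M n" by metis
  have M': "\<And>n w. Im w \<ge> 0 \<Longrightarrow> norm (G n w) \<le> M n" using M e2 by (smt (verit))
  define K where "K = poisson z"
  have K: "integrable lebesgue K" "\<And>t. K t \<ge> 0" "\<And>t. K t > 0"
    unfolding K_def using integrable_poisson poisson_nonneg poisson_pos z by auto
  have Km [measurable]: "K \<in> borel_measurable lebesgue" by (simp add: K_def poisson_measurable_lebesgue)
  have fm [measurable]: "f \<in> borel_measurable lebesgue" by (rule Lp_measurable[OF f])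
  have Xm [measurable]: "X n \<in> borel_measurable lebesgue" for n
    unfolding X_def
    by (intro borel_imp_lebesgue_measurable borel_measurable_continuous_onI
         continuous_on_compose2[OF holomorphic_on_imp_continuous_on[OF Gh[of n]]])
       (use e2[of n] in \<open>auto intro!: continuous_intros\<close>)
  have Xlim: "AE t in lebesgue. (\<lambda>n. X n t) \<longlonglongrightarrow> f t"
    using bv unfolding boundary_value_def
    by (rule AE_mp) (auto intro!: AE_I2 simp: XF \<epsilon>_def dest!: nontangential_limit_vertical)
  have Xi: "integrable lebesgue (\<lambda>t. norm (X n t) powr p)" "(LINT t|lebesgue. norm (X n t) powr p) \<le> C" for n
  proof -
    have 1: "(\<integral>\<^sup>+t. ennreal (norm (X n t) powr p) \<partial>lebesgue) \<le> ennreal C"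
      unfolding XF by (rule C(2)[OF eps])
    then show i: "integrable lebesgue (\<lambda>t. norm (X n t) powr p)"
      by (intro integrableI_nonneg) (auto simp: order_le_less_trans)
    show "(LINT t|lebesgue. norm (X n t) powr p) \<le> C"
      using 1 C(1) by (subst (asm) nn_integral_eq_integral[OF i]) auto
  qed
  define c where "c = 1 / (pi * Im z)"
  have c: "c \<ge> 0" "\<And>t. K t \<le> c" using poisson_le[OF z] z by (auto simp: c_def K_def)
  have Kg: "integrable lebesgue (\<lambda>t. K t * g t)" if "integrable lebesgue g" "\<And>t. g t \<ge> 0" for g :: "real \<Rightarrow> real"
    by (rule Bochner_Integration.integrable_bound[OF integrable_mult_right[OF that(1), of c]])
       (use that c K borel_measurable_integrable[OF that(1)] in \<open>auto intro!: AE_I2 mult_right_mono simp: abs_mult\<close>)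
  have KXi: "integrable lebesgue (\<lambda>t. K t * norm (X n t) powr p)" for n
    by (rule Kg[OF Xi(1)]) simp
  have KXb: "(LINT t|lebesgue. K t * norm (X n t) powr p) \<le> c * C" for n
  proof -
    have "(LINT t|lebesgue. K t * norm (X n t) powr p) \<le> (LINT t|lebesgue. c * norm (X n t) powr p)"
      by (rule integral_mono[OF KXi integrable_mult_right[OF Xi(1)]]) (simp add: c mult_right_mono)
    also have "\<dots> \<le> c * C" using Xi(2)[of n] c by (simp add: mult_left_mono)
    finally show ?thesis .
  qed
  have Kfi: "integrable lebesgue (\<lambda>t. K t * norm (f t) powr p)"
    by (rule Kg[OF Lp_integrable[OF f]]) simp
  note conv = weighted_L1_convergence[OF p K(1,2) Xm fm Xlim KXi KXb Kfi]
  have vint: "integrable lebesgue (\<lambda>t. K t *\<^sub>R g t)" if "integrable lebesgue (\<lambda>t. K t * norm (g t))" "g \<in> borel_measurable lebesgue" for g :: "real \<Rightarrow> complex"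
    by (rule Bochner_Integration.integrable_bound[OF that(1)]) (use that(2) K in auto)
  have KX: "integrable lebesgue (\<lambda>t. K t *\<^sub>R X n t)" for n by (rule vint[OF conv(1) Xm])
  have Kf: "integrable lebesgue (\<lambda>t. K t *\<^sub>R f t)" by (rule vint[OF conv(2) fm])
  have Glim: "(\<lambda>n. G n z) \<longlonglongrightarrow> F z"
  proof -
    have "isCont F z"
      by (rule continuous_on_interior[OF holomorphic_on_imp_continuous_on[OF hol]])
         (use z in \<open>simp add: interior_open open_halfspace_Im_gt\<close>)
    moreover have "(\<lambda>n. z + \<i> * of_real (\<epsilon> n)) \<longlonglongrightarrow> z + \<i> * of_real 0" by (intro tendsto_intros eps0)
    ultimately show ?thesis unfolding G_def using isCont_tendsto_compose[of z F] by simp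
  qed
  have "(\<lambda>n. LINT t|lebesgue. K t *\<^sub>R X n t) \<longlonglongrightarrow> (LINT t|lebesgue. K t *\<^sub>R f t)"
  proof (rule LIM_zero_cancel, rule Lim_null_comparison[OF _ conv(3)], rule always_eventually, rule allI)
    fix n
    have "(LINT t|lebesgue. K t *\<^sub>R X n t) - (LINT t|lebesgue. K t *\<^sub>R f t) = (LINT t|lebesgue. K t *\<^sub>R X n t - K t *\<^sub>R f t)"
      by (rule Bochner_Integration.integral_diff[OF KX Kf, symmetric])
    also have "norm \<dots> \<le> (LINT t|lebesgue. norm (K t *\<^sub>R X n t - K t *\<^sub>R f t))" by (rule integral_norm_bound)
    also have "\<dots> = (LINT t|lebesgue. K t * norm (X n t - f t))"
      using K(2) by (simp add: scaleR_diff_right[symmetric])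
    finally show "norm ((LINT t|lebesgue. K t *\<^sub>R X n t) - (LINT t|lebesgue. K t *\<^sub>R f t)) \<le> (LINT t|lebesgue. K t * norm (X n t - f t))" .
  qed
  moreover have "(LINT t|lebesgue. K t *\<^sub>R X n t) = G n z" for n
    unfolding X_def K_def using poisson_formula(2)[OF e2[of n] Gh[of n] M'[of _ n] z] by simp
  ultimately have Fz: "F z = (LINT t|lebesgue. K t *\<^sub>R f t)" using Glim LIMSEQ_unique by simp
  then show "F z = (LINT t|lebesgue. poisson z t *\<^sub>R f t)" by (simp add: K_def)

  define A where "A = (LINT t|lebesgue. K t * norm (f t))"
  have Alim: "(\<lambda>n. (LINT t|lebesgue. K t * norm (X n t)) + \<epsilon> n) \<longlonglongrightarrow> A + 0"
  proof (rule tendsto_add[OF _ eps0], rule LIM_zero_cancel, rule Lim_null_comparison[OF _ conv(3)], rule always_eventually, rule allI)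
    fix n
    have i3: "integrable lebesgue (\<lambda>t. K t * norm (X n t - f t))"
      by (rule Bochner_Integration.integrable_bound[OF Bochner_Integration.integrable_add[OF conv(1)[of n] conv(2)]])
         (use K(2) in \<open>auto intro!: AE_I2 mult_left_mono norm_triangle_ineq4 simp: abs_mult distrib_left[symmetric]\<close>)
    have "(LINT t|lebesgue. K t * norm (X n t)) - A = (LINT t|lebesgue. K t * norm (X n t) - K t * norm (f t))"
      unfolding A_def by (rule Bochner_Integration.integral_diff[OF conv(1,2), symmetric])
    also have "\<bar>\<dots>\<bar> \<le> (LINT t|lebesgue. \<bar>K t * norm (X n t) - K t * norm (f t)\<bar>)"
      by (rule integral_abs_bound)
    also have "\<dots> \<le> (LINT t|lebesgue. K t * norm (X n t - f t))"
    proof (rule integral_mono[OF integrable_abs[OF Bochner_Integration.integrable_diff[OF conv(1,2)]] i3])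
      fix t
      have "\<bar>K t * norm (X n t) - K t * norm (f t)\<bar> = K t * \<bar>norm (X n t) - norm (f t)\<bar>"
        using K(2) by (simp add: abs_mult right_diff_distrib[symmetric])
      also have "\<dots> \<le> K t * norm (X n t - f t)" by (intro mult_left_mono norm_triangle_ineq3 K(2))
      finally show "\<bar>K t * norm (X n t) - K t * norm (f t)\<bar> \<le> K t * norm (X n t - f t)" .
    qed
    finally show "norm ((LINT t|lebesgue. K t * norm (X n t)) - A) \<le> (LINT t|lebesgue. K t * norm (X n t - f t))"
      by simp
  qed

  assume nz: "F z \<noteq> 0"
  \<comment> \<open>\<open>\<epsilon> n\<close> serves as the \<open>\<delta>\<close> of the bounded
    case: positive for each n, so that the logarithm is bounded below, and gone in the
    limit.\<close>
  define Y where "Y = (\<lambda>n t. norm (X n t) + \<epsilon> n)"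
  have Y: "Y n t > 0" for n t using eps[of n] by (simp add: Y_def add_nonneg_pos)
  have Ym [measurable]: "Y n \<in> borel_measurable lebesgue" for n unfolding Y_def by measurable
  define I where "I = (\<lambda>n. LINT t|lebesgue. K t * ln (Y n t))"
  have KY: "integrable lebesgue (\<lambda>t. K t * Y n t)" "(LINT t|lebesgue. K t * Y n t) = (LINT t|lebesgue. K t * norm (X n t)) + \<epsilon> n" for n
    using conv(1)[of n] K(1) integral_poisson[OF z] by (auto simp: Y_def distrib_left K_def)
  have KlnY: "integrable lebesgue (\<lambda>t. K t * ln (Y n t))" for n
  proof (rule Bochner_Integration.integrable_bound)
    show "integrable lebesgue (\<lambda>t. K t * Y n t + \<bar>ln (\<epsilon> n)\<bar> * K t)"
      using KY(1)[of n] K(1) by simp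
    show "AE t in lebesgue. norm (K t * ln (Y n t)) \<le> norm (K t * Y n t + \<bar>ln (\<epsilon> n)\<bar> * K t)"
    proof (rule AE_I2)
      fix t
      have "ln (\<epsilon> n) \<le> ln (Y n t)" using eps[of n] Y[of n t] by (subst ln_le_cancel_iff) (auto simp: Y_def)
      moreover have "ln (Y n t) \<le> Y n t" using ln_le_minus_one[OF Y[of n t]] by simp
      ultimately have "\<bar>ln (Y n t)\<bar> \<le> Y n t + \<bar>ln (\<epsilon> n)\<bar>" using Y[of n t] by linarith
      then have "K t * \<bar>ln (Y n t)\<bar> \<le> K t * (Y n t + \<bar>ln (\<epsilon> n)\<bar>)" by (intro mult_left_mono K(2))
      then show "norm (K t * ln (Y n t)) \<le> norm (K t * Y n t + \<bar>ln (\<epsilon> n)\<bar> * K t)"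
        using K(2)[of t] Y[of n t] by (simp add: abs_mult distrib_left mult.commute)
    qed
  qed measurable
  have GI: "norm (G n z) \<le> exp (I n)" for n
    using norm_le_exp_poisson_bounded[OF e2[of n] Gh[of n] M z eps[of n]] by (simp add: I_def Y_def X_def K_def)
  \<comment> \<open>Nonnegative because ln s <= s - 1, as Fatou's lemma requires. With the logarithm
    subtracted, the inequality ln |G n z| <= I n becomes an upper bound for the integrals of W
    n.\<close>
  define W where "W = (\<lambda>n t. K t * (Y n t - ln (Y n t)))"
  have W0: "W n t \<ge> 0" for n t
    using ln_le_minus_one[OF Y[of n t]] K(2)[of t] by (simp add: W_def)
  have Wi: "(\<integral>\<^sup>+t. ennreal (W n t) \<partial>lebesgue) = ennreal ((LINT t|lebesgue. K t * norm (X n t)) + \<epsilon> n - I n)" for n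
  proof -
    have "integrable lebesgue (W n)" unfolding W_def right_diff_distrib
      by (rule Bochner_Integration.integrable_diff[OF KY(1) KlnY])
    then have "(\<integral>\<^sup>+t. ennreal (W n t) \<partial>lebesgue) = ennreal (LINT t|lebesgue. W n t)"
      by (rule nn_integral_eq_integral) (simp add: W0)
    also have "(LINT t|lebesgue. W n t) = (LINT t|lebesgue. K t * Y n t) - I n"
      unfolding W_def right_diff_distrib I_def by (rule Bochner_Integration.integral_diff[OF KY(1) KlnY])
    finally show ?thesis by (simp add: KY(2))
  qed
  \<comment> \<open>At a zero of f the values W n t tend to infinity, which the default
    \<open>ln 0 = 0\<close> would hide. Finiteness of the integral of L therefore excludes a set of
    zeros of positive measure.\<close>
  define L where "L = (\<lambda>t. if f t = 0 then \<infinity> else ennreal (K t * (norm (f t) - ln (norm (f t)))))"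
  have Lm [measurable]: "L \<in> borel_measurable lebesgue" unfolding L_def by measurable
  have Llim: "AE t in lebesgue. L t \<le> liminf (\<lambda>n. ennreal (W n t))"
    using Xlim
  proof eventually_elim
    case (elim t)
    have Yl: "(\<lambda>n. Y n t) \<longlonglongrightarrow> norm (f t) + 0" unfolding Y_def by (intro tendsto_intros elim eps0)
    have "(\<lambda>n. ennreal (W n t)) \<longlonglongrightarrow> L t"
    proof (cases "f t = 0")
      case False
      then have "(\<lambda>n. W n t) \<longlonglongrightarrow> K t * (norm (f t) - ln (norm (f t)))"
        unfolding W_def using Yl by (intro tendsto_intros) auto
      then show ?thesis using False by (simp add: L_def)
    next
      case True
      have "filterlim (\<lambda>n. Y n t) (at_right 0) sequentially"
        unfolding filterlim_at using Yl True Y by (auto intro!: always_eventually simp: less_imp_neq[symmetric])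
      then have "filterlim (\<lambda>n. ln (Y n t)) at_bot sequentially"
        by (rule filterlim_compose[OF ln_at_0])
      then have "filterlim (\<lambda>n. - ln (Y n t)) at_top sequentially"
        by (simp add: filterlim_uminus_at_top_at_bot filterlim_compose[OF filterlim_uminus_at_top_at_bot])
      then have "filterlim (\<lambda>n. Y n t + - ln (Y n t)) at_top sequentially"
        using Yl by (rule filterlim_tendsto_add_at_top[rotated])
      then have "filterlim (\<lambda>n. W n t) at_top sequentially"
        unfolding W_def using filterlim_tendsto_pos_mult_at_top[OF tendsto_const K(3)[of t]] by simp
      then show ?thesis using True by (simp add: L_def ennreal_tendsto_top_eq_at_top)
    qed
    then show ?case by (metis lim_imp_Liminf order_refl trivial_limit_sequentially)
  qed
  have fin: "(\<integral>\<^sup>+t. L t \<partial>lebesgue) \<le> ennreal (A - ln (norm (F z)))"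
  proof -
    have "(\<integral>\<^sup>+t. L t \<partial>lebesgue) \<le> (\<integral>\<^sup>+t. liminf (\<lambda>n. ennreal (W n t)) \<partial>lebesgue)"
      by (rule nn_integral_mono_AE[OF Llim])
    also have "\<dots> \<le> liminf (\<lambda>n. \<integral>\<^sup>+t. ennreal (W n t) \<partial>lebesgue)"
      by (rule nn_integral_liminf) (simp add: W_def)
    also have "\<dots> \<le> liminf (\<lambda>n. ennreal ((LINT t|lebesgue. K t * norm (X n t)) + \<epsilon> n - ln (norm (G n z))))"
    proof (rule Liminf_mono)
      have "\<forall>\<^sub>F n in sequentially. G n z \<noteq> 0" by (rule tendsto_imp_eventually_ne[OF Glim nz])
      then show "\<forall>\<^sub>F n in sequentially. (\<integral>\<^sup>+t. ennreal (W n t) \<partial>lebesgue) \<le> ennreal ((LINT t|lebesgue. K t * norm (X n t)) + \<epsilon> n - ln (norm (G n z)))"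
      proof eventually_elim
        case (elim n)
        then have "ln (norm (G n z)) \<le> ln (exp (I n))" using GI[of n] by (subst ln_le_cancel_iff) auto
        then show ?case unfolding Wi by (intro ennreal_leI) simp
      qed
    qed
    also have "\<dots> = ennreal (A - ln (norm (F z)))"
    proof (rule lim_imp_Liminf)
      have "(\<lambda>n. (LINT t|lebesgue. K t * norm (X n t)) + \<epsilon> n - ln (norm (G n z))) \<longlonglongrightarrow> A + 0 - ln (norm (F z))"
        using nz by (intro tendsto_diff Alim tendsto_ln tendsto_norm Glim) auto
      then show "(\<lambda>n. ennreal ((LINT t|lebesgue. K t * norm (X n t)) + \<epsilon> n - ln (norm (G n z)))) \<longlonglongrightarrow> ennreal (A - ln (norm (F z)))"
        by (intro tendsto_ennrealI) simp
    qed simp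
    finally show ?thesis .
  qed
  have "AE t in lebesgue. L t \<noteq> \<infinity>"
    by (rule nn_integral_PInf_AE[OF Lm]) (use fin in \<open>auto simp: top_unique\<close>)
  then show f0: "AE t in lebesgue. f t \<noteq> 0" by (rule AE_mp) (auto intro!: AE_I2 simp: L_def)
  define V where "V = (\<lambda>t. K t * (norm (f t) - ln (norm (f t))))"
  have Vm [measurable]: "V \<in> borel_measurable lebesgue" unfolding V_def by measurable
  have V0: "AE t in lebesgue. V t \<ge> 0"
    using f0 by (rule AE_mp) (use ln_le_minus_one K(2) in \<open>auto intro!: AE_I2 mult_nonneg_nonneg simp: V_def\<close>, smt (verit) ln_le_minus_one zero_less_norm_iff)
  have "(\<integral>\<^sup>+t. ennreal (V t) \<partial>lebesgue) = (\<integral>\<^sup>+t. L t \<partial>lebesgue)"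
    by (rule nn_integral_cong_AE, rule AE_mp[OF f0]) (auto intro!: AE_I2 simp: L_def V_def)
  with fin have Vfin: "(\<integral>\<^sup>+t. ennreal (V t) \<partial>lebesgue) \<le> ennreal (A - ln (norm (F z)))" by simp
  have Vi: "integrable lebesgue V"
    by (rule integrableI_nonneg[OF Vm V0]) (use Vfin in \<open>auto simp: order_le_less_trans\<close>)
  have FA: "norm (F z) \<le> A"
    unfolding Fz A_def using integral_norm_bound[of lebesgue "\<lambda>t. K t *\<^sub>R f t"] K(2) by simp
  have "ln (norm (F z)) \<le> A" using ln_le_minus_one[of "norm (F z)"] nz FA by simp
  then have Vle: "(LINT t|lebesgue. V t) \<le> A - ln (norm (F z))"
    using Vfin by (subst (asm) nn_integral_eq_integral[OF Vi V0]) auto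
  \<comment> \<open>K ln |f| is recovered as a difference of two integrable functions.\<close>
  have lneq: "K t * ln (norm (f t)) = K t * norm (f t) - V t" for t by (simp add: V_def right_diff_distrib)
  show "integrable lebesgue (\<lambda>t. poisson z t * ln (norm (f t)))"
    unfolding K_def[symmetric] lneq by (rule Bochner_Integration.integrable_diff[OF conv(2) Vi])
  have "(LINT t|lebesgue. K t * ln (norm (f t))) = A - (LINT t|lebesgue. V t)"
    unfolding lneq A_def by (rule Bochner_Integration.integral_diff[OF conv(2) Vi])
  then show "ln (norm (F z)) \<le> (LINT t|lebesgue. poisson z t * ln (norm (f t)))"
    using Vle by (simp add: K_def)
qed

section \<open>Smirnov's theorem for quotients of outer functions\<close>


lemma Lp_cong_AE:
  assumes "f \<in> Lp p" "g \<in> borel_measurable lebesgue" "AE x in lebesgue. g x = f x"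
  shows "g \<in> Lp p"
proof -
  have "integrable lebesgue (\<lambda>x. norm (g x) powr p) \<longleftrightarrow> integrable lebesgue (\<lambda>x. norm (f x) powr p)"
    using Lp_measurable[OF assms(1)] assms(2,3) by (intro integrable_cong_AE) auto
  then show ?thesis using assms by (simp add: Lp_def)
qed

lemma boundary_value_cong_AE:
  "boundary_value F f \<Longrightarrow> AE x in lebesgue. g x = f x \<Longrightarrow> boundary_value F g"
  unfolding boundary_value_def by (elim AE_mp) (auto intro!: AE_I2)

lemma Lp_bound:
  assumes p: "p > 0" and f: "f \<in> Lp p" and g [measurable]: "g \<in> borel_measurable lebesgue"
    and b: "AE x in lebesgue. norm (g x) \<le> C * norm (f x)"
  shows "g \<in> Lp p"
proof -
  have "integrable lebesgue (\<lambda>x. norm (g x) powr p)"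
  proof (rule Bochner_Integration.integrable_bound[OF integrable_mult_right[OF Lp_integrable[OF f], of "\<bar>C\<bar> powr p"]])
    show "AE x in lebesgue. norm (norm (g x) powr p) \<le> norm (\<bar>C\<bar> powr p * norm (f x) powr p)"
      using b
    proof eventually_elim
      case (elim x)
      then have "norm (g x) \<le> \<bar>C\<bar> * norm (f x)"
        by (meson abs_ge_self mult_right_mono norm_ge_zero order_trans)
      then have "norm (g x) powr p \<le> (\<bar>C\<bar> * norm (f x)) powr p" using p by (intro powr_mono2) auto
      then show ?case by (simp add: powr_mult)
    qed
  qed measurable
  then show ?thesis using g by (simp add: Lp_def)
qed

lemma poisson_symmetric: "poisson (Complex x y) t = poisson (Complex t y) x"
  by (simp add: poisson_eq power2_commute)

lemma nn_integral_poisson: 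
  assumes "y > 0"
  shows "(\<integral>\<^sup>+x. ennreal (poisson (Complex x y) t) \<partial>lborel) = 1"
proof -
  have y: "Im (Complex t y) > 0" using assms by simp
  have "(\<integral>\<^sup>+x. ennreal (poisson (Complex t y) x) \<partial>lborel) = ennreal 1"
    using has_bochner_integral_poisson[OF y] poisson_nonneg[OF y]
    by (subst nn_integral_eq_integral) (auto simp: has_bochner_integral_iff)
  then show ?thesis by (subst poisson_symmetric) simp
qed

text \<open>Fubini's theorem: for fixed t the kernel also has integral 1 in x, as it is symmetric in
  x and t.\<close>

lemma nn_integral_poisson_mean:
  fixes g :: "real \<Rightarrow> real"
  assumes g: "integrable lebesgue g" "\<And>t. g t \<ge> 0" and y: "y > 0"
  shows "(\<integral>\<^sup>+x. \<integral>\<^sup>+t. ennreal (poisson (Complex x y) t * g t) \<partial>lebesgue \<partial>lebesgue) = (\<integral>\<^sup>+t. ennreal (g t) \<partial>lebesgue)"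
proof -
  have "(\<lambda>t. ennreal (g t)) \<in> borel_measurable (completion lborel)"
    using borel_measurable_integrable[OF g(1)] by measurable
  \<comment> \<open>A Borel representative of g, since the integrals are exchanged over
    \<open>lborel\<close> and not over its completion.\<close>
  then obtain h where h [measurable]: "h \<in> borel_measurable lborel" and hg: "AE t in lborel. ennreal (g t) = h t"
    using completion_ex_borel_measurable by blast
  have gh: "(\<integral>\<^sup>+t. ennreal (poisson (Complex x y) t * g t) \<partial>lebesgue) = (\<integral>\<^sup>+t. ennreal (poisson (Complex x y) t) * h t \<partial>lborel)" for x
    unfolding nn_integral_completion
    by (rule nn_integral_cong_AE, rule AE_mp[OF hg]) (use g(2) y in \<open>auto intro!: AE_I2 simp: ennreal_mult poisson_nonneg\<close>)
  have [measurable]: "(\<lambda>(x, t). poisson (Complex x y) t) \<in> borel_measurable (lborel \<Otimes>\<^sub>M lborel)"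
    unfolding poisson_eq complex.sel by measurable
  have "(\<integral>\<^sup>+x. \<integral>\<^sup>+t. ennreal (poisson (Complex x y) t * g t) \<partial>lebesgue \<partial>lebesgue)
     = (\<integral>\<^sup>+x. \<integral>\<^sup>+t. ennreal (poisson (Complex x y) t) * h t \<partial>lborel \<partial>lebesgue)"
    by (simp only: gh)
  also have "\<dots> = (\<integral>\<^sup>+x. \<integral>\<^sup>+t. ennreal (poisson (Complex x y) t) * h t \<partial>lborel \<partial>lborel)"
    by (rule nn_integral_completion)
  also have "\<dots> = (\<integral>\<^sup>+t. \<integral>\<^sup>+x. ennreal (poisson (Complex x y) t) * h t \<partial>lborel \<partial>lborel)"
    by (rule lborel_pair.Fubini'[symmetric]) measurable
  also have "\<dots> = (\<integral>\<^sup>+t. h t \<partial>lborel)"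
  proof (rule nn_integral_cong)
    fix t
    have [measurable]: "(\<lambda>x. poisson (Complex x y) t) \<in> borel_measurable borel"
      unfolding poisson_eq complex.sel by measurable
    show "(\<integral>\<^sup>+x. ennreal (poisson (Complex x y) t) * h t \<partial>lborel) = h t"
      by (subst nn_integral_multc) (auto simp: nn_integral_poisson[OF y])
  qed
  also have "\<dots> = (\<integral>\<^sup>+t. ennreal (g t) \<partial>lebesgue)"
    unfolding nn_integral_completion by (rule nn_integral_cong_AE) (use hg in auto)
  finally show ?thesis .
qed

lemma Lp_integrable_weighted:
  assumes "g \<in> Lp p"
  shows "integrable lebesgue (\<lambda>t. norm (g t) powr p / (1 + t\<^sup>2))"
  by (rule Bochner_Integration.integrable_bound[OF Lp_integrable[OF assms]])
     (use borel_measurable_integrable[OF Lp_integrable[OF assms]] in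
       \<open>auto intro!: AE_I2 simp: divide_le_eq add_pos_nonneg algebra_simps\<close>)

lemma not_AE_lebesgue_False: "\<not> (AE x in (lebesgue :: real measure). False)"
proof
  assume "AE x in (lebesgue :: real measure). False"
  then have "ae_filter (lebesgue :: real measure) = bot" by (simp add: trivial_limit_def)
  then show False by (simp add: ae_filter_eq_bot_iff emeasure_lborel_UNIV)
qed

lemma hardy_funI:
  assumes "F holomorphic_on upper_half_plane"
    and "\<And>y. y > 0 \<Longrightarrow> (\<integral>\<^sup>+x. ennreal (norm (F (Complex x y)) powr p) \<partial>lebesgue) \<le> ennreal C"
  shows "hardy_fun p F"
  unfolding hardy_fun_def
  by (intro conjI assms(1) order_le_less_trans[OF SUP_least[of _ _ "ennreal C"]]) (use assms(2) in auto)

text \<open>Integrating the pointwise bound over a horizontal line gives the integral of |g|^p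
  whatever the height, so the supremum over the heights is finite.\<close>

lemma hardy_fun_of_poisson_bound:
  assumes hol: "F holomorphic_on upper_half_plane" and g: "g \<in> Lp p"
    and b: "\<And>z. Im z > 0 \<Longrightarrow> norm (F z) powr p \<le> (LINT t|lebesgue. poisson z t * norm (g t) powr p)"
  shows "hardy_fun p F"
proof (rule hardy_funI[OF hol])
  fix y :: real assume y: "y > 0"
  note gi = Lp_integrable[OF g]
  note gw = Lp_integrable_weighted[OF g]
  have "(\<integral>\<^sup>+x. ennreal (norm (F (Complex x y)) powr p) \<partial>lebesgue) 
      \<le> (\<integral>\<^sup>+x. \<integral>\<^sup>+t. ennreal (poisson (Complex x y) t * norm (g t) powr p) \<partial>lebesgue \<partial>lebesgue)"
  proof (rule nn_integral_mono)
    fix x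
    have z: "Im (Complex x y) > 0" using y by simp
    have "ennreal (norm (F (Complex x y)) powr p) \<le> ennreal (LINT t|lebesgue. poisson (Complex x y) t * norm (g t) powr p)"
      by (intro ennreal_leI b z)
    also have "\<dots> = (\<integral>\<^sup>+t. ennreal (poisson (Complex x y) t * norm (g t) powr p) \<partial>lebesgue)"
      by (rule nn_integral_eq_integral[symmetric, OF integrable_poisson_mult[OF z gw]]) (simp add: poisson_nonneg z y)
    finally show "ennreal (norm (F (Complex x y)) powr p) \<le> (\<integral>\<^sup>+t. ennreal (poisson (Complex x y) t * norm (g t) powr p) \<partial>lebesgue)" .
  qed
  also have "\<dots> = (\<integral>\<^sup>+t. ennreal (norm (g t) powr p) \<partial>lebesgue)"
    by (rule nn_integral_poisson_mean[OF gi _ y]) simp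
  also have "\<dots> = ennreal (LINT t|lebesgue. norm (g t) powr p)"
    by (rule nn_integral_eq_integral[OF gi]) simp
  finally show "(\<integral>\<^sup>+x. ennreal (norm (F (Complex x y)) powr p) \<partial>lebesgue) \<le> ennreal (LINT t|lebesgue. norm (g t) powr p)" .
qed

lemma boundary_value_mult:
  "boundary_value F f \<Longrightarrow> boundary_value G g \<Longrightarrow> boundary_value (\<lambda>z. F z * G z) (\<lambda>x. f x * g x)"
  unfolding boundary_value_def
  by (elim AE_mp) (auto intro!: AE_I2 tendsto_mult simp: nontangential_limit_def)

lemma boundary_value_add:
  "boundary_value F f \<Longrightarrow> boundary_value G g \<Longrightarrow> boundary_value (\<lambda>z. F z + G z) (\<lambda>x. f x + g x)"
  unfolding boundary_value_def
  by (elim AE_mp) (auto intro!: AE_I2 tendsto_add simp: nontangential_limit_def)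

lemma boundary_value_divide:
  "boundary_value F f \<Longrightarrow> boundary_value G g \<Longrightarrow> AE x in lebesgue. g x \<noteq> 0 \<Longrightarrow>
    boundary_value (\<lambda>z. F z / G z) (\<lambda>x. f x / g x)"
  unfolding boundary_value_def
  by (elim AE_mp) (auto intro!: AE_I2 tendsto_divide simp: nontangential_limit_def)

text \<open>
  The quotient of two outer functions satisfies \<open>ln |E| = P[ln |E|]\<close> exactly, while
  \<open>ln |\<phi>| \<le> P[ln |\<phi>|]\<close>; Jensen's inequality for the Poisson measure then
  bounds \<open>|\<phi> E|\<^sup>p\<close> by the Poisson integral of its boundary values.
\<close>

lemma hardy_plus_mult_outer_quotient:
  assumes p: "p > 1" and \<phi>: "\<phi> \<in> hardy_plus p" and u: "outer_plus p u" and w: "outer_plus p w"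
    and L: "(\<lambda>x. \<phi> x * u x / w x) \<in> Lp p"
  shows "(\<lambda>x. \<phi> x * u x / w x) \<in> hardy_plus p"
proof -
  obtain \<Phi> where \<Phi>: "hardy_fun p \<Phi>" "boundary_value \<Phi> \<phi>" and \<phi>L: "\<phi> \<in> Lp p"
    using \<phi> by (auto simp: hardy_plus_def)
  define lu where "lu = (\<lambda>t. ln (norm (u t)))"
  define lw where "lw = (\<lambda>t. ln (norm (w t)))"
  obtain c where c: "norm c = 1" "boundary_value (\<lambda>z. c * outer_exp lu z) u"
    and u0: "AE t in lebesgue. u t \<noteq> 0" and ui: "integrable lebesgue (\<lambda>t. lu t / (1 + t\<^sup>2))"
    using u unfolding outer_plus_def lu_def by blast
  obtain d where d: "norm d = 1" "boundary_value (\<lambda>z. d * outer_exp lw z) w"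
    and w0: "AE t in lebesgue. w t \<noteq> 0" and wi: "integrable lebesgue (\<lambda>t. lw t / (1 + t\<^sup>2))"
    using w unfolding outer_plus_def lw_def by blast
  define g where "g = (\<lambda>x. \<phi> x * u x / w x)"
  define G where "G = (\<lambda>z. \<Phi> z * (c * outer_exp lu z) / (d * outer_exp lw z))"
  have gL: "g \<in> Lp p" using L by (simp add: g_def)
  note [measurable] = Lp_measurable[OF gL]
  have hol: "G holomorphic_on upper_half_plane"
  proof -
    have "\<Phi> holomorphic_on upper_half_plane" using \<Phi>(1) by (simp add: hardy_fun_def)
    then show ?thesis unfolding G_def
      by (intro holomorphic_intros outer_exp_holomorphic ui wi) (use d(1) in \<open>auto simp: outer_exp_def\<close>)
  qed
  have "hardy_fun p G"
  proof (rule hardy_fun_of_poisson_bound[OF hol gL])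
    fix z assume z: "Im z > 0"
    define A where "A = (LINT t|lebesgue. poisson z t * norm (g t) powr p)"
    have A0: "A \<ge> 0" unfolding A_def using poisson_nonneg[OF z] by (intro integral_nonneg_AE AE_I2) auto
    show "norm (G z) powr p \<le> (LINT t|lebesgue. poisson z t * norm (g t) powr p)"
    proof (cases "\<Phi> z = 0")
      case True
      then show ?thesis using A0 p by (simp add: G_def A_def)
    next
      case False
      note \<phi>0 = hardy_boundary_nonzero[OF p \<Phi> \<phi>L z False]
      note \<phi>i = hardy_log_integrable[OF p \<Phi> \<phi>L z False]
      note \<phi>le = hardy_log_le[OF p \<Phi> \<phi>L z False]
      have ui': "integrable lebesgue (\<lambda>t. poisson z t * lu t)" by (rule integrable_poisson_mult[OF z ui])
      have wi': "integrable lebesgue (\<lambda>t. poisson z t * lw t)" by (rule integrable_poisson_mult[OF z wi])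
      have gi: "integrable lebesgue (\<lambda>t. poisson z t * norm (g t) powr p)"
        by (rule integrable_poisson_mult[OF z Lp_integrable_weighted[OF gL]])
      have g0: "AE t in lebesgue. g t \<noteq> 0" using \<phi>0 u0 w0 by eventually_elim (simp add: g_def)
      \<comment> \<open>A is the normalising constant in Jensen's inequality; A = 0 would force g =
        0 almost everywhere.\<close>
      have A: "A > 0"
      proof (rule ccontr)
        assume "\<not> A > 0"
        with A0 have "A = 0" by simp
        then have "AE t in lebesgue. poisson z t * norm (g t) powr p = 0"
          unfolding A_def by (subst (asm) integral_nonneg_eq_0_iff_AE[OF gi]) (auto simp: poisson_nonneg[OF z])
        with g0 have "AE t in (lebesgue :: real measure). t \<noteq> t"
          by eventually_elim (use poisson_pos[OF z] in \<open>auto simp: less_imp_neq[symmetric]\<close>)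
        then show False using not_AE_lebesgue_False by simp
      qed
      have nG: "norm (G z) = norm (\<Phi> z) * exp (LINT t|lebesgue. poisson z t * lu t) / exp (LINT t|lebesgue. poisson z t * lw t)"
        by (simp add: G_def norm_mult norm_divide c d norm_outer_exp[OF ui z] norm_outer_exp[OF wi z])
      then have "ln (norm (G z)) = ln (norm (\<Phi> z)) + (LINT t|lebesgue. poisson z t * lu t) - (LINT t|lebesgue. poisson z t * lw t)"
        using False by (simp add: ln_mult ln_div)
      also have "\<dots> \<le> (LINT t|lebesgue. poisson z t * ln (norm (\<phi> t))) + (LINT t|lebesgue. poisson z t * lu t) - (LINT t|lebesgue. poisson z t * lw t)"
        using \<phi>le by simp
      also have "\<dots> = (LINT t|lebesgue. poisson z t * ln (norm (\<phi> t)) + poisson z t * lu t - poisson z t * lw t)"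
        using \<phi>i ui' wi' by simp
      finally have "p * ln (norm (G z)) \<le> p * (LINT t|lebesgue. poisson z t * ln (norm (\<phi> t)) + poisson z t * lu t - poisson z t * lw t)"
        using p by (intro mult_left_mono) auto
      also have "\<dots> = (LINT t|lebesgue. p * (poisson z t * ln (norm (\<phi> t)) + poisson z t * lu t - poisson z t * lw t))" by simp
      \<comment> \<open>Jensen's inequality in the form ln s <= s - 1 with s = |g|^p / A: the
        right-hand side integrates to 1 + (ln A - 1).\<close>
      also have "\<dots> \<le> (LINT t|lebesgue. (1 / A) * (poisson z t * norm (g t) powr p) + (ln A - 1) * poisson z t)"
      proof (rule integral_mono_AE)
        show "integrable lebesgue (\<lambda>t. p * (poisson z t * ln (norm (\<phi> t)) + poisson z t * lu t - poisson z t * lw t))"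
          using \<phi>i ui' wi' by simp
        show "integrable lebesgue (\<lambda>t. (1 / A) * (poisson z t * norm (g t) powr p) + (ln A - 1) * poisson z t)"
          using gi integrable_poisson[OF z] by simp
        show "AE t in lebesgue. p * (poisson z t * ln (norm (\<phi> t)) + poisson z t * lu t - poisson z t * lw t)
            \<le> (1 / A) * (poisson z t * norm (g t) powr p) + (ln A - 1) * poisson z t"
          using \<phi>0 u0 w0
        proof eventually_elim
          case (elim t)
          then have lg: "ln (norm (g t)) = ln (norm (\<phi> t)) + lu t - lw t"
            by (simp add: g_def norm_mult norm_divide ln_mult ln_div lu_def lw_def)
          have gp: "norm (g t) powr p > 0" using elim by (simp add: g_def)
          have "p * ln (norm (g t)) = ln (norm (g t) powr p / A) + ln A"
            using A gp elim by (simp add: ln_div ln_powr g_def)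
          also have "\<dots> \<le> norm (g t) powr p / A - 1 + ln A"
            using ln_le_minus_one[of "norm (g t) powr p / A"] A gp by simp
          finally have "poisson z t * (p * ln (norm (g t))) \<le> poisson z t * (norm (g t) powr p / A - 1 + ln A)"
            by (rule mult_left_mono) (simp add: poisson_nonneg[OF z])
          then show ?case unfolding lg by (simp add: algebra_simps)
        qed
      qed
      also have "\<dots> = (1 / A) * A + (ln A - 1)"
        using gi integrable_poisson[OF z] integral_poisson[OF z] by (simp add: A_def)
      also have "\<dots> = ln A" using A by simp
      finally have "ln (norm (G z) powr p) \<le> ln A" 
        using False by (simp add: ln_powr nG)
      moreover have "norm (G z) powr p > 0" using False by (simp add: nG)
      ultimately have "norm (G z) powr p \<le> A" using A by (simp only: ln_le_cancel_iff)
      then show ?thesis by (simp only: A_def)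
    qed
  qed
  moreover have "boundary_value G g"
    unfolding G_def g_def by (intro boundary_value_divide boundary_value_mult \<Phi> c d w0)
  ultimately show ?thesis using gL unfolding hardy_plus_def g_def by blast
qed

section \<open>Algebraic operations on Hardy spaces\<close>


lemma hardy_plusE:
  assumes "f \<in> hardy_plus p"
  obtains F where "hardy_fun p F" "boundary_value F f" "f \<in> Lp p"
  using assms by (auto simp: hardy_plus_def)

lemma hardy_plusI: "hardy_fun p F \<Longrightarrow> boundary_value F f \<Longrightarrow> f \<in> Lp p \<Longrightarrow> f \<in> hardy_plus p"
  by (auto simp: hardy_plus_def)

lemma hardy_plus_measurable: "f \<in> hardy_plus p \<Longrightarrow> f \<in> borel_measurable lebesgue"
  by (simp add: hardy_plus_def Lp_def)

lemma hardy_plus_cong_AE: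
  assumes "f \<in> hardy_plus p" "g \<in> borel_measurable lebesgue" "AE x in lebesgue. g x = f x"
  shows "g \<in> hardy_plus p"
  using assms by (auto elim!: hardy_plusE intro: hardy_plusI Lp_cong_AE boundary_value_cong_AE)

lemma hardy_fun_line_measurable:
  assumes "F holomorphic_on upper_half_plane" "y > 0"
  shows "(\<lambda>x. F (Complex x y)) \<in> borel_measurable lebesgue"
proof -
  have "continuous_on UNIV (\<lambda>x. of_real x + \<i> * of_real y)" by (intro continuous_intros)
  then have "continuous_on UNIV (\<lambda>x. F (of_real x + \<i> * of_real y))"
    by (rule continuous_on_compose2[OF holomorphic_on_imp_continuous_on[OF assms(1)]])
       (use assms(2) in \<open>auto simp: upper_half_plane_def\<close>)
  then show ?thesis unfolding Complex_eq
    by (intro borel_imp_lebesgue_measurable borel_measurable_continuous_onI)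
qed

lemma norm_add_powr_le:
  fixes a b :: "'a::real_normed_vector"
  assumes "p > 0"
  shows "norm (a + b) powr p \<le> 2 powr p * (norm a powr p + norm b powr p)"
proof -
  have "norm (a + b) \<le> 2 * max (norm a) (norm b)"
    using norm_triangle_ineq[of a b] by linarith
  then have "norm (a + b) powr p \<le> (2 * max (norm a) (norm b)) powr p"
    using assms by (intro powr_mono2) auto
  also have "\<dots> = 2 powr p * max (norm a) (norm b) powr p" by (simp add: powr_mult)
  also have "max (norm a) (norm b) powr p \<le> norm a powr p + norm b powr p"
    by (simp add: max_def)
  finally show ?thesis by simp
qed

text \<open>The summand h does not depend on the height. It accounts for a region where G is bounded
  but not comparable with F, such as a neighbourhood of a divided zero.\<close>

lemma hardy_fun_dominated:
  assumes F: "hardy_fun p F" and hol: "G holomorphic_on upper_half_plane"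
    and C: "C \<ge> 0" and h: "integrable lebesgue h" "\<And>x. h x \<ge> 0"
    and b: "\<And>x y. y > 0 \<Longrightarrow> norm (G (Complex x y)) powr p \<le> C * norm (F (Complex x y)) powr p + h x"
  shows "hardy_fun p G"
proof -
  obtain D where D: "D \<ge> 0" "\<And>y. y > 0 \<Longrightarrow> (\<integral>\<^sup>+x. ennreal (norm (F (Complex x y)) powr p) \<partial>lebesgue) \<le> ennreal D"
    using hardy_fun_line_bound[OF F] by blast
  have hI: "(LINT x|lebesgue. h x) \<ge> 0" using h(2) by (intro integral_nonneg_AE AE_I2)
  show ?thesis
  proof (rule hardy_funI[OF hol])
    fix y :: real assume y: "y > 0"
    have Fm [measurable]: "(\<lambda>x. F (Complex x y)) \<in> borel_measurable lebesgue"
      using F y by (intro hardy_fun_line_measurable) (auto simp: hardy_fun_def)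
    have [measurable]: "h \<in> borel_measurable lebesgue" using h by auto
    have "(\<integral>\<^sup>+x. ennreal (norm (G (Complex x y)) powr p) \<partial>lebesgue)
       \<le> (\<integral>\<^sup>+x. ennreal C * ennreal (norm (F (Complex x y)) powr p) + ennreal (h x) \<partial>lebesgue)"
      using b[OF y] C h(2) by (intro nn_integral_mono) (simp add: ennreal_mult[symmetric] ennreal_plus[symmetric] ennreal_leI del: ennreal_plus)
    also have "\<dots> = ennreal C * (\<integral>\<^sup>+x. ennreal (norm (F (Complex x y)) powr p) \<partial>lebesgue) + (\<integral>\<^sup>+x. ennreal (h x) \<partial>lebesgue)"
      by (subst nn_integral_add) (auto simp: nn_integral_cmult)
    also have "\<dots> \<le> ennreal C * ennreal D + ennreal (LINT x|lebesgue. h x)"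
      using D(2)[OF y] h by (intro add_mono mult_left_mono) (auto simp: nn_integral_eq_integral)
    also have "\<dots> = ennreal (C * D + (LINT x|lebesgue. h x))"
      using C D hI by (simp add: ennreal_mult ennreal_plus)
    finally show "(\<integral>\<^sup>+x. ennreal (norm (G (Complex x y)) powr p) \<partial>lebesgue) \<le> ennreal (C * D + (LINT x|lebesgue. h x))" .
  qed
qed

lemma hardy_fun_add:
  assumes p: "p > 0" and F: "hardy_fun p F" and G: "hardy_fun p G"
  shows "hardy_fun p (\<lambda>z. F z + G z)"
proof -
  obtain D where D: "D \<ge> 0" "\<And>y. y > 0 \<Longrightarrow> (\<integral>\<^sup>+x. ennreal (norm (F (Complex x y)) powr p) \<partial>lebesgue) \<le> ennreal D"
    using hardy_fun_line_bound[OF F] by blast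
  obtain E where E: "E \<ge> 0" "\<And>y. y > 0 \<Longrightarrow> (\<integral>\<^sup>+x. ennreal (norm (G (Complex x y)) powr p) \<partial>lebesgue) \<le> ennreal E"
    using hardy_fun_line_bound[OF G] by blast
  have hol: "F holomorphic_on upper_half_plane" "G holomorphic_on upper_half_plane"
    using F G by (auto simp: hardy_fun_def)
  show ?thesis
  proof (rule hardy_funI)
    show "(\<lambda>z. F z + G z) holomorphic_on upper_half_plane" by (intro holomorphic_intros hol)
    fix y :: real assume y: "y > 0"
    note [measurable] = hardy_fun_line_measurable[OF hol(1) y] hardy_fun_line_measurable[OF hol(2) y]
    have "(\<integral>\<^sup>+x. ennreal (norm (F (Complex x y) + G (Complex x y)) powr p) \<partial>lebesgue)
       \<le> (\<integral>\<^sup>+x. ennreal (2 powr p) * (ennreal (norm (F (Complex x y)) powr p) + ennreal (norm (G (Complex x y)) powr p)) \<partial>lebesgue)"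
      using norm_add_powr_le[OF p]
      by (intro nn_integral_mono) (simp add: ennreal_mult[symmetric] ennreal_plus[symmetric] ennreal_leI del: ennreal_plus)
    also have "\<dots> = ennreal (2 powr p) * ((\<integral>\<^sup>+x. ennreal (norm (F (Complex x y)) powr p) \<partial>lebesgue) + (\<integral>\<^sup>+x. ennreal (norm (G (Complex x y)) powr p) \<partial>lebesgue))"
      by (subst nn_integral_cmult) (auto simp: nn_integral_add)
    also have "\<dots> \<le> ennreal (2 powr p) * (ennreal D + ennreal E)"
      using D(2)[OF y] E(2)[OF y] by (intro add_mono mult_left_mono) auto
    also have "\<dots> = ennreal (2 powr p * (D + E))"
      using D E by (simp add: ennreal_mult)
    finally show "(\<integral>\<^sup>+x. ennreal (norm (F (Complex x y) + G (Complex x y)) powr p) \<partial>lebesgue) \<le> ennreal (2 powr p * (D + E))" .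
  qed
qed

lemma Lp_add:
  assumes p: "p > 0" and f: "f \<in> Lp p" and g: "g \<in> Lp p"
  shows "(\<lambda>x. f x + g x) \<in> Lp p"
proof -
  note [measurable] = Lp_measurable[OF f] Lp_measurable[OF g]
  have "integrable lebesgue (\<lambda>x. 2 powr p * (norm (f x) powr p + norm (g x) powr p))"
    using Lp_integrable[OF f] Lp_integrable[OF g] by simp
  then have "integrable lebesgue (\<lambda>x. norm (f x + g x) powr p)"
    by (rule Bochner_Integration.integrable_bound)
       (auto intro!: AE_I2 order_trans[OF norm_add_powr_le[OF p]])
  then show ?thesis by (simp add: Lp_def)
qed

lemma hardy_plus_add:
  assumes p: "p > 0" and f: "f \<in> hardy_plus p" and g: "g \<in> hardy_plus p"
  shows "(\<lambda>x. f x + g x) \<in> hardy_plus p"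
  using f g by (elim hardy_plusE) (blast intro: hardy_plusI hardy_fun_add[OF p] boundary_value_add Lp_add[OF p])

lemma boundary_value_continuous:
  assumes "\<And>x. isCont G (complex_of_real x)"
  shows "boundary_value G (\<lambda>x. G (of_real x))"
  unfolding boundary_value_def nontangential_limit_def
  using assms by (intro AE_I2 allI impI) (auto simp: isCont_def intro: tendsto_within_subset)

lemma real_line_measurable:
  assumes "\<And>x. isCont G (complex_of_real x)"
  shows "(\<lambda>x. G (of_real x)) \<in> borel_measurable lebesgue"
proof -
  have "isCont (\<lambda>x. G (complex_of_real x)) x" for x
    using isCont_o2[of x complex_of_real G] assms by simp
  then have "continuous_on UNIV (\<lambda>x. G (complex_of_real x))"
    by (simp add: continuous_on_eq_continuous_at)
  then show ?thesis by (intro borel_imp_lebesgue_measurable borel_measurable_continuous_onI)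
qed

lemma hardy_fun_mult_bounded:
  assumes p: "p > 0" and F: "hardy_fun p F" and G: "G holomorphic_on upper_half_plane"
    and C: "\<And>z. Im z > 0 \<Longrightarrow> norm (G z) \<le> C"
  shows "hardy_fun p (\<lambda>z. F z * G z)"
proof (rule hardy_fun_dominated[OF F, where C = "C powr p" and h = "\<lambda>x. 0"])
  show "(\<lambda>z. F z * G z) holomorphic_on upper_half_plane"
    using F G by (intro holomorphic_intros) (auto simp: hardy_fun_def)
  have C0: "C \<ge> 0" using order_trans[OF norm_ge_zero C[of \<i>]] by simp
  fix x y :: real assume y: "y > 0"
  have "norm (F (Complex x y) * G (Complex x y)) powr p \<le> (norm (F (Complex x y)) * C) powr p"
    unfolding norm_mult using C[of "Complex x y"] y p by (intro powr_mono2 mult_left_mono) auto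
  then show "norm (F (Complex x y) * G (Complex x y)) powr p \<le> C powr p * norm (F (Complex x y)) powr p + 0"
    using C0 by (simp add: powr_mult mult.commute)
qed auto

lemma hardy_plus_mult_bounded:
  assumes p: "p > 0" and f: "f \<in> hardy_plus p"
    and G: "G holomorphic_on upper_half_plane" "\<And>x. isCont G (complex_of_real x)"
    and C: "\<And>z. Im z \<ge> 0 \<Longrightarrow> norm (G z) \<le> C"
  shows "(\<lambda>x. f x * G (of_real x)) \<in> hardy_plus p"
proof -
  obtain F where F: "hardy_fun p F" "boundary_value F f" "f \<in> Lp p" using hardy_plusE[OF f] .
  have "hardy_fun p (\<lambda>z. F z * G z)" by (rule hardy_fun_mult_bounded[OF p F(1) G(1) C]) simp
  moreover have "boundary_value (\<lambda>z. F z * G z) (\<lambda>x. f x * G (of_real x))"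
    by (intro boundary_value_mult F boundary_value_continuous G)
  moreover have "(\<lambda>x. f x * G (of_real x)) \<in> Lp p"
  proof (rule Lp_bound[OF p F(3)])
    show "(\<lambda>x. f x * G (of_real x)) \<in> borel_measurable lebesgue"
      by (intro borel_measurable_times Lp_measurable[OF F(3)] real_line_measurable G)
    show "AE x in lebesgue. norm (f x * G (of_real x)) \<le> C * norm (f x)"
      using C by (intro AE_I2) (simp add: norm_mult mult.commute[of C] mult_left_mono)
  qed
  ultimately show ?thesis by (rule hardy_plusI)
qed

lemma hardy_plus_scale:
  assumes "p > 0" "f \<in> hardy_plus p"
  shows "(\<lambda>x. c * f x) \<in> hardy_plus p"
  using hardy_plus_mult_bounded[OF assms, of "\<lambda>z. c" "norm c"] by (simp add: mult.commute)

lemma hardy_plus_diff: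
  assumes p: "p > 0" and f: "f \<in> hardy_plus p" and g: "g \<in> hardy_plus p"
  shows "(\<lambda>x. f x - g x) \<in> hardy_plus p"
  using hardy_plus_add[OF p f hardy_plus_scale[OF p g, of "-1"]] by simp

text \<open>Outside a disc around a the quotient is at most |F|/d. Inside the disc it is bounded by
  compactness, which contributes only over the interval from Re a - d to Re a + d, with the same
  bound at every height.\<close>

lemma hardy_plus_divide_zero:
  assumes p: "p > 0" and F: "hardy_fun p F" "boundary_value F f" "f \<in> Lp p"
    and a: "Im a > 0" and Fa: "F a = 0"
  shows "(\<lambda>x. f x / (of_real x - a)) \<in> hardy_plus p"
proof -
  define H where "H = (\<lambda>z. if z = a then deriv F a else (F z - F a) / (z - a))"
  have U: "open upper_half_plane" by (simp add: upper_half_plane_def open_halfspace_Im_gt)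
  have hol: "H holomorphic_on upper_half_plane"
    unfolding H_def by (rule pole_lemma_open) (use F(1) U in \<open>auto simp: hardy_fun_def\<close>)
  define d where "d = Im a / 2"
  have d: "d > 0" using a by (simp add: d_def)
  have sub: "cball a d \<subseteq> upper_half_plane"
  proof
    fix z assume "z \<in> cball a d"
    then have "norm (a - z) \<le> d" by (simp add: dist_norm)
    then have "\<bar>Im a - Im z\<bar> \<le> d" using abs_Im_le_cmod[of "a - z"] by simp
    then have "Im z > 0" using a unfolding d_def by linarith
    then show "z \<in> upper_half_plane" by (simp add: upper_half_plane_def)
  qed
  have "compact (H ` cball a d)"
    by (intro compact_continuous_image continuous_on_subset[OF holomorphic_on_imp_continuous_on[OF hol] sub] compact_cball)
  then obtain M where M: "\<And>z. z \<in> cball a d \<Longrightarrow> norm (H z) \<le> M"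
    using compact_imp_bounded[THEN bounded_iff[THEN iffD1]] by (metis imageI)
  have M0: "M \<ge> 0" using order_trans[OF norm_ge_zero M[of a]] d by simp
  have "hardy_fun p H"
  proof (rule hardy_fun_dominated[OF F(1) hol, where C = "(1/d) powr p" and h = "\<lambda>x. M powr p * indicator {Re a - d..Re a + d} x"])
    show "integrable lebesgue (\<lambda>x. M powr p * indicator {Re a - d..Re a + d} x)"
      by (intro integrable_mult_right integrable_real_indicator) (auto simp: emeasure_lborel_Icc_eq)
    fix x y :: real assume y: "y > 0"
    show "norm (H (Complex x y)) powr p \<le> (1/d) powr p * norm (F (Complex x y)) powr p + M powr p * indicator {Re a - d..Re a + d} x"
    proof (cases "Complex x y \<in> cball a d")
      case True
      then have "norm (a - Complex x y) \<le> d" by (simp add: dist_norm)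
      then have "\<bar>Re a - x\<bar> \<le> d" using abs_Re_le_cmod[of "a - Complex x y"] by simp
      then have "x \<in> {Re a - d..Re a + d}" by auto
      moreover have "norm (H (Complex x y)) powr p \<le> M powr p" using M[OF True] p by (intro powr_mono2) auto
      ultimately show ?thesis by (simp add: add_increasing)
    next
      case False
      then have n: "norm (Complex x y - a) > d" by (simp add: dist_norm norm_minus_commute)
      then have "Complex x y \<noteq> a" using d by auto
      then have "norm (H (Complex x y)) = norm (F (Complex x y)) / norm (Complex x y - a)"
        using Fa by (simp add: H_def norm_divide)
      also have "\<dots> \<le> norm (F (Complex x y)) / d" using n d by (intro divide_left_mono mult_pos_pos) auto
      finally have "norm (H (Complex x y)) powr p \<le> ((1/d) * norm (F (Complex x y))) powr p"
        using p by (intro powr_mono2) auto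
      also have "\<dots> = (1/d) powr p * norm (F (Complex x y)) powr p" by (simp only: powr_mult)
      finally show ?thesis by (simp add: add_increasing2)
    qed
  qed auto
  moreover have "boundary_value H (\<lambda>x. f x / (of_real x - a))"
  proof -
    have "boundary_value (\<lambda>z. F z * (1 / (z - a))) (\<lambda>x. f x * (1 / (of_real x - a)))"
      using of_real_neq_Im_pos[OF a]
      by (intro boundary_value_mult F boundary_value_continuous continuous_intros) auto
    \<comment> \<open>H agrees with F/(z - a) except at a, which is away from the real line.\<close>
    moreover have "nontangential_limit H x l" if "nontangential_limit (\<lambda>z. F z * (1 / (z - a))) x l" for x l
      unfolding nontangential_limit_def
    proof (intro allI impI)
      fix k :: real assume k: "k > 0"
      have "((\<lambda>z. F z * (1 / (z - a))) \<longlongrightarrow> l) (at (complex_of_real x) within {z. 0 < Im z \<and> \<bar>Re z - x\<bar> < k * Im z})"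
        using that k by (simp add: nontangential_limit_def)
      then show "(H \<longlongrightarrow> l) (at (complex_of_real x) within {z. 0 < Im z \<and> \<bar>Re z - x\<bar> < k * Im z})"
      proof (rule Lim_transform_eventually)
        have "\<forall>\<^sub>F z in at (complex_of_real x) within {z. 0 < Im z \<and> \<bar>Re z - x\<bar> < k * Im z}. z \<noteq> a"
          using of_real_neq_Im_pos[OF a, of x] by (intro eventually_neq_at_within)
        then show "\<forall>\<^sub>F z in at (complex_of_real x) within {z. 0 < Im z \<and> \<bar>Re z - x\<bar> < k * Im z}. F z * (1 / (z - a)) = H z"
          by eventually_elim (simp add: H_def Fa)
      qed
    qed
    ultimately have "boundary_value H (\<lambda>x. f x * (1 / (of_real x - a)))"
      unfolding boundary_value_def by (elim AE_mp) (auto intro!: AE_I2)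
    then show ?thesis by simp
  qed
  moreover have "(\<lambda>x. f x / (of_real x - a)) \<in> Lp p"
  proof (rule Lp_bound[OF p F(3)])
    show "(\<lambda>x. f x / (of_real x - a)) \<in> borel_measurable lebesgue"
      using Lp_measurable[OF F(3)] by measurable
    show "AE x in lebesgue. norm (f x / (of_real x - a)) \<le> (1 / Im a) * norm (f x)"
    proof (rule AE_I2)
      fix x
      have "norm (f x / (of_real x - a)) \<le> norm (f x) / Im a"
        unfolding norm_divide using Im_le_norm_diff[OF a, of x] of_real_neq_Im_pos[OF a, of x] a
        by (intro divide_left_mono mult_pos_pos) auto
      then show "norm (f x / (of_real x - a)) \<le> (1 / Im a) * norm (f x)" by simp
    qed
  qed
  ultimately show ?thesis by (rule hardy_plusI)
qed

text \<open>The open mapping theorem: a nonempty open set is not contained in the real axis.\<close>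

lemma real_valued_holomorphic_constant:
  assumes h: "h holomorphic_on upper_half_plane" and r: "\<And>z. z \<in> upper_half_plane \<Longrightarrow> Im (h z) = 0"
  shows "h constant_on upper_half_plane"
proof (rule ccontr)
  assume nc: "\<not> h constant_on upper_half_plane"
  have U: "open upper_half_plane" "connected upper_half_plane"
    by (auto simp: upper_half_plane_def open_halfspace_Im_gt convex_halfspace_Im_gt convex_connected)
  have op: "open (h ` upper_half_plane)"
    by (rule open_mapping_thm[OF h U U(1) order_refl nc])
  have "h \<i> \<in> h ` upper_half_plane" by (simp add: upper_half_plane_def)
  then obtain e where e: "e > 0" "ball (h \<i>) e \<subseteq> h ` upper_half_plane"
    using op open_contains_ball by blast
  have "h \<i> + \<i> * of_real (e / 2) \<in> ball (h \<i>) e" using e(1) by (simp add: dist_norm norm_mult)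
  then obtain z where "z \<in> upper_half_plane" "h z = h \<i> + \<i> * of_real (e / 2)" using e(2) by (metis imageE subsetD)
  then have "Im (h \<i> + \<i> * of_real (e / 2)) = 0" using r by metis
  then show False using r[of \<i>] e(1) by (simp add: upper_half_plane_def)
qed

text \<open>\<open>hardy_plus p\<close> and \<open>hardy_minus p\<close> meet only in zero. The
  extensions S and T are Poisson integrals of conjugate functions, hence T is the conjugate of S;
  then S + T and i (S - T) are real-valued and holomorphic, so S is constant, and a constant in L_p
  of the line is 0.\<close>

lemma hardy_plus_cnj_zero:
  assumes p: "p > 1" and s: "s \<in> hardy_plus p" and t: "(\<lambda>x. cnj (s x)) \<in> hardy_plus p"
  shows "AE x in lebesgue. s x = 0"
proof -
  obtain S where S: "hardy_fun p S" "boundary_value S s" "s \<in> Lp p" using hardy_plusE[OF s] .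
  obtain T where T: "hardy_fun p T" "boundary_value T (\<lambda>x. cnj (s x))" "(\<lambda>x. cnj (s x)) \<in> Lp p" using hardy_plusE[OF t] .
  have hol: "S holomorphic_on upper_half_plane" "T holomorphic_on upper_half_plane"
    using S T by (auto simp: hardy_fun_def)
  have TS: "T z = cnj (S z)" if "z \<in> upper_half_plane" for z
  proof -
    have z: "Im z > 0" using that by (simp add: upper_half_plane_def)
    have "T z = (LINT t|lebesgue. poisson z t *\<^sub>R cnj (s t))" by (rule hardy_poisson[OF p T z])
    also have "\<dots> = (LINT t|lebesgue. cnj (poisson z t *\<^sub>R s t))"
      by (rule Bochner_Integration.integral_cong) (simp_all add: complex_eq_iff)
    also have "\<dots> = cnj (S z)" unfolding hardy_poisson[OF p S z] by (rule Bochner_Integration.integral_cnj)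
    finally show ?thesis .
  qed
  have "(\<lambda>z. S z + T z) constant_on upper_half_plane" 
    by (rule real_valued_holomorphic_constant) (auto intro!: holomorphic_intros hol simp: TS)
  then obtain c where c: "\<And>z. z \<in> upper_half_plane \<Longrightarrow> S z + T z = c" unfolding constant_on_def by auto
  have "(\<lambda>z. \<i> * (S z - T z)) constant_on upper_half_plane"
    by (rule real_valued_holomorphic_constant) (auto intro!: holomorphic_intros hol simp: TS)
  then obtain d where d: "\<And>z. z \<in> upper_half_plane \<Longrightarrow> \<i> * (S z - T z) = d" unfolding constant_on_def by auto
  define k where "k = (c - \<i> * d) / 2"
  have k: "S z = k" if "Im z > 0" for z
  proof -
    have cd: "S z + T z = c" "\<i> * (S z - T z) = d" using c d that by (auto simp: upper_half_plane_def)
    have "- \<i> * d = S z - T z" unfolding cd(2)[symmetric] by (simp add: algebra_simps)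
    then show ?thesis unfolding k_def cd(1)[symmetric] by simp
  qed
  have sk: "AE x in lebesgue. s x = k"
    using S(2) unfolding boundary_value_def
  proof (rule AE_mp, intro AE_I2 impI)
    fix x assume "nontangential_limit S x (s x)"
    from nontangential_limit_vertical[OF this] have "(\<lambda>n. k) \<longlonglongrightarrow> s x" by (simp add: k)
    then show "s x = k" by (simp add: LIMSEQ_const_iff)
  qed
  then have "integrable lebesgue (\<lambda>x::real. norm k powr p)"
    using Lp_integrable[OF S(3)] 
    by (subst (asm) integrable_cong_AE[where g="\<lambda>x. norm k powr p"])
       (use borel_measurable_integrable[OF Lp_integrable[OF S(3)]] in \<open>auto elim: AE_mp\<close>)
  then have "(\<integral>\<^sup>+x. ennreal (norm k powr p) \<partial>(lborel :: real measure)) < \<infinity>"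
    unfolding integrable_iff_bounded nn_integral_completion by simp
  then have "k = 0"
    by (auto simp: emeasure_lborel_UNIV ennreal_mult_top split: if_splits)
  with sk show ?thesis by simp
qed

section \<open>Real multipliers and zeros\<close>


text \<open>In the notation of the overview, \<open>zpoly as\<close> is A and
  \<open>zpoly (map cnj as)\<close> is A#.\<close>

definition zpoly :: "complex list \<Rightarrow> complex poly" where
  "zpoly as = (\<Prod>a\<leftarrow>as. [:- a, 1:])"

lemma zpoly_Nil [simp]: "zpoly [] = 1"
  by (simp add: zpoly_def)

lemma zpoly_Cons [simp]: "zpoly (a # as) = [:- a, 1:] * zpoly as"
  by (simp add: zpoly_def)

lemma zpoly_monic: "degree (zpoly as) = length as \<and> coeff (zpoly as) (length as) = 1"
proof (induction as)
  case (Cons a as)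
  then have nz: "zpoly as \<noteq> 0" by auto
  then have d: "degree (zpoly (a # as)) = length (a # as)" 
    using Cons unfolding zpoly_Cons by (subst degree_mult_eq) auto
  have "lead_coeff (zpoly (a # as)) = 1"
    using Cons unfolding zpoly_Cons lead_coeff_mult by simp
  with d show ?case by simp
qed simp

lemma poly_zpoly_cnj_nonzero:
  assumes "\<forall>a\<in>set as. Im a > 0" "Im z \<ge> 0"
  shows "poly (zpoly (map cnj as)) z \<noteq> 0"
  using assms
proof (induction as)
  case (Cons a as)
  then have "z - cnj a \<noteq> 0" "poly (zpoly (map cnj as)) z \<noteq> 0" by (auto simp: complex_eq_iff)
  moreover have "poly (zpoly (map cnj (a # as))) z = (z - cnj a) * poly (zpoly (map cnj as)) z"
    by (simp add: algebra_simps)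
  ultimately show ?case by simp
qed simp

lemma cnj_poly_zpoly: "cnj (poly (zpoly as) (of_real x)) = poly (zpoly (map cnj as)) (of_real x)"
  by (induction as) auto

text \<open>Division of q by z - cnj a with remainder: the quotient and the constant 1 both fall
  under the induction hypothesis, and 1/|z - cnj a| <= 1/Im a in the closed half-plane.\<close>

lemma poly_over_zpoly_bounded:
  assumes "\<forall>a\<in>set as. Im a > 0" "degree q \<le> length as"
  shows "\<exists>C. \<forall>z. Im z \<ge> 0 \<longrightarrow> norm (poly q z / poly (zpoly (map cnj as)) z) \<le> C"
  using assms
proof (induction as arbitrary: q)
  case Nil
  then obtain k where "q = [:k:]" by (auto elim: degree_eq_zeroE)
  then show ?case by auto
next
  case (Cons a as)
  define q1 where "q1 = synthetic_div q (cnj a)"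
  have "degree q1 \<le> length as" using Cons.prems(2) by (simp add: q1_def degree_synthetic_div)
  then obtain C1 where C1: "\<And>z. Im z \<ge> 0 \<Longrightarrow> norm (poly q1 z / poly (zpoly (map cnj as)) z) \<le> C1"
    using Cons.IH[of q1] Cons.prems(1) by (metis list.set_intros(2))
  obtain C2 where C2: "\<And>z. Im z \<ge> 0 \<Longrightarrow> norm (poly 1 z / poly (zpoly (map cnj as)) z) \<le> C2"
    using Cons.IH[of 1] Cons.prems by auto
  have a: "Im a > 0" using Cons.prems by simp
  show ?case
  proof (intro exI[of _ "C1 + norm (poly q (cnj a)) / Im a * C2"] allI impI)
    fix z assume z: "Im z \<ge> 0"
    have n: "norm (z - cnj a) \<ge> Im a" using abs_Im_le_cmod[of "z - cnj a"] z a by simp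
    then have nz: "z - cnj a \<noteq> 0" using a by auto
    have "poly q z = (z - cnj a) * poly q1 z + poly q (cnj a)"
      using arg_cong[OF synthetic_div_correct'[of "cnj a" q], of "\<lambda>p. poly p z"] by (simp add: q1_def algebra_simps)
    moreover have "poly (zpoly (map cnj (a # as))) z = (z - cnj a) * poly (zpoly (map cnj as)) z"
      by (simp add: algebra_simps)
    ultimately have "poly q z / poly (zpoly (map cnj (a # as))) z = poly q1 z / poly (zpoly (map cnj as)) z 
        + poly q (cnj a) / (z - cnj a) * (poly 1 z / poly (zpoly (map cnj as)) z)"
      using nz poly_zpoly_cnj_nonzero[of as z] Cons.prems(1) z
      by (simp only: add_divide_distrib) simp
    also have "norm \<dots> \<le> C1 + norm (poly q (cnj a)) / Im a * C2"
    proof (rule norm_triangle_mono[OF C1[OF z]])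
      have "norm (poly q (cnj a) / (z - cnj a)) \<le> norm (poly q (cnj a)) / Im a"
        unfolding norm_divide using n a nz by (intro divide_left_mono mult_pos_pos) auto
      then show "norm (poly q (cnj a) / (z - cnj a) * (poly 1 z / poly (zpoly (map cnj as)) z)) \<le> norm (poly q (cnj a)) / Im a * C2"
        unfolding norm_mult using C2[OF z] a by (intro mult_mono) auto
    qed
    finally show "norm (poly q z / poly (zpoly (map cnj (a # as))) z) \<le> C1 + norm (poly q (cnj a)) / Im a * C2" .
  qed
qed

lemma rational_holomorphic:
  assumes "\<forall>a\<in>set as. Im a > 0"
  shows "(\<lambda>z. poly q z / poly (zpoly (map cnj as)) z) holomorphic_on upper_half_plane"
    "isCont (\<lambda>z. poly q z / poly (zpoly (map cnj as)) z) (of_real x)"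
  using poly_zpoly_cnj_nonzero[OF assms]
  by (auto intro!: holomorphic_intros continuous_intros simp: upper_half_plane_def)

lemma hardy_plus_mult_rational:
  assumes p: "p > 0" and f: "f \<in> hardy_plus p" and as: "\<forall>a\<in>set as. Im a > 0" "degree q \<le> length as"
  shows "(\<lambda>x. f x * (poly q (of_real x) / poly (zpoly (map cnj as)) (of_real x))) \<in> hardy_plus p"
proof -
  obtain C where "\<And>z. Im z \<ge> 0 \<Longrightarrow> norm (poly q z / poly (zpoly (map cnj as)) z) \<le> C"
    using poly_over_zpoly_bounded[OF as] by blast
  then show ?thesis by (intro hardy_plus_mult_bounded[OF p f] rational_holomorphic as)
qed

lemma AE_neq_real: "AE x in lebesgue. x \<noteq> (k::real)"
  by (rule AE_completion) (simp add: AE_lborel_singleton)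

lemma not_AE_eq_real: "\<not> (AE x in lebesgue. x = (k::real))"
proof
  assume "AE x in lebesgue. x = k"
  with AE_neq_real[of k] have "AE x in (lebesgue :: real measure). x \<noteq> x"
    by eventually_elim simp
  then show False using not_AE_lebesgue_False by simp
qed

text \<open>The common ground of the two kernels to be computed: \<open>\<omega>\<close> is the
  conjugate of the square rigid function in one case and 1/(x + i) in the other. The nonvanishing
  extension \<open>\<Omega>\<close> makes it possible to prescribe values at the zeros a.\<close>

locale real_multiplier_const =
  fixes p :: real and \<omega> :: "real \<Rightarrow> complex" and \<Omega> :: "complex \<Rightarrow> complex"
  assumes p: "p > 1"
    and \<Omega>: "hardy_fun p \<Omega>" "boundary_value \<Omega> \<omega>" "\<omega> \<in> Lp p" "\<And>z. Im z > 0 \<Longrightarrow> \<Omega> z \<noteq> 0"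
    and const: "\<And>u::real \<Rightarrow> real. u \<in> borel_measurable lebesgue \<Longrightarrow> (\<lambda>x. of_real (u x) * \<omega> x) \<in> hardy_plus p
      \<Longrightarrow> \<exists>k. AE x in lebesgue. u x = k"
    and nonzero: "AE x in lebesgue. \<omega> x \<noteq> 0"
begin

lemma p0: "p > 0" using p by simp

lemma omega_hardy: "\<omega> \<in> hardy_plus p" using \<Omega> by (intro hardy_plusI)

lemma omega_measurable [measurable]: "\<omega> \<in> borel_measurable lebesgue" using \<Omega>(3) by (rule Lp_measurable)

text \<open>The induction generalises over u because each step replaces u by another real multiplier
  v; reality is what leads back to the assumption \<open>const\<close> when no zero is left.\<close>

lemma real_quotient_poly:
  fixes u :: "real \<Rightarrow> real"
  assumes "\<forall>a\<in>set as. Im a > 0" "u \<in> borel_measurable lebesgue"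
    and "(\<lambda>x. of_real (u x) * \<omega> x / poly (zpoly (map cnj as)) (of_real x)) \<in> hardy_plus p"
  shows "\<exists>q::complex poly. degree q \<le> length as \<and> (AE x in lebesgue. of_real (u x) = poly q (of_real x))"
  using assms
proof (induction as arbitrary: u)
  case Nil
  then obtain k where k: "AE x in lebesgue. u x = k" using const[of u] by auto
  then show ?case by (intro exI[of _ "[:of_real k:]"]) (auto elim: AE_mp)
next
  case (Cons a as)
  note um [measurable] = Cons.prems(2)
  have a: "Im a > 0" and as: "\<forall>a\<in>set as. Im a > 0" using Cons.prems(1) by auto
  define Z where "Z = poly (zpoly (map cnj as))"
  define Z1 where "Z1 = poly (zpoly (map cnj (a # as)))"
  have Z1: "Z1 z = (z - cnj a) * Z z" for z by (simp add: Z1_def Z_def algebra_simps)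
  have Znz: "Z z \<noteq> 0" "Z1 z \<noteq> 0" if "Im z \<ge> 0" for z
    using poly_zpoly_cnj_nonzero[OF as that] poly_zpoly_cnj_nonzero[OF Cons.prems(1) that] by (auto simp: Z_def Z1_def)
  define f where "f = (\<lambda>x. of_real (u x) * \<omega> x / Z1 (of_real x))"
  have "f \<in> hardy_plus p" using Cons.prems(3) by (simp add: f_def Z1_def)
  then obtain F where F: "hardy_fun p F" "boundary_value F f" "f \<in> Lp p" by (rule hardy_plusE)
  \<comment> \<open>F Z1 / \<open>\<Omega>\<close> extends u to the half-plane, and w is its value
    at a. As Im a > 0, the two real numbers \<open>\<alpha>\<close> and \<open>\<beta>\<close> can
    be chosen with \<open>\<alpha>\<close> + \<open>\<beta>\<close> a = w.\<close>
  define w where "w = F a * Z1 a / \<Omega> a"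
  define \<beta> where "\<beta> = Im w / Im a"
  define \<alpha> where "\<alpha> = Re w - \<beta> * Re a"
  have w: "of_real \<alpha> + of_real \<beta> * a = w" using a by (simp add: complex_eq_iff \<alpha>_def \<beta>_def)
  define q0 where "q0 = [:complex_of_real \<alpha>, of_real \<beta>:]"
  have q0: "degree q0 \<le> length (a # as)" by (simp add: q0_def)
  define l where "l = (\<lambda>x. \<omega> x * (poly q0 (of_real x) / Z1 (of_real x)))"
  define L where "L = (\<lambda>z. \<Omega> z * (poly q0 z / Z1 z))"
  note rh = rational_holomorphic[OF Cons.prems(1), where q = q0, folded Z1_def]
  obtain C where C: "\<And>z. Im z \<ge> 0 \<Longrightarrow> norm (poly q0 z / Z1 z) \<le> C"
    using poly_over_zpoly_bounded[OF Cons.prems(1) q0] unfolding Z1_def by blast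
  have L: "hardy_fun p L" unfolding L_def
    by (rule hardy_fun_mult_bounded[OF p0 \<Omega>(1) rh(1) C]) simp
  have Ll: "boundary_value L l" unfolding L_def l_def
    by (intro boundary_value_mult \<Omega> boundary_value_continuous rh(2))
  have lp: "l \<in> hardy_plus p" unfolding l_def Z1_def
    by (rule hardy_plus_mult_rational[OF p0 omega_hardy Cons.prems(1) q0])
  then have lL: "l \<in> Lp p" by (simp add: hardy_plus_def)
  have La: "F a + - L a = 0"
  proof -
    have "poly q0 a = w" using w by (simp add: q0_def mult.commute)
    then show ?thesis using \<Omega>(4)[OF a] Znz(2)[of a] a by (simp add: L_def w_def)
  qed
  have m1: "hardy_fun p (\<lambda>z. - L z)"
    using hardy_fun_mult_bounded[OF p0 L, of "\<lambda>z. -1" 1] by simp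
  have m2: "boundary_value (\<lambda>z. - L z) (\<lambda>x. - l x)"
    using boundary_value_mult[OF boundary_value_continuous[of "\<lambda>z. -1"] Ll] by simp
  have m3: "(\<lambda>x. - l x) \<in> Lp p" using lL by (simp add: Lp_def)
  have d: "(\<lambda>x. (f x + - l x) / (of_real x - a)) \<in> hardy_plus p"
    by (rule hardy_plus_divide_zero[OF p0 hardy_fun_add[OF p0 F(1) m1] boundary_value_add[OF F(2) m2] Lp_add[OF p0 F(3) m3] a La])
  \<comment> \<open>D x = |x - a|^2: the factor x - cnj a comes from Z1, the factor x - a from
    dividing out the zero.\<close>
  define D where "D = (\<lambda>x. (x - Re a)\<^sup>2 + (Im a)\<^sup>2)"
  have D: "D x > 0" for x using a by (simp add: D_def add_nonneg_pos)
  have Dc: "(of_real x - cnj a) * (of_real x - a) = of_real (D x)" for x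
    by (simp add: D_def complex_eq_iff power2_eq_square algebra_simps)
  define v where "v = (\<lambda>x. (u x - (\<alpha> + \<beta> * x)) / D x)"
  have vm: "v \<in> borel_measurable lebesgue" unfolding v_def D_def by measurable
  have "(f x + - l x) / (of_real x - a) = of_real (v x) * \<omega> x / Z (of_real x)" for x
  proof -
    have n: "of_real x - a \<noteq> 0" "of_real x - cnj a \<noteq> 0" "Z (of_real x) \<noteq> 0"
      using of_real_neq_Im_pos[OF a, of x] Znz(1)[of "of_real x"] a by (auto simp: complex_eq_iff)
    have "f x + - l x = of_real (u x - (\<alpha> + \<beta> * x)) * \<omega> x / ((of_real x - cnj a) * Z (of_real x))"
    proof -
      have *: "U * W / m + - (W * (Q / m)) = (U - Q) * W / m" for U W Q m :: complex
        by (simp add: left_diff_distrib right_diff_distrib diff_divide_distrib mult.commute)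
      have "poly q0 (of_real x) = of_real (\<alpha> + \<beta> * x)" by (simp add: q0_def mult.commute)
      then show ?thesis unfolding f_def l_def Z1 * by simp
    qed
    then have "(f x + - l x) / (of_real x - a) = of_real (u x - (\<alpha> + \<beta> * x)) * \<omega> x / (((of_real x - cnj a) * (of_real x - a)) * Z (of_real x))"
      by (simp add: mult_ac)
    then show ?thesis unfolding Dc v_def by simp
  qed
  with d have "(\<lambda>x. of_real (v x) * \<omega> x / poly (zpoly (map cnj as)) (of_real x)) \<in> hardy_plus p"
    by (simp add: Z_def)
  from Cons.IH[OF as vm this] obtain q1 :: "complex poly" where q1: "degree q1 \<le> length as" "AE x in lebesgue. of_real (v x) = poly q1 (of_real x)" by blast
  \<comment> \<open>Read off from u = \<open>\<alpha>\<close> + \<open>\<beta>\<close> x + |x - a|^2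
    v.\<close>
  define q where "q = q0 + [:- cnj a, 1:] * ([:- a, 1:] * q1)"
  have uq: "AE x in lebesgue. of_real (u x) = poly q (of_real x)"
    using q1(2)
  proof eventually_elim
    case (elim x)
    have "u x = \<alpha> + \<beta> * x + D x * v x" using D[of x] by (simp add: v_def)
    then have "of_real (u x) = of_real \<alpha> + of_real \<beta> * of_real x + of_real (D x) * complex_of_real (v x)" by simp
    also have "\<dots> = poly q (of_real x)" unfolding elim Dc[symmetric] by (simp add: q_def q0_def algebra_simps)
    finally show ?case .
  qed
  define n where "n = length (a # as)"
  \<comment> \<open>The quotient has degree at most n - 1 and is multiplied by two linear factors,
    so the bound is one above the claim.\<close>
  have dq: "degree q \<le> Suc n"
  proof -
    have "degree ([:- cnj a, 1:] * ([:- a, 1:] * q1)) \<le> 1 + (1 + degree q1)"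
      by (intro order_trans[OF degree_mult_le] add_mono) auto
    then show ?thesis unfolding q_def n_def using q1(1) q0 by (intro degree_add_le) auto
  qed
  \<comment> \<open>x Z1 is monic of degree n + 1, so subtracting its multiple by the top
    coefficient brings q down to degree n.\<close>
  define \<kappa> where "\<kappa> = coeff q (Suc n)"
  define q' where "q' = q - smult \<kappa> (pCons 0 (zpoly (map cnj (a # as))))"
  have zm: "degree (zpoly (map cnj (a # as))) = n" "coeff (zpoly (map cnj (a # as))) n = 1"
    using zpoly_monic[of "map cnj (a # as)"] by (auto simp: n_def)
  have dq': "degree q' \<le> n"
  proof (rule degree_le, intro allI impI)
    fix i assume i: "n < i"
    show "coeff q' i = 0"
    proof (cases "i = Suc n")
      case True
      then show ?thesis by (simp add: q'_def \<kappa>_def zm del: zpoly_Cons list.map)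
    next
      case False
      then have "i > Suc n" using i by simp
      then have "coeff q i = 0" "coeff (zpoly (map cnj (a # as))) (i - 1) = 0"
        using dq zm(1) by (auto intro!: coeff_eq_0 simp del: zpoly_Cons list.map)
      then show ?thesis using \<open>i > Suc n\<close> by (cases i) (simp_all add: q'_def del: zpoly_Cons list.map)
    qed
  qed
  \<comment> \<open>Otherwise f = \<open>\<omega>\<close> q / Z1 could be solved for x
    \<open>\<omega>\<close> inside H_p^+, and the real multiplier x would have to be
    constant.\<close>
  have "\<kappa> = 0"
  proof (rule ccontr)
    assume k: "\<kappa> \<noteq> 0"
    have l': "(\<lambda>x. \<omega> x * (poly q' (of_real x) / Z1 (of_real x))) \<in> hardy_plus p"
      unfolding Z1_def by (rule hardy_plus_mult_rational[OF p0 omega_hardy Cons.prems(1)]) (use dq' n_def in simp)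
    have "(\<lambda>x. (1 / \<kappa>) * (f x - \<omega> x * (poly q' (of_real x) / Z1 (of_real x)))) \<in> hardy_plus p"
      by (intro hardy_plus_scale hardy_plus_diff p0 \<open>f \<in> hardy_plus p\<close> l')
    then have "(\<lambda>x. of_real x * \<omega> x) \<in> hardy_plus p"
    proof (rule hardy_plus_cong_AE)
      show "(\<lambda>x. of_real x * \<omega> x) \<in> borel_measurable lebesgue" by measurable
      show "AE x in lebesgue. of_real x * \<omega> x = (1 / \<kappa>) * (f x - \<omega> x * (poly q' (of_real x) / Z1 (of_real x)))"
        using uq
      proof eventually_elim
        case (elim x)
        have z: "Z1 (of_real x) \<noteq> 0" by (rule Znz) simp
        have "poly q (of_real x) = poly q' (of_real x) + \<kappa> * (of_real x * Z1 (of_real x))"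
          by (simp add: q'_def Z1_def)
        then show ?case unfolding f_def elim using z k by (simp add: field_simps)
      qed
    qed
    then show False using const[of "\<lambda>x. x"] not_AE_eq_real by auto
  qed
  then have "q' = q" by (simp add: q'_def)
  with dq' uq show ?case by (auto simp: n_def)
qed

lemma quotient_poly:
  assumes as: "\<forall>a\<in>set as. Im a > 0" and tm [measurable]: "t \<in> borel_measurable lebesgue"
    and t: "(\<lambda>x. t x * \<omega> x / poly (zpoly (map cnj as)) (of_real x)) \<in> hardy_plus p"
    and ct: "(\<lambda>x. cnj (t x) * \<omega> x / poly (zpoly (map cnj as)) (of_real x)) \<in> hardy_plus p"
  shows "\<exists>q. degree q \<le> length as \<and> (AE x in lebesgue. t x = poly q (of_real x))"
proof -
  have re: "complex_of_real (Re (t x)) = (1 / 2) * t x + (1 / 2) * cnj (t x)" for x by (simp add: complex_eq_iff)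
  have im: "complex_of_real (Im (t x)) = (1 / (2 * \<i>)) * t x - (1 / (2 * \<i>)) * cnj (t x)" for x
    by (simp add: complex_eq_iff)
  have "(\<lambda>x. of_real (Re (t x)) * \<omega> x / poly (zpoly (map cnj as)) (of_real x)) \<in> hardy_plus p"
    using hardy_plus_add[OF p0 hardy_plus_scale[OF p0 t, of "1/2"] hardy_plus_scale[OF p0 ct, of "1/2"]]
    by (simp add: re algebra_simps add_divide_distrib)
  from real_quotient_poly[OF as _ this] obtain q1 :: "complex poly" where q1: "degree q1 \<le> length as" "AE x in lebesgue. of_real (Re (t x)) = poly q1 (of_real x)"
    by auto
  have "(\<lambda>x. of_real (Im (t x)) * \<omega> x / poly (zpoly (map cnj as)) (of_real x)) \<in> hardy_plus p"
    using hardy_plus_diff[OF p0 hardy_plus_scale[OF p0 t, of "1/(2*\<i>)"] hardy_plus_scale[OF p0 ct, of "1/(2*\<i>)"]]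
    by (simp add: im algebra_simps diff_divide_distrib)
  from real_quotient_poly[OF as _ this] obtain q2 :: "complex poly" where q2: "degree q2 \<le> length as" "AE x in lebesgue. of_real (Im (t x)) = poly q2 (of_real x)"
    by auto
  have "AE x in lebesgue. t x = poly (q1 + smult \<i> q2) (of_real x)"
    using q1(2) q2(2)
  proof eventually_elim
    case (elim x)
    then show ?case by (simp add: elim[symmetric] complex_eq_iff)
  qed
  moreover have "degree (q1 + smult \<i> q2) \<le> length as" using q1 q2 by (intro degree_add_le) auto
  ultimately show ?thesis by blast
qed

end

section \<open>Square rigid functions and the Cauchy kernel\<close>


text \<open>|z^2|^(p/2) = |z|^p, so the bounds for F carry over unchanged to its square. The
  exponent p/2 may lie below 1; sums in \<open>hardy_plus (p / 2)\<close> remain available because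
  \<open>hardy_plus_add\<close> asks only for a positive exponent.\<close>

lemma hardy_plus_square:
  assumes p: "p > 0" and f: "f \<in> hardy_plus p"
  shows "(\<lambda>x. (f x)\<^sup>2) \<in> hardy_plus (p / 2)"
proof -
  have pw: "norm (z\<^sup>2) powr (p / 2) = norm z powr p" for z :: complex
  proof (cases "z = 0")
    case False
    then show ?thesis using powr_powr[of "norm z" 2 "p / 2"] by (simp add: norm_power)
  qed (use p in simp)
  obtain F where F: "hardy_fun p F" "boundary_value F f" "f \<in> Lp p" using hardy_plusE[OF f] .
  have "hardy_fun (p / 2) (\<lambda>z. (F z)\<^sup>2)"
    using F(1) unfolding hardy_fun_def pw by (auto intro: holomorphic_intros)
  moreover have "boundary_value (\<lambda>z. (F z)\<^sup>2) (\<lambda>x. (f x)\<^sup>2)"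
    using boundary_value_mult[OF F(2) F(2)] by (simp add: power2_eq_square)
  moreover have "(\<lambda>x. (f x)\<^sup>2) \<in> Lp (p / 2)"
    using F(3) unfolding Lp_def mem_Collect_eq pw by (intro conjI borel_measurable_power) auto
  ultimately show ?thesis by (rule hardy_plusI)
qed

text \<open>
  If \<open>u f \<in> H\<^sub>p\<close> with \<open>u\<close> real, then \<open>(u\<^sup>2 + 1) f\<^sup>2\<close> and \<open>((u + 1)\<^sup>2 + 1) f\<^sup>2\<close> lie in \<open>H\<^sub>p\<^sub>/\<^sub>2\<close>,
  so that rigidity makes both \<open>u\<^sup>2\<close> and \<open>(u + 1)\<^sup>2\<close> constant.
\<close>

lemma square_rigid_real_multiplier_const:
  fixes u :: "real \<Rightarrow> real"
  assumes p: "p > 1" and f: "square_rigid_plus p f"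
    and u: "(\<lambda>x. of_real (u x) * f x) \<in> hardy_plus p"
  shows "\<exists>k. AE x in lebesgue. u x = k"
proof -
  have p0: "p > 0" using p by simp
  have out: "outer_plus p f" and rig: "rigid (p / 2) (\<lambda>x. (f x)\<^sup>2)" using f by (auto simp: square_rigid_plus_def)
  have fh: "f \<in> hardy_plus p" and f0: "AE x in lebesgue. f x \<noteq> 0"
    using out by (auto simp: outer_plus_def hardy_plus_def)
  have key: "\<exists>l. AE x in lebesgue. (v x)\<^sup>2 + 1 = l" if v: "(\<lambda>x. of_real (v x) * f x) \<in> hardy_plus p" for v :: "real \<Rightarrow> real"
  proof -
    \<comment> \<open>The added square of f makes the quotient v^2 + 1 strictly positive, also where
      v vanishes.\<close>
    define g where "g = (\<lambda>x. (of_real (v x) * f x)\<^sup>2 + (f x)\<^sup>2)"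
    have g: "g \<in> hardy_plus (p / 2)" unfolding g_def
      by (intro hardy_plus_add hardy_plus_square p0 v fh) (use p in simp)
    have q: "g x / (f x)\<^sup>2 = of_real ((v x)\<^sup>2 + 1)" if "f x \<noteq> 0" for x
      using that by (simp add: g_def power_mult_distrib add_divide_distrib)
    have "AE x in lebesgue. g x / (f x)\<^sup>2 \<in> \<real> \<and> Re (g x / (f x)\<^sup>2) > 0"
      using f0
    proof eventually_elim
      case (elim x)
      show ?case unfolding q[OF elim] Re_complex_of_real by (simp add: add_nonneg_pos del: of_real_add)
    qed
    then obtain l where "AE x in lebesgue. g x = of_real l * (f x)\<^sup>2"
      using rig g unfolding rigid_def by blast
    then have "AE x in lebesgue. (v x)\<^sup>2 + 1 = l"
      using f0
    proof eventually_elim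
      case (elim x)
      then have "complex_of_real ((v x)\<^sup>2 + 1) = of_real l" unfolding q[OF elim(2), symmetric] by simp
      then show ?case by (simp only: of_real_eq_iff)
    qed
    then show ?thesis by blast
  qed
  obtain l where l: "AE x in lebesgue. (u x)\<^sup>2 + 1 = l" using key[OF u] by blast
  have "(\<lambda>x. of_real (u x + 1) * f x) \<in> hardy_plus p"
    using hardy_plus_add[OF p0 u fh] by (simp add: algebra_simps)
  from key[OF this] obtain m where m: "AE x in lebesgue. (u x + 1)\<^sup>2 + 1 = m" by blast
  \<comment> \<open>(u + 1)^2 - u^2 = 2 u + 1 determines u, including its sign.\<close>
  have "AE x in lebesgue. u x = (m - l - 1) / 2"
    using l m by eventually_elim (simp add: power2_eq_square algebra_simps)
  then show ?thesis by blast
qed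

lemma square_rigid_real_multiplier_locale:
  assumes p: "p > 1" and f: "square_rigid_plus p f"
  shows "\<exists>F. real_multiplier_const p f F"
proof -
  have out: "outer_plus p f" using f by (simp add: square_rigid_plus_def)
  then obtain c where c: "norm c = 1" 
    "hardy_fun p (\<lambda>z. c * outer_exp (\<lambda>t. ln (norm (f t))) z)"
    "boundary_value (\<lambda>z. c * outer_exp (\<lambda>t. ln (norm (f t))) z) f"
    by (auto simp: outer_plus_def)
  have "real_multiplier_const p f (\<lambda>z. c * outer_exp (\<lambda>t. ln (norm (f t))) z)"
  proof
    show "c * outer_exp (\<lambda>t. ln (norm (f t))) z \<noteq> 0" for z
      using c(1) by (auto simp: outer_exp_def)
  qed (use out c p square_rigid_real_multiplier_const[OF p f] in \<open>auto simp: outer_plus_def\<close>)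
  then show ?thesis by blast
qed

section \<open>The Cauchy kernel\<close>

lemma integrable_one_plus_abs_powr:
  assumes p: "(p::real) > 1"
  shows "integrable lborel (\<lambda>x::real. (1 + \<bar>x\<bar>) powr (- p))"
proof -
  define h where "h = (\<lambda>x::real. (1 + x) powr (- p) * indicator {0..} x)"
  have hm [measurable]: "h \<in> borel_measurable borel" unfolding h_def by measurable
  have "(\<integral>\<^sup>+x. ennreal ((1 + x) powr (- p)) * indicator {0..} x \<partial>lborel) = ennreal (0 - ((- 1 / (p - 1)) * (1 + 0) powr (1 - p)))"
  proof (rule nn_integral_FTC_atLeast)
    fix x :: real assume x: "0 \<le> x"
    have "((\<lambda>x. (1 + x) powr (1 - p)) has_real_derivative ((1 - p) * (1 + x) powr (1 - p - 1)) * 1) (at x)"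
      by (rule DERIV_chain2[where f = "\<lambda>x. x powr (1 - p)", OF has_real_derivative_powr])
         (use x in \<open>auto intro!: derivative_eq_intros\<close>)
    then have "((\<lambda>x. (- 1 / (p - 1)) * (1 + x) powr (1 - p)) has_real_derivative (- 1 / (p - 1)) * (((1 - p) * (1 + x) powr (1 - p - 1)) * 1)) (at x)"
      by (rule DERIV_cmult)
    moreover have "(- 1 / (p - 1)) * (((1 - p) * (1 + x) powr (1 - p - 1)) * 1) = (1 + x) powr (- p)"
    proof -
      have "(- 1 / (p - 1)) * (1 - p) = 1" using p by (simp add: divide_eq_eq)
      then show ?thesis by (simp add: mult.assoc[symmetric])
    qed
    ultimately show "((\<lambda>x. (- 1 / (p - 1)) * (1 + x) powr (1 - p)) has_real_derivative (1 + x) powr (- p)) (at x)"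
      by simp
  next
    have "((\<lambda>x. (1 + x) powr (1 - p)) \<longlongrightarrow> 0) at_top"
      using p by (intro tendsto_neg_powr filterlim_tendsto_add_at_top[OF tendsto_const] filterlim_ident) auto
    then have "((\<lambda>x. (- 1 / (p - 1)) * (1 + x) powr (1 - p)) \<longlongrightarrow> (- 1 / (p - 1)) * 0) at_top"
      by (intro tendsto_intros)
    then show "((\<lambda>x. (- 1 / (p - 1)) * (1 + x) powr (1 - p)) \<longlongrightarrow> 0) at_top" by simp
  qed auto
  then have "(\<integral>\<^sup>+x. ennreal (h x) \<partial>lborel) < \<infinity>"
    by (simp add: h_def ennreal_mult' ennreal_indicator)
  then have hi: "integrable lborel h"
    by (intro integrableI_nonneg) (auto simp: h_def)
  have "integrable lborel (\<lambda>x. h (0 + (-1) * x))"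
    by (rule lborel_integrable_real_affine[OF hi]) simp
  with hi have "integrable lborel (\<lambda>x. h x + h (- x))" by simp
  then show ?thesis
    by (rule Bochner_Integration.integrable_bound) (auto intro!: AE_I2 simp: h_def indicator_def)
qed

lemma cauchy_kernel_hardy:
  assumes p: "p > 1"
  shows "hardy_fun p (\<lambda>z. 1 / (z + \<i>))" "boundary_value (\<lambda>z. 1 / (z + \<i>)) (\<lambda>x. 1 / (of_real x + \<i>))"
    "(\<lambda>x. 1 / (of_real x + \<i>)) \<in> Lp p"
proof -
  have nz: "z + \<i> \<noteq> 0" if "Im z \<ge> 0" for z using that by (auto simp: complex_eq_iff)
  \<comment> \<open>|z + i| is at least both |x| and 1, hence at least their mean, at every height y
    >= 0.\<close>
  have b: "norm (1 / (Complex x y + \<i>)) powr p \<le> 2 powr p * (1 + \<bar>x\<bar>) powr (- p)" if "y \<ge> 0" for x y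
  proof -
    have "\<bar>x\<bar> \<le> norm (Complex x y + \<i>)" "1 \<le> norm (Complex x y + \<i>)"
      using abs_Re_le_cmod[of "Complex x y + \<i>"] abs_Im_le_cmod[of "Complex x y + \<i>"] that by auto
    then have "2 / (2 * norm (Complex x y + \<i>)) \<le> 2 / (1 + \<bar>x\<bar>)"
      by (intro divide_left_mono mult_pos_pos add_pos_nonneg) linarith+
    then have "1 / norm (Complex x y + \<i>) \<le> 2 * (1 / (1 + \<bar>x\<bar>))" by simp
    then have "(1 / norm (Complex x y + \<i>)) powr p \<le> (2 * (1 / (1 + \<bar>x\<bar>))) powr p"
      using p by (intro powr_mono2) auto
    also have "\<dots> = 2 powr p * (1 + \<bar>x\<bar>) powr (- p)" by (simp add: powr_mult powr_divide powr_minus field_simps)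
    finally show ?thesis by (simp add: norm_divide)
  qed
  have hi: "integrable lebesgue (\<lambda>x::real. 2 powr p * (1 + \<bar>x\<bar>) powr (- p))"
    using integrable_one_plus_abs_powr[OF p] by (intro integrable_mult_right) (simp add: integrable_completion)
  have zero: "hardy_fun p (\<lambda>z. 0)" by (simp add: hardy_fun_def)
  show "hardy_fun p (\<lambda>z. 1 / (z + \<i>))"
  \<comment> \<open>Domination by the zero function: the integrable majorant carries the whole
    estimate.\<close>
  proof (rule hardy_fun_dominated[OF zero _ _ hi, where C = 0])
    show "(\<lambda>z. 1 / (z + \<i>)) holomorphic_on upper_half_plane"
      by (intro holomorphic_intros) (auto simp: upper_half_plane_def complex_eq_iff)
  qed (use b in auto)
  have c: "isCont (\<lambda>z. 1 / (z + \<i>)) (of_real x)" for x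
    using nz[of "of_real x"] by (intro continuous_intros) auto
  show "boundary_value (\<lambda>z. 1 / (z + \<i>)) (\<lambda>x. 1 / (of_real x + \<i>))"
    by (rule boundary_value_continuous[OF c])
  have m: "(\<lambda>x. 1 / (complex_of_real x + \<i>)) \<in> borel_measurable lebesgue"
    by (rule real_line_measurable[OF c])
  have "integrable lebesgue (\<lambda>x. norm (1 / (complex_of_real x + \<i>)) powr p)"
  proof (rule Bochner_Integration.integrable_bound[OF hi])
    show "AE x in lebesgue. norm (norm (1 / (complex_of_real x + \<i>)) powr p) \<le> norm (2 powr p * (1 + \<bar>x\<bar>) powr (- p))"
      using b[of 0] by (intro AE_I2) (simp add: Complex_eq)
  qed (use m in measurable)
  with m show "(\<lambda>x. 1 / (of_real x + \<i>)) \<in> Lp p" by (simp add: Lp_def)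
qed

text \<open>For a suitable constant \<open>\<alpha>\<close>, the function s = (u -
  \<open>\<alpha>\<close>)/(x - i) lies in H_p^+. As u is real, its conjugate is (u - cnj
  \<open>\<alpha>\<close>)/(x + i), which lies in H_p^+ as well. Hence s = 0.\<close>

lemma cauchy_kernel_real_multiplier_const:
  fixes u :: "real \<Rightarrow> real"
  assumes p: "p > 1" and u: "(\<lambda>x. of_real (u x) * (1 / (of_real x + \<i>))) \<in> hardy_plus p"
  shows "\<exists>k. AE x in lebesgue. u x = k"
proof -
  have p0: "p > 0" using p by simp
  note ck = cauchy_kernel_hardy[OF p]
  have ckh: "(\<lambda>x. 1 / (of_real x + \<i>)) \<in> hardy_plus p" by (rule hardy_plusI[OF ck])
  define f where "f = (\<lambda>x. of_real (u x) * (1 / (of_real x + \<i>)))"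
  have fh: "f \<in> hardy_plus p" using u by (simp add: f_def)
  obtain F where F: "hardy_fun p F" "boundary_value F f" "f \<in> Lp p" using hardy_plusE[OF fh] .
  \<comment> \<open>The value at i of F z (z + i), the extension of u; subtracting
    \<open>\<alpha>\<close>/(z + i) from F creates a zero at i.\<close>
  define \<alpha> where "\<alpha> = F \<i> * (2 * \<i>)"
  have L: "hardy_fun p (\<lambda>z. 1 / (z + \<i>) * (- \<alpha>))"
    by (rule hardy_fun_mult_bounded[OF p0 ck(1), where C = "norm \<alpha>"]) auto
  have Ll: "boundary_value (\<lambda>z. 1 / (z + \<i>) * (- \<alpha>)) (\<lambda>x. 1 / (of_real x + \<i>) * (- \<alpha>))"
    by (intro boundary_value_mult ck boundary_value_continuous) auto
  have LL: "(\<lambda>x. 1 / (of_real x + \<i>) * (- \<alpha>)) \<in> Lp p"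
    using hardy_plus_scale[OF p0 ckh, of "- \<alpha>"] by (simp add: hardy_plus_def)
  define f1 where "f1 = (\<lambda>x. f x + 1 / (of_real x + \<i>) * (- \<alpha>))"
  have f1: "f1 \<in> hardy_plus p" unfolding f1_def
    by (rule hardy_plusI[OF hardy_fun_add[OF p0 F(1) L] boundary_value_add[OF F(2) Ll] Lp_add[OF p0 F(3) LL]])
  have d: "(\<lambda>x. f1 x / (of_real x - \<i>)) \<in> hardy_plus p" unfolding f1_def
    by (rule hardy_plus_divide_zero[OF p0 hardy_fun_add[OF p0 F(1) L] boundary_value_add[OF F(2) Ll] Lp_add[OF p0 F(3) LL]])
       (simp_all add: \<alpha>_def complex_eq_iff)
  \<comment> \<open>This is f1 (x + i)/(x - i), written as f1 + 2 i f1/(x - i) so that both summands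
    are visibly in H_p^+.\<close>
  define s where "s = (\<lambda>x. f1 x + 2 * \<i> * (f1 x / (of_real x - \<i>)))"
  have s: "s \<in> hardy_plus p" unfolding s_def by (intro hardy_plus_add hardy_plus_scale p0 f1 d)
  have nz: "complex_of_real x - \<i> \<noteq> 0" "complex_of_real x + \<i> \<noteq> 0" for x by (auto simp: complex_eq_iff)
  have s_eq: "s x = (of_real (u x) - \<alpha>) / (of_real x - \<i>)" for x
  proof -
    have f1x: "f1 x = (of_real (u x) - \<alpha>) / (of_real x + \<i>)"
      by (simp add: f1_def f_def diff_divide_distrib)
    have "s x = f1 x * ((of_real x + \<i>) / (of_real x - \<i>))"
      unfolding s_def using nz[of x] by (simp add: field_simps)
    then show ?thesis unfolding f1x using nz[of x] by simp
  qed
  have "(\<lambda>x. f x - cnj \<alpha> * (1 / (of_real x + \<i>))) \<in> hardy_plus p"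
    by (intro hardy_plus_diff hardy_plus_scale p0 fh ckh)
  moreover have "cnj (s x) = f x - cnj \<alpha> * (1 / (of_real x + \<i>))" for x
    by (simp add: s_eq f_def diff_divide_distrib)
  ultimately have cs: "(\<lambda>x. cnj (s x)) \<in> hardy_plus p" by simp
  have "AE x in lebesgue. u x = Re \<alpha>"
    using hardy_plus_cnj_zero[OF p s cs]
  proof eventually_elim
    case (elim x)
    then have "of_real (u x) = \<alpha>" using nz[of x] by (simp add: s_eq)
    then show ?case by (metis Re_complex_of_real)
  qed
  then show ?thesis by blast
qed

lemma cauchy_kernel_real_multiplier_locale:
  assumes p: "p > 1"
  shows "real_multiplier_const p (\<lambda>x. 1 / (of_real x + \<i>)) (\<lambda>z. 1 / (z + \<i>))"
proof
  have nz: "z + \<i> \<noteq> 0" if "Im z \<ge> 0" for z using that by (auto simp: complex_eq_iff)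
  show "1 / (z + \<i>) \<noteq> 0" if "Im z > 0" for z using nz[of z] that by simp
  show "AE x in lebesgue. 1 / (complex_of_real x + \<i>) \<noteq> 0" using nz by (intro AE_I2) simp
qed (use p cauchy_kernel_hardy[OF p] cauchy_kernel_real_multiplier_const[OF p] in auto)

section \<open>Kernels with rational structure\<close>


lemma blaschke_eq_zpoly:
  "(\<Prod>a\<leftarrow>as. (z - a) / (z - cnj a)) = poly (zpoly as) z / poly (zpoly (map cnj as)) z"
proof (induction as)
  case (Cons a as)
  have "poly (zpoly (a # as)) z = (z - a) * poly (zpoly as) z" 
    "poly (zpoly (map cnj (a # as))) z = (z - cnj a) * poly (zpoly (map cnj as)) z"
    by (simp_all add: algebra_simps)
  then show ?case using Cons by (simp only: list.map prod_list.Cons times_divide_times_eq)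
qed simp

lemma cnj_poly_of_real: "cnj (poly q (of_real x)) = poly (map_poly cnj q) (of_real x)"
  using poly_cnj[of q "of_real x"] by (simp only: complex_cnj_complex_of_real)

lemma borel_measurable_cnj [measurable (raw)]:
  "f \<in> borel_measurable M \<Longrightarrow> (\<lambda>x. cnj (f x)) \<in> borel_measurable M"
  by (rule borel_measurable_continuous_on[where f = cnj]) (intro continuous_intros)

lemma poly_real_line_measurable [measurable]: "(\<lambda>x. poly q (complex_of_real x)) \<in> borel_measurable lebesgue"
  by (rule real_line_measurable) simp

text \<open>Stated for a general W because it is applied twice: with W = O_+ for the symbol of the
  theorem, and with W = \<open>\<omega>\<close> = 1/(x + i) for the model space. The hypothesis
  \<open>quot\<close> is Smirnov's theorem in the first case and immediate in the second, where
  \<open>\<omega>\<close>/W = 1.\<close>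

lemma (in real_multiplier_const) toeplitz_kernel_rational:
  fixes W :: "real \<Rightarrow> complex" and c :: complex and as :: "complex list"
  assumes W: "W \<in> hardy_plus p" "AE x in lebesgue. W x \<noteq> 0"
    and quot: "\<And>\<phi>. \<phi> \<in> hardy_plus p \<Longrightarrow> (\<lambda>x. \<phi> x * \<omega> x / W x) \<in> Lp p \<Longrightarrow> (\<lambda>x. \<phi> x * \<omega> x / W x) \<in> hardy_plus p"
    and c: "norm c = 1" and as: "\<forall>a\<in>set as. Im a > 0"
    and B: "\<And>x. B (complex_of_real x) = c * (poly (zpoly as) (of_real x) / poly (zpoly (map cnj as)) (of_real x))"
  shows "toeplitz_kernel p (\<lambda>x. cnj (\<omega> x) * cnj (B (of_real x)) * inverse (W x)) =
    {\<phi> \<in> borel_measurable lebesgue. \<exists>q. degree q \<le> length as \<and>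
      (AE x in lebesgue. \<phi> x = W x * (poly q (of_real x) / poly (zpoly (map cnj as)) (of_real x)))}"
    (is "toeplitz_kernel p ?g = ?K")
proof -
  define Z where "Z = (\<lambda>x. poly (zpoly (map cnj as)) (complex_of_real x))"
  have Z: "Z x \<noteq> 0" for x unfolding Z_def by (rule poly_zpoly_cnj_nonzero[OF as]) simp
  have B': "B (of_real x) = c * (cnj (Z x) / Z x)" for x
    using B cnj_poly_zpoly[of as x] by (metis Z_def complex_cnj_cnj)
  have cc: "cnj c * c = 1" using c complex_norm_square[of c] by (simp add: mult.commute)
  have Zm [measurable]: "Z \<in> borel_measurable lebesgue" unfolding Z_def by measurable
  note [measurable] = hardy_plus_measurable[OF W(1)]
  have gm [measurable]: "?g \<in> borel_measurable lebesgue" unfolding B' inverse_eq_divide by measurable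
  have cg: "cnj (?g x * \<phi>) = \<omega> x * (c * (cnj (Z x) / Z x)) * (cnj \<phi> / cnj (W x))" for x \<phi>
    unfolding B'[symmetric] by (simp add: divide_inverse)
  show ?thesis
  proof (intro subset_antisym subsetI)
    fix \<phi> assume "\<phi> \<in> ?K"
    then obtain q where \<phi>m [measurable]: "\<phi> \<in> borel_measurable lebesgue" and q: "degree q \<le> length as"
      "AE x in lebesgue. \<phi> x = W x * (poly q (of_real x) / Z x)" unfolding Z_def by blast
    have "\<phi> \<in> hardy_plus p"
      by (rule hardy_plus_cong_AE[OF hardy_plus_mult_rational[OF p0 W(1) as q(1)] \<phi>m]) (use q(2) in \<open>simp add: Z_def\<close>)
    moreover have "(\<lambda>x. cnj (?g x * \<phi> x)) \<in> hardy_plus p"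
    proof (rule hardy_plus_cong_AE)
      \<comment> \<open>Conjugation on the real line replaces q by the polynomial with conjugate
        coefficients and moves the claim from H_p^- to H_p^+; the factor conj Z of B cancels the
        conjugated denominator.\<close>
      show "(\<lambda>x. c * (\<omega> x * (poly (map_poly cnj q) (of_real x) / Z x))) \<in> hardy_plus p"
        unfolding Z_def
        by (intro hardy_plus_scale hardy_plus_mult_rational p0 omega_hardy as) (use q(1) in \<open>simp add: degree_map_poly\<close>)
      have "(\<lambda>x. ?g x * \<phi> x) \<in> borel_measurable lebesgue" by measurable
      then show "(\<lambda>x. cnj (?g x * \<phi> x)) \<in> borel_measurable lebesgue" by (rule borel_measurable_cnj)
      show "AE x in lebesgue. cnj (?g x * \<phi> x) = c * (\<omega> x * (poly (map_poly cnj q) (of_real x) / Z x))"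
        using q(2) W(2)
      proof eventually_elim
        case (elim x)
        have e: "w * (c * (cnj z / z)) * (cnj (V * (q / z)) / cnj V) = c * (w * (cnj q / z))"
          if "z \<noteq> 0" "V \<noteq> 0" for w V q z using that by simp
        show ?case unfolding cg unfolding elim(1) cnj_poly_of_real[symmetric] by (rule e[OF Z elim(2)])
      qed
    qed
    ultimately show "\<phi> \<in> toeplitz_kernel p ?g"
      unfolding toeplitz_kernel_eq[OF p0] by (simp only: mem_Collect_eq hardy_minus_def)
  next
    fix \<phi> assume "\<phi> \<in> toeplitz_kernel p ?g"
    then have \<phi>: "\<phi> \<in> hardy_plus p" and m: "(\<lambda>x. ?g x * \<phi> x) \<in> hardy_minus p"
      unfolding toeplitz_kernel_eq[OF p0] by auto
    have cm: "(\<lambda>x. cnj (?g x * \<phi> x)) \<in> hardy_plus p" using m by (simp only: hardy_minus_def mem_Collect_eq)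
    note \<phi>m [measurable] = hardy_plus_measurable[OF \<phi>]
    \<comment> \<open>Chosen so that \<open>\<phi> \<omega>\<close> / W = t \<open>\<omega>\<close>
      / Z, while the conjugate of the symbol times \<open>\<phi>\<close> is c conj t
      \<open>\<omega>\<close> / Z.\<close>
    define t where "t = (\<lambda>x. \<phi> x * Z x / W x)"
    have tm [measurable]: "t \<in> borel_measurable lebesgue" unfolding t_def by measurable
    have "(\<lambda>x. \<phi> x * \<omega> x / W x) \<in> Lp p"
    proof (rule Lp_bound[OF p0])
      show "(\<lambda>x. ?g x * \<phi> x) \<in> Lp p" using m hardy_minus_subset_Lp by blast
      show "(\<lambda>x. \<phi> x * \<omega> x / W x) \<in> borel_measurable lebesgue" by measurable
      \<comment> \<open>B is unimodular on the line, so \<open>\<phi> \<omega>\<close> / W has the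
        same modulus as the symbol times \<open>\<phi>\<close>, which is in L_p.\<close>
      have "norm (B (of_real x)) = 1" for x unfolding B' using c Z[of x] by (simp add: norm_mult norm_divide)
      then show "AE x in lebesgue. norm (\<phi> x * \<omega> x / W x) \<le> 1 * norm (?g x * \<phi> x)"
        by (intro AE_I2) (simp add: norm_mult norm_divide norm_inverse divide_inverse mult_ac)
    qed
    from quot[OF \<phi> this] have "(\<lambda>x. t x * \<omega> x / Z x) \<in> hardy_plus p"
      using Z by (simp add: t_def mult_ac)
    moreover have "(\<lambda>x. cnj (t x) * \<omega> x / Z x) \<in> hardy_plus p"
    proof -
      have "cnj (t x) * \<omega> x / Z x = cnj c * cnj (?g x * \<phi> x)" for x
      proof -
        have "cnj c * cnj (?g x * \<phi> x) = (cnj c * c) * (\<omega> x * (cnj (Z x) / Z x) * (cnj (\<phi> x) / cnj (W x)))"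
          unfolding cg by (simp only: mult_ac)
        then show ?thesis unfolding cc by (simp add: t_def mult_ac)
      qed
      then show ?thesis using hardy_plus_scale[OF p0 cm, of "cnj c"] by simp
    qed
    ultimately obtain q :: "complex poly" where q: "degree q \<le> length as" "AE x in lebesgue. t x = poly q (of_real x)"
      using quotient_poly[OF as tm] unfolding Z_def by blast
    have "AE x in lebesgue. \<phi> x = W x * (poly q (of_real x) / Z x)"
      using q(2) W(2)
    proof eventually_elim
      case (elim x)
      then show ?case using Z[of x] by (simp add: elim(1)[symmetric] t_def)
    qed
    with q(1) \<phi>m show "\<phi> \<in> ?K" unfolding Z_def by blast
  qed
qed

section \<open>The minimal kernel and its description by the model space\<close>

theorem theorem4p8:
  fixes p :: real
    and f Oplus Ominus :: "real \<Rightarrow> complex"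
    and B :: "complex \<Rightarrow> complex"
  assumes "1 < p"
    and "f \<in> hardy_plus p"
    and "\<not> (AE x in lebesgue. f x = 0)"
    and "finite_blaschke B"
    and "outer_plus p Oplus"
    and "AE x in lebesgue. f x = B (complex_of_real x) * Oplus x"
    and "outer_minus p Ominus"
    and "square_rigid_minus p Ominus"
  shows "min_kernel_exists p f \<and>
    min_kernel p f =
      toeplitz_kernel p (\<lambda>x. Ominus x * cnj (B (complex_of_real x)) * inverse (Oplus x)) \<and>
    toeplitz_kernel p (\<lambda>x. Ominus x * cnj (B (complex_of_real x)) * inverse (Oplus x)) =
      mult_set (\<lambda>x. Oplus x * (complex_of_real x + \<i>))
        (model_space p (\<lambda>x. r_fun (complex_of_real x) * B (complex_of_real x)))"
proof -
  have p: "p > 1" and p0: "p > 0" using assms(1) by auto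
  obtain c as where c: "norm c = 1" and as: "\<forall>a\<in>set as. Im a > 0"
    and B_def: "B = (\<lambda>z. c * (\<Prod>a\<leftarrow>as. (z - a) / (z - cnj a)))"
    using assms(4) unfolding finite_blaschke_def by blast
  have B: "B (complex_of_real x) = c * (poly (zpoly as) (of_real x) / poly (zpoly (map cnj as)) (of_real x))" for x
    unfolding B_def blaschke_eq_zpoly ..
  define Z where "Z = (\<lambda>x. poly (zpoly (map cnj as)) (complex_of_real x))"
  have Z: "Z x \<noteq> 0" for x unfolding Z_def by (rule poly_zpoly_cnj_nonzero[OF as]) simp
  have Zm [measurable]: "Z \<in> borel_measurable lebesgue" unfolding Z_def by measurable
  have B': "B (of_real x) = c * (cnj (Z x) / Z x)" for x
    using B cnj_poly_zpoly[of as x] by (metis Z_def complex_cnj_cnj)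
  have W: "Oplus \<in> hardy_plus p" "AE x in lebesgue. Oplus x \<noteq> 0"
    using assms(5) by (auto simp: outer_plus_def hardy_plus_def)
  define g where "g = (\<lambda>x. Ominus x * cnj (B (complex_of_real x)) * inverse (Oplus x))"
  define K where "K = {\<phi> \<in> borel_measurable lebesgue. \<exists>q. degree q \<le> length as \<and>
      (AE x in lebesgue. \<phi> x = Oplus x * (poly q (of_real x) / Z x))}"
  define M where "M = {k \<in> borel_measurable lebesgue. \<exists>q. degree q \<le> length as \<and>
      (AE x in lebesgue. k x = 1 / (of_real x + \<i>) * (poly q (of_real x) / Z x))}"
  have K: "toeplitz_kernel p g = K"
  proof -
    obtain F where "real_multiplier_const p (\<lambda>x. cnj (Ominus x)) F"
      using square_rigid_real_multiplier_locale[OF p] assms(8) by (auto simp: square_rigid_minus_def)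
    then interpret real_multiplier_const p "\<lambda>x. cnj (Ominus x)" F .
    have "outer_plus p (\<lambda>x. cnj (Ominus x))" using assms(7) by (simp add: outer_minus_def)
    from toeplitz_kernel_rational[OF W hardy_plus_mult_outer_quotient[OF p _ this assms(5)] c as B]
    show ?thesis by (simp add: g_def K_def Z_def)
  qed
  have c0: "c \<noteq> 0" using c by (metis norm_zero zero_neq_one)
  have M: "model_space p (\<lambda>x. r_fun (complex_of_real x) * B (complex_of_real x)) = M"
  proof -
    interpret real_multiplier_const p "\<lambda>x. 1 / (of_real x + \<i>)" "\<lambda>z. 1 / (z + \<i>)"
      by (rule cauchy_kernel_real_multiplier_locale[OF p])
    have nz: "complex_of_real x + \<i> \<noteq> 0" "complex_of_real x - \<i> \<noteq> 0" for x by (auto simp: complex_eq_iff)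
    \<comment> \<open>On the real line conj r = (x + i)/(x - i), the quotient conj
      \<open>\<omega>\<close> / \<open>\<omega>\<close> for \<open>\<omega>\<close> = 1/(x +
      i).\<close>
    have "cnj (r_fun (of_real x) * B (of_real x)) = cnj (1 / (of_real x + \<i>)) * cnj (B (of_real x)) * inverse (1 / (of_real x + \<i>))" for x
      using nz[of x] by (simp add: r_fun_def divide_inverse mult_ac)
    then have "model_space p (\<lambda>x. r_fun (complex_of_real x) * B (complex_of_real x)) =
      toeplitz_kernel p (\<lambda>x. cnj (1 / (of_real x + \<i>)) * cnj (B (of_real x)) * inverse (1 / (of_real x + \<i>)))"
      unfolding model_space_def by simp
    also have "\<dots> = M" unfolding M_def Z_def
      by (rule toeplitz_kernel_rational[OF omega_hardy nonzero _ c as B]) (use nz in simp)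
    finally show ?thesis .
  qed
  have KM: "K = mult_set (\<lambda>x. Oplus x * (complex_of_real x + \<i>)) M"
  proof (intro subset_antisym subsetI)
    have nz: "complex_of_real x + \<i> \<noteq> 0" for x by (auto simp: complex_eq_iff)
    {
      fix \<phi> assume "\<phi> \<in> K"
      then obtain q where \<phi>: "\<phi> \<in> borel_measurable lebesgue" "degree q \<le> length as"
        "AE x in lebesgue. \<phi> x = Oplus x * (poly q (of_real x) / Z x)" unfolding K_def by blast
      define k where "k = (\<lambda>x. 1 / (of_real x + \<i>) * (poly q (of_real x) / Z x))"
      have "k \<in> borel_measurable lebesgue" unfolding k_def by measurable
      then have "k \<in> M" using \<phi>(2) unfolding M_def k_def by auto
      moreover have "AE x in lebesgue. \<phi> x = Oplus x * (of_real x + \<i>) * k x"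
        using \<phi>(3) by (rule AE_mp) (use nz in \<open>auto intro!: AE_I2 simp: k_def\<close>)
      ultimately show "\<phi> \<in> mult_set (\<lambda>x. Oplus x * (complex_of_real x + \<i>)) M"
        using \<phi>(1) unfolding mult_set_def by blast
    next
      fix \<phi> assume "\<phi> \<in> mult_set (\<lambda>x. Oplus x * (complex_of_real x + \<i>)) M"
      then obtain k where k: "\<phi> \<in> borel_measurable lebesgue" "k \<in> M"
        "AE x in lebesgue. \<phi> x = Oplus x * (of_real x + \<i>) * k x" unfolding mult_set_def by blast
      then obtain q where q: "degree q \<le> length as" 
        "AE x in lebesgue. k x = 1 / (of_real x + \<i>) * (poly q (of_real x) / Z x)" unfolding M_def by blast
      have "AE x in lebesgue. \<phi> x = Oplus x * (poly q (of_real x) / Z x)"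
        using k(3) q(2) by eventually_elim (use nz in simp)
      with k(1) q(1) show "\<phi> \<in> K" unfolding K_def by blast
    }
  qed
  have fK: "f \<in> K"
  proof -
    \<comment> \<open>f itself belongs to q = c A, of full degree.\<close>
    have "degree (smult c (zpoly as)) \<le> length as" using zpoly_monic[of as] by (simp add: degree_smult_le)
    moreover have "AE x in lebesgue. f x = Oplus x * (poly (smult c (zpoly as)) (of_real x) / Z x)"
      using assms(6) by eventually_elim (simp add: B Z_def)
    ultimately show ?thesis using hardy_plus_measurable[OF assms(2)] unfolding K_def by blast
  qed
  have min: "is_min_kernel p f K"
    unfolding is_min_kernel_def
  proof (intro conjI ballI impI fK)
    have "(\<lambda>x. g x * f x) \<in> hardy_minus p" using fK unfolding K[symmetric] toeplitz_kernel_eq[OF p0] by simp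
    then have gf: "(\<lambda>x. g x * f x) \<in> Lp p" using hardy_minus_subset_Lp by blast
    have "(\<lambda>x. cnj (Ominus x)) \<in> borel_measurable lebesgue"
      using assms(7) by (simp add: outer_minus_def outer_plus_def Lp_def)
    then have "(\<lambda>x. cnj (cnj (Ominus x))) \<in> borel_measurable lebesgue" by (rule borel_measurable_cnj)
    then have [measurable]: "Ominus \<in> borel_measurable lebesgue" by (simp only: complex_cnj_cnj)
    note [measurable] = hardy_plus_measurable[OF W(1)]
    have "g \<in> borel_measurable lebesgue" unfolding g_def B' inverse_eq_divide by measurable
    \<comment> \<open>The nonzero function f witnesses that the domain of the Toeplitz operator is
      nontrivial.\<close>
    then have "g \<in> symbol_class p"
      unfolding symbol_class_def by (intro CollectI conjI bexI[of _ f] gf assms)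
    then show "\<exists>k\<in>symbol_class p. K = toeplitz_kernel p k" using K by auto
  next
    fix h assume h: "h \<in> symbol_class p" and fh: "f \<in> toeplitz_kernel p h"
    have hm [measurable]: "h \<in> borel_measurable lebesgue" using h by (simp add: symbol_class_def)
    have hf: "(\<lambda>x. cnj (h x * f x)) \<in> hardy_plus p"
      using fh unfolding toeplitz_kernel_eq[OF p0] hardy_minus_def by simp
    show "K \<subseteq> toeplitz_kernel p h"
    proof
      fix \<phi> assume \<phi>K: "\<phi> \<in> K"
      then obtain q where \<phi>m [measurable]: "\<phi> \<in> borel_measurable lebesgue" and q: "degree q \<le> length as"
        "AE x in lebesgue. \<phi> x = Oplus x * (poly q (of_real x) / Z x)" unfolding K_def by blast
      have "\<phi> \<in> hardy_plus p" using \<phi>K unfolding K[symmetric] toeplitz_kernel_eq[OF p0] by simp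
      moreover have "(\<lambda>x. cnj (h x * \<phi> x)) \<in> hardy_plus p"
      proof (rule hardy_plus_cong_AE)
        show "(\<lambda>x. inverse (cnj c) * (cnj (h x * f x) * (poly (map_poly cnj q) (of_real x) / Z x))) \<in> hardy_plus p"
          unfolding Z_def
          by (intro hardy_plus_scale hardy_plus_mult_rational p0 hf as) (use q(1) in \<open>simp add: degree_map_poly\<close>)
        have "(\<lambda>x. h x * \<phi> x) \<in> borel_measurable lebesgue" by measurable
        then show "(\<lambda>x. cnj (h x * \<phi> x)) \<in> borel_measurable lebesgue" by (rule borel_measurable_cnj)
        show "AE x in lebesgue. cnj (h x * \<phi> x) = inverse (cnj c) * (cnj (h x * f x) * (poly (map_poly cnj q) (of_real x) / Z x))"
          using q(2) assms(6)
        proof eventually_elim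
          case (elim x)
          \<comment> \<open>The conjugate of \<open>\<phi>\<close> / f is conj q / (conj c A#). Its
            denominator has no zeros in the closed upper half-plane, so multiplication by it
            preserves H_p^+.\<close>
          have e: "cnj (h * (W * (q / z))) = inverse (cnj c) * (cnj (h * (c * (cnj z / z) * W)) * (cnj q / z))"
            if "z \<noteq> 0" for h W q z using that c0 by simp
          show ?case unfolding elim(1) unfolding elim(2) B' cnj_poly_of_real[symmetric] by (rule e[OF Z])
        qed
      qed
      ultimately show "\<phi> \<in> toeplitz_kernel p h"
        unfolding toeplitz_kernel_eq[OF p0] hardy_minus_def by simp
    qed
  qed
  then have "min_kernel_exists p f" "min_kernel p f = K"
    by (auto simp: min_kernel_exists_def min_kernel_eqI)
  then show ?thesis using K KM M by (simp add: g_def)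
qed

end
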